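(* MaxNDP in unit-capacity graphs is $\mathsf{W}[1]$-hard when parameterized by the feedback vertex set number $r$ of the input graph. *)

theory Defs
  imports Main
begin

section \<open>Model of computation\<close>

text \<open>
  Jones's WHILE language over binary trees, with its unit-cost time measure. Sharing subtrees,
  a multi-tape Turing machine simulates a run of time \<open>t\<close> in time polynomial in \<open>t\<close> and the input
  length, and conversely. Inputs and outputs are bit strings, laid out along the right spine of a
  tree; a run of time \<open>t\<close> extends a spine by at most \<open>t\<close>, so outputs have length at most
  input length plus \<open>t\<close>.
\<close>

datatype tree = Leaf | Pair tree tree

fun left :: "tree \<Rightarrow> tree" where
  "left Leaf = Leaf"
| "left (Pair a b) = a"

fun right :: "tree \<Rightarrow> tree" where
  "right Leaf = Leaf"
| "right (Pair a b) = b"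

datatype expr = Var nat | Nl | Hd expr | Tl expr | Cns expr expr

type_synonym store = "nat \<Rightarrow> tree"

primrec eval :: "expr \<Rightarrow> store \<Rightarrow> tree" where
  "eval (Var i) s = s i"
| "eval Nl s = Leaf"
| "eval (Hd e) s = left (eval e s)"
| "eval (Tl e) s = right (eval e s)"
| "eval (Cns e e') s = Pair (eval e s) (eval e' s)"

primrec cost :: "expr \<Rightarrow> nat" where
  "cost (Var i) = 1"
| "cost Nl = 1"
| "cost (Hd e) = cost e + 1"
| "cost (Tl e) = cost e + 1"
| "cost (Cns e e') = cost e + cost e' + 1"

datatype com = Assign nat expr | Seq com com | If expr com com | While expr com

text \<open>\<open>exec c s t s'\<close>: started in \<open>s\<close>, program \<open>c\<close> halts in \<open>s'\<close> after exactly \<open>t\<close> time units.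
  A test succeeds iff the value is not \<open>Leaf\<close>.\<close>

inductive exec :: "com \<Rightarrow> store \<Rightarrow> nat \<Rightarrow> store \<Rightarrow> bool" where
  Assign: "exec (Assign i e) s (cost e + 1) (s(i := eval e s))"
| Seq: "exec c s t s' \<Longrightarrow> exec c' s' t' s'' \<Longrightarrow> exec (Seq c c') s (t + t') s''"
| IfTrue: "eval e s \<noteq> Leaf \<Longrightarrow> exec c s t s' \<Longrightarrow> exec (If e c c') s (cost e + 1 + t) s'"
| IfFalse: "eval e s = Leaf \<Longrightarrow> exec c' s t s' \<Longrightarrow> exec (If e c c') s (cost e + 1 + t) s'"
| WhileFalse: "eval e s = Leaf \<Longrightarrow> exec (While e c) s (cost e + 1) s"
| WhileTrue: "eval e s \<noteq> Leaf \<Longrightarrow> exec c s t s' \<Longrightarrow> exec (While e c) s' t' s'' \<Longrightarrow>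
    exec (While e c) s (cost e + 1 + t + t') s''"

type_synonym bits = "bool list"

primrec tree_of_bits :: "bits \<Rightarrow> tree" where
  "tree_of_bits [] = Leaf"
| "tree_of_bits (b # bs) = Pair (if b then Pair Leaf Leaf else Leaf) (tree_of_bits bs)"

text \<open>Input and output are held in variable 0; all other variables are initially \<open>Leaf\<close>.\<close>

definition run :: "com \<Rightarrow> bits \<Rightarrow> nat \<Rightarrow> bits \<Rightarrow> bool" where
  "run c x t y \<longleftrightarrow>
     (\<exists>s. exec c ((\<lambda>_. Leaf)(0 := tree_of_bits x)) t s \<and> s 0 = tree_of_bits y)"

definition computable :: "(nat \<Rightarrow> nat) \<Rightarrow> bool" where
  "computable f \<longleftrightarrow> (\<exists>c. \<forall>n. \<exists>t. run c (replicate n True) t (replicate (f n) True))"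


section \<open>Parameterized problems and fpt-reductions\<close>

text \<open>A language together with its parameterization. The parameterization is not required to be
  polynomial-time computable, as computing the feedback vertex set number is NP-hard.\<close>

type_synonym pproblem = "bits set \<times> (bits \<Rightarrow> nat)"

definition fpt_reducible :: "pproblem \<Rightarrow> pproblem \<Rightarrow> bool" (infix "\<le>\<^sub>f\<^sub>p\<^sub>t" 50) where
  "A \<le>\<^sub>f\<^sub>p\<^sub>t B \<longleftrightarrow>
     (\<exists>R c f g p. computable f \<and> computable g \<and>
        (\<forall>x. (\<exists>t \<le> f (snd A x) * (length x + 1) ^ p. run c x t (R x)) \<and>
             (x \<in> fst A \<longleftrightarrow> R x \<in> fst B) \<and>
             snd B (R x) \<le> g (snd A x)))"

text \<open>The problem with instances \<open>I\<close>, encoded by \<open>enc\<close>. Strings that encode no instance are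
  no-instances with parameter 0.\<close>

definition encoded_problem ::
    "('i \<Rightarrow> bits) \<Rightarrow> 'i set \<Rightarrow> ('i \<Rightarrow> bool) \<Rightarrow> ('i \<Rightarrow> nat) \<Rightarrow> pproblem" where
  "encoded_problem enc I yes par =
     (enc ` {i \<in> I. yes i}, \<lambda>x. if x \<in> enc ` I then par (inv_into I enc x) else 0)"

definition enc_nat :: "nat \<Rightarrow> bits" where
  "enc_nat n = replicate n True @ [False]"

definition enc_list :: "('a \<Rightarrow> bits) \<Rightarrow> 'a list \<Rightarrow> bits" where
  "enc_list enc xs = enc_nat (length xs) @ concat (map enc xs)"

fun enc_pair :: "nat \<times> nat \<Rightarrow> bits" where
  "enc_pair (a, b) = enc_nat a @ enc_nat b"

lemma enc_nat_append_eq [simp]: "enc_nat m @ xs = enc_nat n @ ys \<longleftrightarrow> m = n \<and> xs = ys"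
  unfolding enc_nat_def by (induction m arbitrary: n; case_tac n; auto)

lemma enc_list_append_eq:
  assumes "\<And>a b xs ys. enc a @ xs = enc b @ ys \<longleftrightarrow> a = b \<and> xs = ys"
  shows "enc_list enc as @ xs = enc_list enc bs @ ys \<longleftrightarrow> as = bs \<and> xs = ys"
proof -
  have "concat (map enc as) @ xs = concat (map enc bs) @ ys \<longleftrightarrow> as = bs \<and> xs = ys"
    if "length as = length bs"
    using that by (induction as bs rule: list_induct2) (auto simp: assms)
  then show ?thesis
    unfolding enc_list_def by auto
qed

lemma enc_pair_append_eq [simp]: "enc_pair a @ xs = enc_pair b @ ys \<longleftrightarrow> a = b \<and> xs = ys"
  by (cases a; cases b) auto


section \<open>The W-hierarchy\<close>

text \<open>
  A circuit with \<open>n\<close> inputs is a list of gates in topological order: node \<open>i < n\<close> is the \<open>i\<close>-th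
  input, node \<open>n + j\<close> is the \<open>j\<close>-th gate, and the last node is the output.
\<close>

datatype gate = Neg nat | And "nat list" | Or "nat list"

primrec preds :: "gate \<Rightarrow> nat list" where
  "preds (Neg i) = [i]"
| "preds (And is) = is"
| "preds (Or is) = is"

definition wf_circuit :: "nat \<Rightarrow> gate list \<Rightarrow> bool" where
  "wf_circuit n gs \<longleftrightarrow> n > 0 \<and>
     (\<forall>j < length gs. (\<forall>i \<in> set (preds (gs ! j)). i < n + j) \<and> distinct (preds (gs ! j))) \<and>
     (\<forall>is. And is \<in> set gs \<or> Or is \<in> set gs \<longrightarrow> length is \<ge> 2)"

text \<open>The value of \<open>f\<close> at the output, computed node by node from the values \<open>vs\<close> at the inputs.\<close>

definition at_output :: "(gate \<Rightarrow> 'v list \<Rightarrow> 'v) \<Rightarrow> 'v list \<Rightarrow> gate list \<Rightarrow> 'v" where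
  "at_output f vs gs = last (foldl (\<lambda>us g. us @ [f g (map ((!) us) (preds g))]) vs gs)"

primrec gate_value :: "gate \<Rightarrow> bool list \<Rightarrow> bool" where
  "gate_value (Neg i) bs = (\<not> hd bs)"
| "gate_value (And is) bs = (\<forall>b \<in> set bs. b)"
| "gate_value (Or is) bs = (\<exists>b \<in> set bs. b)"

definition circuit_value :: "gate list \<Rightarrow> bool list \<Rightarrow> bool" where
  "circuit_value gs bs = at_output gate_value bs gs"

text \<open>Maximal length of, respectively maximal number of large gates (of fan-in more than 2) on, a
  path from an input to the output.\<close>

definition depth :: "nat \<Rightarrow> gate list \<Rightarrow> nat" where
  "depth n gs = at_output (\<lambda>g ds. Max (set ds) + 1) (replicate n 0) gs"

definition weft :: "nat \<Rightarrow> gate list \<Rightarrow> nat" where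
  "weft n gs =
     at_output (\<lambda>g ws. Max (set ws) + (if length (preds g) > 2 then 1 else 0)) (replicate n 0) gs"

primrec enc_gate :: "gate \<Rightarrow> bits" where
  "enc_gate (Neg i) = enc_nat 0 @ enc_nat i"
| "enc_gate (And is) = enc_nat 1 @ enc_list enc_nat is"
| "enc_gate (Or is) = enc_nat 2 @ enc_list enc_nat is"

fun enc_circuit :: "nat \<times> gate list \<times> nat \<Rightarrow> bits" where
  "enc_circuit (n, gs, k) = enc_nat n @ enc_list enc_gate gs @ enc_nat k"

lemma enc_gate_append_eq: "enc_gate g @ xs = enc_gate h @ ys \<longleftrightarrow> g = h \<and> xs = ys"
  by (cases g; cases h) (auto simp: enc_list_append_eq[OF enc_nat_append_eq])

lemma inj_enc_circuit: "inj enc_circuit"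
proof (rule injI)
  fix a b :: "nat \<times> gate list \<times> nat"
  assume "enc_circuit a = enc_circuit b"
  then show "a = b"
    using enc_nat_append_eq[where xs = "[]" and ys = "[]"]
    by (cases a; cases b) (auto simp: enc_list_append_eq[OF enc_gate_append_eq])
qed

text \<open>Weighted circuit satisfiability for weft at most \<open>t\<close> and depth at most \<open>d\<close>: is there a
  satisfying assignment with exactly \<open>k\<close> true inputs?\<close>

definition WCS :: "nat \<Rightarrow> nat \<Rightarrow> pproblem" where
  "WCS t d = encoded_problem enc_circuit
     {(n, gs, k). wf_circuit n gs \<and> weft n gs \<le> t \<and> depth n gs \<le> d}
     (\<lambda>(n, gs, k). \<exists>bs. length bs = n \<and> count_list bs True = k \<and> circuit_value gs bs)
     (\<lambda>(n, gs, k). k)"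

definition W :: "nat \<Rightarrow> pproblem set" where
  "W t = {A. \<exists>d. A \<le>\<^sub>f\<^sub>p\<^sub>t WCS t d}"

definition W_hard :: "nat \<Rightarrow> pproblem \<Rightarrow> bool" where
  "W_hard t B \<longleftrightarrow> (\<forall>A \<in> W t. A \<le>\<^sub>f\<^sub>p\<^sub>t B)"


section \<open>Maximum node-disjoint paths\<close>

definition simple_graph :: "'a set \<Rightarrow> 'a set set \<Rightarrow> bool" where
  "simple_graph V E \<longleftrightarrow> finite V \<and> (\<forall>e \<in> E. e \<subseteq> V \<and> card e = 2)"

definition is_path :: "'a set \<Rightarrow> 'a set set \<Rightarrow> 'a \<Rightarrow> 'a list \<Rightarrow> 'a \<Rightarrow> bool" where
  "is_path V E u p v \<longleftrightarrow> p \<noteq> [] \<and> hd p = u \<and> last p = v \<and> set p \<subseteq> V \<and> distinct p \<and>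
     successively (\<lambda>x y. {x, y} \<in> E) p"

definition is_cycle :: "'a set \<Rightarrow> 'a set set \<Rightarrow> 'a list \<Rightarrow> bool" where
  "is_cycle V E p \<longleftrightarrow> length p \<ge> 3 \<and> set p \<subseteq> V \<and> distinct p \<and>
     successively (\<lambda>x y. {x, y} \<in> E) p \<and> {last p, hd p} \<in> E"

definition is_forest :: "'a set \<Rightarrow> 'a set set \<Rightarrow> bool" where
  "is_forest V E \<longleftrightarrow> (\<nexists>p. is_cycle V E p)"

definition feedback_vertex_set :: "'a set \<Rightarrow> 'a set set \<Rightarrow> 'a set \<Rightarrow> bool" where
  "feedback_vertex_set V E X \<longleftrightarrow> X \<subseteq> V \<and> is_forest (V - X) {e \<in> E. e \<inter> X = {}}"

definition fvs_number :: "'a set \<Rightarrow> 'a set set \<Rightarrow> nat" where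
  "fvs_number V E = (LEAST r. \<exists>X. feedback_vertex_set V E X \<and> card X = r)"

definition routable :: "'a set \<Rightarrow> 'a set set \<Rightarrow> ('a \<Rightarrow> nat) \<Rightarrow> ('a \<times> 'a) set \<Rightarrow> bool" where
  "routable V E cap M \<longleftrightarrow> (\<exists>P.
     (\<forall>(s, t) \<in> M. is_path V E s (P (s, t)) t) \<and>
     (\<forall>v \<in> V. card {m \<in> M. v \<in> set (P m)} \<le> cap v))"

definition max_ndp :: "'a set \<Rightarrow> 'a set set \<Rightarrow> ('a \<Rightarrow> nat) \<Rightarrow> ('a \<times> 'a) set \<Rightarrow> nat" where
  "max_ndp V E cap M = Max (card ` {M'. M' \<subseteq> M \<and> routable V E cap M'})"

text \<open>An instance \<open>(n, es, ms, l)\<close> consists of the vertices \<open>0, \<dots>, n - 1\<close>, the edges, the terminal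
  pairs, and the number of pairs to be routed.\<close>

type_synonym ndp_instance = "nat \<times> (nat \<times> nat) list \<times> (nat \<times> nat) list \<times> nat"

definition edges :: "(nat \<times> nat) list \<Rightarrow> nat set set" where
  "edges es = (\<lambda>(u, v). {u, v}) ` set es"

fun enc_ndp :: "ndp_instance \<Rightarrow> bits" where
  "enc_ndp (n, es, ms, l) = enc_nat n @ enc_list enc_pair es @ enc_list enc_pair ms @ enc_nat l"

lemma inj_enc_ndp: "inj enc_ndp"
proof (rule injI)
  fix a b :: ndp_instance
  assume "enc_ndp a = enc_ndp b"
  then show "a = b"
    using enc_nat_append_eq[where xs = "[]" and ys = "[]"]
    by (cases a; cases b) (auto simp: enc_list_append_eq[OF enc_pair_append_eq])
qed

definition ndp_instances :: "ndp_instance set" where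
  "ndp_instances = {(n, es, ms, l). simple_graph {..<n} (edges es) \<and>
     (\<forall>(s, t) \<in> set ms. s < n \<and> t < n \<and> s \<noteq> t)}"

definition MaxNDP_unit_fvs :: pproblem where
  "MaxNDP_unit_fvs = encoded_problem enc_ndp ndp_instances
     (\<lambda>(n, es, ms, l). max_ndp {..<n} (edges es) (\<lambda>_. 1) (set ms) \<ge> l)
     (\<lambda>(n, es, ms, l). fvs_number {..<n} (edges es))"

end

theory Submission
  imports Defs "HOL-Library.More_List"
begin

text \<open>
  Fix \<open>d\<close> and a circuit of weft at most 1 and depth at most \<open>d\<close>. Below a large gate, every node depends
  on at most \<open>2 ^ d\<close> inputs, and above them at most \<open>2 ^ d\<close> large gates matter; so the circuit accepts
  iff one of polynomially many CNFs with clauses of at most \<open>2 ^ d\<close> literals is satisfied. An assignment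
  of weight \<open>k\<close> is a division of the inputs into \<open>k + 1\<close> gaps between consecutive true inputs, and a
  falsified clause is witnessed by at most \<open>2 ^ d\<close> of the gaps. Hence a binary constraint satisfaction
  problem with one variable per \<open>2 ^ d\<close>-tuple of gap indices, whose values are the chosen CNF and the
  gaps themselves, is solvable iff there is a satisfying assignment of weight \<open>k\<close>.

  A binary constraint satisfaction problem with \<open>K\<close> variables becomes a disjoint paths instance whose
  graph consists of disjoint lines and at most \<open>3 * K\<^sup>2\<close> further vertices, the hubs, which form a feedback
  vertex set. Terminals of a pair lie on different lines, so each path uses a hub; asking for as many
  paths as there are hubs forces exactly one path through every hub. For each variable, two of these
  paths block all of its line except for the block of one value, and each pair of variables has a
  hub that serves only pairs whose terminals encode allowed pairs of values.
\<close>

section \<open>Polynomial-time programs on trees\<close>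

text \<open>Binary constraints see two variables at a time, whereas refuting a clause takes up to
  \<open>2 ^ d\<close> gaps. With a whole tuple of gap indices as one variable, the clause test
  becomes unary, at the price of \<open>(k + 1) ^ 2 ^ d\<close> variables, still a function of
  \<open>k\<close> for fixed \<open>d\<close>. Gaps are used rather than the true inputs alone
  because a false input must be visible locally too: it lies in a gap without being its right end.
  Each variable also carries the chosen CNF, so that all tuples test the same one. In the graph, the
  two paths around a ring could select different blocks. The second line of the ring excludes this:
  it is joined the other way round, so that disjointness on the two lines gives the two inequalities
  between the blocks. Running times are those of concrete programs. As sharing lets a tree grow
  exponentially in the time spent, time bounds come with size bounds; the composition with an
  arbitrary fpt-reduction uses instead that the height of a tree grows by at most the time
  spent.\<close>

definition poly_bounded :: "(nat \<Rightarrow> nat) \<Rightarrow> bool" where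
  "poly_bounded h \<longleftrightarrow> (\<exists>C q. \<forall>n. h n \<le> C * (n + 1) ^ q)"

lemma poly_boundedI: "(\<And>n. h n \<le> C * (n + 1) ^ q) \<Longrightarrow> poly_bounded h"
  unfolding poly_bounded_def by blast

lemma poly_bounded_le: "poly_bounded h \<Longrightarrow> (\<And>n. h' n \<le> h n) \<Longrightarrow> poly_bounded h'"
  unfolding poly_bounded_def by (meson order_trans)

text \<open>Sizes of intermediate results are only known up to an upper bound, and a time bound can
  be evaluated at such an upper bound only if it is monotone.\<close>

lemma poly_bounded_mono:
  assumes "poly_bounded h"
  obtains h' where "poly_bounded h'" "mono h'" "\<And>n. h n \<le> h' n"
proof -
  obtain C q where "\<And>n. h n \<le> C * (n + 1) ^ q"
    using assms unfolding poly_bounded_def by blast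
  moreover have "mono (\<lambda>n. C * (n + 1) ^ q)"
    by (auto intro!: monoI power_mono)
  ultimately show ?thesis
    using that[of "\<lambda>n. C * (n + 1) ^ q"] poly_boundedI[OF order_refl] by blast
qed

lemma poly_bounded_const: "poly_bounded (\<lambda>_. k)"
  by (rule poly_boundedI[where q = 0 and C = k]) simp

lemma poly_bounded_id: "poly_bounded (\<lambda>n. n)"
  by (rule poly_boundedI[where q = 1 and C = 1]) simp

lemma poly_bounded_add:
  assumes "poly_bounded f" "poly_bounded g"
  shows "poly_bounded (\<lambda>n. f n + g n)"
proof -
  obtain C q D r where *: "\<And>n. f n \<le> C * (n + 1) ^ q" "\<And>n. g n \<le> D * (n + 1) ^ r"
    using assms unfolding poly_bounded_def by blast
  show ?thesis
  proof (rule poly_boundedI)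
    fix n :: nat
    have "(n + 1) ^ q \<le> (n + 1) ^ (q + r)" "(n + 1) ^ r \<le> (n + 1) ^ (q + r)"
      using power_increasing[of q "q + r" "n + 1"] power_increasing[of r "q + r" "n + 1"]
      by simp_all
    then have "C * (n + 1) ^ q + D * (n + 1) ^ r \<le> C * (n + 1) ^ (q + r) + D * (n + 1) ^ (q + r)"
      by (intro add_mono mult_le_mono2)
    then show "f n + g n \<le> (C + D) * (n + 1) ^ (q + r)"
      using *[of n] by (simp add: algebra_simps)
  qed
qed

lemma poly_bounded_mult:
  assumes "poly_bounded f" "poly_bounded g"
  shows "poly_bounded (\<lambda>n. f n * g n)"
proof -
  obtain C q D r where *: "\<And>n. f n \<le> C * (n + 1) ^ q" "\<And>n. g n \<le> D * (n + 1) ^ r"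
    using assms unfolding poly_bounded_def by blast
  show ?thesis
  proof (rule poly_boundedI)
    fix n :: nat
    show "f n * g n \<le> (C * D) * (n + 1) ^ (q + r)"
      using mult_le_mono[OF *[of n]] by (simp add: algebra_simps power_add)
  qed
qed

lemma poly_bounded_power: "poly_bounded f \<Longrightarrow> poly_bounded (\<lambda>n. f n ^ e)"
  by (induction e) (auto intro: poly_bounded_const poly_bounded_mult)

lemma poly_bounded_comp:
  assumes "poly_bounded f" "poly_bounded g"
  shows "poly_bounded (\<lambda>n. f (g n))"
proof -
  obtain C q where *: "\<And>n. f n \<le> C * (n + 1) ^ q"
    using assms unfolding poly_bounded_def by blast
  have "poly_bounded (\<lambda>n. C * (g n + 1) ^ q)"
    by (intro poly_bounded_mult poly_bounded_const poly_bounded_power poly_bounded_add assms)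
  then show ?thesis
    by (rule poly_bounded_le) (rule *)
qed

lemmas poly_bounded_intros =
  poly_bounded_const poly_bounded_id poly_bounded_add poly_bounded_mult poly_bounded_power

primrec tsize :: "tree \<Rightarrow> nat" where
  "tsize Leaf = 1"
| "tsize (Pair a b) = tsize a + tsize b + 1"

lemma tsize_pos [simp]: "0 < tsize x"
  by (induction x) auto

lemma tsize_left: "tsize (left x) \<le> tsize x"
  by (cases x) auto

lemma tsize_right: "tsize (right x) \<le> tsize x"
  by (cases x) auto

text \<open>The variables above \<open>b\<close> are scratch space, and nothing is assumed about their initial values; so
  programs can be sequenced, and nested by raising the base \<open>b\<close>.\<close>

definition computes_at :: "nat \<Rightarrow> com \<Rightarrow> tree set \<Rightarrow> (tree \<Rightarrow> tree) \<Rightarrow> (nat \<Rightarrow> nat) \<Rightarrow> bool" where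
  "computes_at b c D F h \<longleftrightarrow> (\<forall>s. s b \<in> D \<longrightarrow>
     (\<exists>t s'. exec c s t s' \<and> t \<le> h (tsize (s b)) \<and> s' b = F (s b) \<and> (\<forall>i < b. s' i = s i)))"

lemma computes_atI:
  assumes "\<And>s x. x \<in> D \<Longrightarrow> s b = x \<Longrightarrow>
    \<exists>t s'. exec c s t s' \<and> t \<le> h (tsize x) \<and> s' b = F x \<and> (\<forall>i < b. s' i = s i)"
  shows "computes_at b c D F h"
  unfolding computes_at_def using assms by blast

lemma computes_atE:
  assumes "computes_at b c D F h" "s b = x" "x \<in> D"
  obtains t s' where "exec c s t s'" "t \<le> h (tsize x)" "s' b = F x" "\<And>i. i < b \<Longrightarrow> s' i = s i"
  using assms unfolding computes_at_def by blast

lemma computes_at_le: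
  assumes "computes_at b c D F h" "\<And>n. h n \<le> h' n"
  shows "computes_at b c D F h'"
  using assms unfolding computes_at_def by (meson order_trans)

text \<open>Size is bounded separately from time, since \<open>Cns\<close> shares subtrees and can
  double the size at constant cost. The polynomial is chosen before the base \<open>b\<close>, so
  nesting programs at higher bases does not affect the bounds.\<close>

definition tree_poly :: "tree set \<Rightarrow> (tree \<Rightarrow> tree) \<Rightarrow> bool" where
  "tree_poly D F \<longleftrightarrow> (\<exists>h. poly_bounded h \<and> (\<forall>x \<in> D. tsize (F x) \<le> h (tsize x)) \<and>
     (\<forall>b. \<exists>c. computes_at b c D F h))"

lemma tree_polyI:
  assumes "poly_bounded h" "poly_bounded h'" "\<And>x. x \<in> D \<Longrightarrow> tsize (F x) \<le> h (tsize x)"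
    and "\<And>b. \<exists>c. computes_at b c D F h'"
  shows "tree_poly D F"
  unfolding tree_poly_def
proof (intro exI[of _ "\<lambda>n. h n + h' n"] conjI allI ballI)
  show "poly_bounded (\<lambda>n. h n + h' n)"
    by (intro poly_bounded_add assms)
  show "tsize (F x) \<le> h (tsize x) + h' (tsize x)" if "x \<in> D" for x
    using assms(3)[OF that] by simp
  show "\<exists>c. computes_at b c D F (\<lambda>n. h n + h' n)" for b
    using assms(4)[of b] computes_at_le le_add2 by meson
qed

lemma tree_polyE:
  assumes "tree_poly D F"
  obtains h where "poly_bounded h" "mono h" "\<And>x. x \<in> D \<Longrightarrow> tsize (F x) \<le> h (tsize x)"
    and "\<And>b. \<exists>c. computes_at b c D F h"
proof -
  obtain h where h: "poly_bounded h" "\<And>x. x \<in> D \<Longrightarrow> tsize (F x) \<le> h (tsize x)"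
    "\<And>b. \<exists>c. computes_at b c D F h"
    using assms unfolding tree_poly_def by blast
  obtain h' where h': "poly_bounded h'" "mono h'" "\<And>n. h n \<le> h' n"
    using poly_bounded_mono[OF h(1)] by blast
  show ?thesis
  proof (rule that[OF h'(1,2)])
    show "tsize (F x) \<le> h' (tsize x)" if "x \<in> D" for x
      using h(2)[OF that] h'(3) order_trans by blast
    show "\<exists>c. computes_at b c D F h'" for b
      using h(3)[of b] h'(3) computes_at_le by meson
  qed
qed

section \<open>Assignments, composition and branching\<close>

lemma exec_AssignI: "t = cost e + 1 \<Longrightarrow> s' = s(i := eval e s) \<Longrightarrow> exec (Assign i e) s t s'"
  by (simp only: exec.Assign)

lemma exec_WhileFalseI: "t = cost e + 1 \<Longrightarrow> eval e s = Leaf \<Longrightarrow> exec (While e c) s t s"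
  by (simp only: exec.WhileFalse)

lemma tree_poly_expr:
  assumes "\<And>b. \<exists>e. cost e \<le> k \<and> (\<forall>s. eval e s = F (s b))"
    and "poly_bounded h" "\<And>x. tsize (F x) \<le> h (tsize x)"
  shows "tree_poly D F"
proof (rule tree_polyI[OF assms(2) poly_bounded_const[of "k + 1"] assms(3)])
  fix b
  obtain e where e: "cost e \<le> k" "\<And>s. eval e s = F (s b)"
    using assms(1) by blast
  have "computes_at b (Assign b e) D F (\<lambda>_. k + 1)"
  proof (rule computes_atI)
    fix s :: store and x
    assume x: "s b = x"
    show "\<exists>t s'. exec (Assign b e) s t s' \<and> t \<le> k + 1 \<and> s' b = F x \<and> (\<forall>i < b. s' i = s i)"
      by (intro exI conjI, rule exec.Assign) (use e x in auto)
  qed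
  then show "\<exists>c. computes_at b c D F (\<lambda>_. k + 1)" ..
qed

lemma tree_poly_id: "tree_poly D (\<lambda>x. x)"
proof (rule tree_poly_expr[where k = 1, OF _ poly_bounded_id])
  show "\<exists>e. cost e \<le> 1 \<and> (\<forall>s. eval e s = s b)" for b
    by (rule exI[of _ "Var b"]) simp
qed auto

lemma tree_poly_const: "tree_poly D (\<lambda>_. a)"
proof -
  have "\<exists>e. \<forall>s. eval e s = a"
  proof (induction a)
    case Leaf
    show ?case by (rule exI[of _ Nl]) simp
  next
    case (Pair a b)
    then obtain e e' where "\<forall>s. eval e s = a" "\<forall>s. eval e' s = b" by blast
    then show ?case by (intro exI[of _ "Cns e e'"]) simp
  qed
  then obtain e where "\<forall>s. eval e s = a" by blast
  then show ?thesis
    by (intro tree_poly_expr[where k = "cost e", OF _ poly_bounded_const[of "tsize a"]]) auto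
qed

lemma tree_poly_left: "tree_poly D left"
proof (rule tree_poly_expr[where k = 2, OF _ poly_bounded_id])
  show "\<exists>e. cost e \<le> 2 \<and> (\<forall>s. eval e s = left (s b))" for b
    by (rule exI[of _ "Hd (Var b)"]) simp
qed (rule tsize_left)

lemma tree_poly_right: "tree_poly D right"
proof (rule tree_poly_expr[where k = 2, OF _ poly_bounded_id])
  show "\<exists>e. cost e \<le> 2 \<and> (\<forall>s. eval e s = right (s b))" for b
    by (rule exI[of _ "Tl (Var b)"]) simp
qed (rule tsize_right)

lemma tree_poly_comp:
  assumes "tree_poly D' G" "tree_poly D F" "\<And>x. x \<in> D \<Longrightarrow> F x \<in> D'"
  shows "tree_poly D (\<lambda>x. G (F x))"
proof -
  obtain f where f: "poly_bounded f" "mono f" "\<And>x. x \<in> D \<Longrightarrow> tsize (F x) \<le> f (tsize x)"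
    "\<And>b. \<exists>c. computes_at b c D F f"
    using tree_polyE[OF assms(2)] by blast
  obtain g where g: "poly_bounded g" "mono g" "\<And>x. x \<in> D' \<Longrightarrow> tsize (G x) \<le> g (tsize x)"
    "\<And>b. \<exists>c. computes_at b c D' G g"
    using tree_polyE[OF assms(1)] by blast
  have gf: "g (tsize (F x)) \<le> g (f (tsize x))" if "x \<in> D" for x
    by (rule monoD[OF g(2) f(3)[OF that]])
  show ?thesis
  proof (rule tree_polyI)
    show "poly_bounded (\<lambda>n. g (f n))" "poly_bounded (\<lambda>n. f n + g (f n))"
      by (intro poly_bounded_add poly_bounded_comp[OF g(1) f(1)] f(1))+
    show "tsize (G (F x)) \<le> g (f (tsize x))" if "x \<in> D" for x
      using g(3) gf[OF that] assms(3)[OF that] order_trans by blast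
    fix b
    obtain cf cg where c: "computes_at b cf D F f" "computes_at b cg D' G g"
      using f(4) g(4) by blast
    have "computes_at b (Seq cf cg) D (\<lambda>x. G (F x)) (\<lambda>n. f n + g (f n))"
    proof (rule computes_atI)
      fix s :: store and x
      assume x: "x \<in> D" "s b = x"
      obtain t s' where 1: "exec cf s t s'" "t \<le> f (tsize x)" "s' b = F x" "\<And>i. i < b \<Longrightarrow> s' i = s i"
        using computes_atE[OF c(1), where s = s, OF x(2,1)] by blast
      obtain t' s'' where 2: "exec cg s' t' s''" "t' \<le> g (tsize (F x))" "s'' b = G (F x)"
        "\<And>i. i < b \<Longrightarrow> s'' i = s' i"
        using computes_atE[OF c(2), where s = s', OF 1(3) assms(3)[OF x(1)]] by blast
      show "\<exists>t s'. exec (Seq cf cg) s t s' \<and> t \<le> f (tsize x) + g (f (tsize x)) \<and>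
        s' b = G (F x) \<and> (\<forall>i < b. s' i = s i)"
        by (intro exI conjI, rule exec.Seq[OF 1(1) 2(1)]) (use 1 2 gf[OF x(1)] in auto)
    qed
    then show "\<exists>c. computes_at b c D (\<lambda>x. G (F x)) (\<lambda>n. f n + g (f n))" ..
  qed
qed

lemma tree_poly_pair:
  assumes "tree_poly D F" "tree_poly D G"
  shows "tree_poly D (\<lambda>x. Pair (F x) (G x))"
proof -
  obtain f where f: "poly_bounded f" "mono f" "\<And>x. x \<in> D \<Longrightarrow> tsize (F x) \<le> f (tsize x)"
    "\<And>b. \<exists>c. computes_at b c D F f"
    using tree_polyE[OF assms(1)] by blast
  obtain g where g: "poly_bounded g" "mono g" "\<And>x. x \<in> D \<Longrightarrow> tsize (G x) \<le> g (tsize x)"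
    "\<And>b. \<exists>c. computes_at b c D G g"
    using tree_polyE[OF assms(2)] by blast
  let ?R = "\<lambda>x. Pair (F x) (G x)"
  show ?thesis
  proof (rule tree_polyI)
    show "poly_bounded (\<lambda>n. f n + g n + 1)" "poly_bounded (\<lambda>n. f n + g n + 8)"
      by (intro poly_bounded_intros f(1) g(1))+
    show "tsize (?R x) \<le> f (tsize x) + g (tsize x) + 1" if "x \<in> D" for x
      using f(3)[OF that] g(3)[OF that] by simp
    fix b
    obtain cf cg where c: "computes_at (b+1) cf D F f" "computes_at (b+2) cg D G g"
      using f(4) g(4) by blast
    let ?c = "Seq (Seq (Assign (b+1) (Var b)) cf) (Seq (Seq (Assign (b+2) (Var b)) cg)
      (Assign b (Cns (Var (b+1)) (Var (b+2)))))"
    have "computes_at b ?c D ?R (\<lambda>n. f n + g n + 8)"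
    proof (rule computes_atI)
      fix s :: store and x
      assume x: "x \<in> D" "s b = x"
      define s1 where "s1 = s(b+1 := x)"
      have 0: "exec (Assign (b+1) (Var b)) s 2 s1"
        by (intro exec_AssignI) (simp_all add: s1_def x)
      have "s1 (b+1) = x"
        by (simp add: s1_def)
      then obtain t s2 where 1: "exec cf s1 t s2" "t \<le> f (tsize x)" "s2 (b+1) = F x"
        "\<And>i. i < b + 1 \<Longrightarrow> s2 i = s1 i"
        using computes_atE[OF c(1) _ x(1)] by blast
      have s2: "s2 i = s i" if "i \<le> b" for i
        using 1(4)[of i] that by (simp add: s1_def)
      define s3 where "s3 = s2(b+2 := x)"
      have 2: "exec (Assign (b+2) (Var b)) s2 2 s3"
        by (intro exec_AssignI) (simp_all add: s3_def s2 x)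
      have "s3 (b+2) = x"
        by (simp add: s3_def)
      then obtain t' s4 where 3: "exec cg s3 t' s4" "t' \<le> g (tsize x)" "s4 (b+2) = G x"
        "\<And>i. i < b + 2 \<Longrightarrow> s4 i = s3 i"
        using computes_atE[OF c(2) _ x(1)] by blast
      have s4: "s4 (b+1) = F x" "\<And>i. i \<le> b \<Longrightarrow> s4 i = s i"
        using 3(4) 1(3) s2 by (auto simp: s3_def)
      have 4: "exec (Assign b (Cns (Var (b+1)) (Var (b+2)))) s4 4 (s4(b := ?R x))"
        using 3(3) s4(1) by (intro exec_AssignI) simp_all
      have E: "exec ?c s (2 + t + (2 + t' + 4)) (s4(b := ?R x))"
        by (intro exec.Seq[OF exec.Seq[OF 0 1(1)] exec.Seq[OF exec.Seq[OF 2 3(1)] 4]])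
      show "\<exists>t s'. exec ?c s t s' \<and> t \<le> f (tsize x) + g (tsize x) + 8 \<and>
        s' b = ?R x \<and> (\<forall>i < b. s' i = s i)"
        by (intro exI conjI, rule E) (use 1(2) 3(2) s4(2) in auto)
    qed
    then show "\<exists>c. computes_at b c D ?R (\<lambda>n. f n + g n + 8)" ..
  qed
qed

lemma tree_poly_if:
  assumes "tree_poly D H" "tree_poly D F" "tree_poly D G"
  shows "tree_poly D (\<lambda>x. if H x \<noteq> Leaf then F x else G x)"
proof -
  obtain f where f: "poly_bounded f" "mono f" "\<And>x. x \<in> D \<Longrightarrow> tsize (F x) \<le> f (tsize x)"
    "\<And>b. \<exists>c. computes_at b c D F f"
    using tree_polyE[OF assms(2)] by blast
  obtain g where g: "poly_bounded g" "mono g" "\<And>x. x \<in> D \<Longrightarrow> tsize (G x) \<le> g (tsize x)"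
    "\<And>b. \<exists>c. computes_at b c D G g"
    using tree_polyE[OF assms(3)] by blast
  obtain h where h: "poly_bounded h" "mono h" "\<And>x. x \<in> D \<Longrightarrow> tsize (H x) \<le> h (tsize x)"
    "\<And>b. \<exists>c. computes_at b c D H h"
    using tree_polyE[OF assms(1)] by blast
  let ?R = "\<lambda>x. if H x \<noteq> Leaf then F x else G x"
  show ?thesis
  proof (rule tree_polyI)
    show "poly_bounded (\<lambda>n. f n + g n)" "poly_bounded (\<lambda>n. f n + g n + h n + 4)"
      by (intro poly_bounded_intros f(1) g(1) h(1))+
    show "tsize (?R x) \<le> f (tsize x) + g (tsize x)" if "x \<in> D" for x
      using f(3)[OF that] g(3)[OF that] by auto
    fix b
    obtain cf cg ch where c: "computes_at b cf D F f" "computes_at b cg D G g"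
      "computes_at (b+1) ch D H h"
      using f(4) g(4) h(4) by blast
    let ?c = "Seq (Seq (Assign (b+1) (Var b)) ch) (If (Var (b+1)) cf cg)"
    have "computes_at b ?c D ?R (\<lambda>n. f n + g n + h n + 4)"
    proof (rule computes_atI)
      fix s :: store and x
      assume x: "x \<in> D" "s b = x"
      define s1 where "s1 = s(b+1 := x)"
      have 0: "exec (Assign (b+1) (Var b)) s 2 s1"
        by (intro exec_AssignI) (simp_all add: s1_def x)
      have "s1 (b+1) = x"
        by (simp add: s1_def)
      then obtain t s2 where 1: "exec ch s1 t s2" "t \<le> h (tsize x)" "s2 (b+1) = H x"
        "\<And>i. i < b + 1 \<Longrightarrow> s2 i = s1 i"
        using computes_atE[OF c(3) _ x(1)] by blast
      have s2: "s2 i = s i" if "i \<le> b" for i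
        using 1(4)[of i] that by (simp add: s1_def)
      have s2b: "s2 b = x"
        using s2 x by simp
      have "\<exists>t' s3. exec (If (Var (b+1)) cf cg) s2 t' s3 \<and>
          t' \<le> f (tsize x) + g (tsize x) + 2 \<and> s3 b = ?R x \<and> (\<forall>i < b. s3 i = s2 i)"
      proof (cases "H x = Leaf")
        case True
        obtain t' s3 where 2: "exec cg s2 t' s3" "t' \<le> g (tsize x)" "s3 b = G x"
          "\<And>i. i < b \<Longrightarrow> s3 i = s2 i"
          using computes_atE[OF c(2), where s = s2, OF s2b x(1)] by blast
        have "eval (Var (b+1)) s2 = Leaf"
          using 1(3) True by simp
        note E = exec.IfFalse[OF this 2(1)]
        show ?thesis
          by (intro exI conjI, rule E) (use 2 True in auto)
      next
        case False
        obtain t' s3 where 2: "exec cf s2 t' s3" "t' \<le> f (tsize x)" "s3 b = F x"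
          "\<And>i. i < b \<Longrightarrow> s3 i = s2 i"
          using computes_atE[OF c(1), where s = s2, OF s2b x(1)] by blast
        have "eval (Var (b+1)) s2 \<noteq> Leaf"
          using 1(3) False by simp
        note E = exec.IfTrue[OF this 2(1)]
        show ?thesis
          by (intro exI conjI, rule E) (use 2 False in auto)
      qed
      then obtain t' s3 where 2: "exec (If (Var (b+1)) cf cg) s2 t' s3"
          "t' \<le> f (tsize x) + g (tsize x) + 2" "s3 b = ?R x" "\<And>i. i < b \<Longrightarrow> s3 i = s2 i"
        by blast
      show "\<exists>t s'. exec ?c s t s' \<and> t \<le> f (tsize x) + g (tsize x) + h (tsize x) + 4 \<and>
        s' b = ?R x \<and> (\<forall>i < b. s' i = s i)"
        by (intro exI conjI, rule exec.Seq[OF exec.Seq[OF 0 1(1)] 2(1)]) (use 1(2) 2 s2 in auto)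
    qed
    then show "\<exists>c. computes_at b c D ?R (\<lambda>n. f n + g n + h n + 4)" ..
  qed
qed

section \<open>Loops over lists\<close>

fun tfold :: "(tree \<Rightarrow> tree) \<Rightarrow> tree \<Rightarrow> tree \<Rightarrow> tree \<Rightarrow> tree" where
  "tfold F e a Leaf = a"
| "tfold F e a (Pair x xs) = tfold F e (F (Pair e (Pair a x))) xs"

text \<open>The condition under which a fold is affordable: polynomial steps alone could double the
  accumulator each time. The set \<open>D\<close> records where the program for the step is known to
  be correct.\<close>

fun tfold_bounded :: "tree set \<Rightarrow> nat \<Rightarrow> (tree \<Rightarrow> tree) \<Rightarrow> tree \<Rightarrow> tree \<Rightarrow> tree \<Rightarrow> bool" where
  "tfold_bounded D B F e a Leaf = (tsize a \<le> B)"
| "tfold_bounded D B F e a (Pair x xs) = (tsize a \<le> B \<and> Pair e (Pair a x) \<in> D \<and>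
     tfold_bounded D B F e (F (Pair e (Pair a x))) xs)"

lemma tsize_tfold: "tfold_bounded D B F e a xs \<Longrightarrow> tsize (tfold F e a xs) \<le> B"
  by (induction F e a xs rule: tfold.induct) auto

text \<open>The variables \<open>b+1\<close>, \<open>b+2\<close>, \<open>b+3\<close> hold the
  environment, the accumulator and the remaining list; \<open>b+4\<close> holds the argument and
  then the result of the step. An iteration costs 14 units besides the step and consumes at least
  one node of the list, so a charge per node with slack 20 suffices.\<close>

lemma exec_tfold_loop:
  assumes "mono f" and c: "computes_at (b+4) c D F f"
    and "tfold_bounded D B F (s (b+1)) (s (b+2)) (s (b+3))"
  shows "\<exists>t s'. exec (While (Var (b+3)) (Seq (Seq (Assign (b+4)
      (Cns (Var (b+1)) (Cns (Var (b+2)) (Hd (Var (b+3)))))) c)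
      (Seq (Assign (b+2) (Var (b+4))) (Assign (b+3) (Tl (Var (b+3))))))) s t s' \<and>
    t \<le> (f (tsize (s (b+1)) + B + tsize (s (b+3)) + 2) + 20) * tsize (s (b+3)) \<and>
    s' (b+2) = tfold F (s (b+1)) (s (b+2)) (s (b+3)) \<and> (\<forall>i < b+2. s' i = s i)"
    (is "\<exists>t s'. exec ?w s t s' \<and> _")
  using assms(3)
proof (induction "s (b+3)" arbitrary: s)
  case Leaf
  have L: "s (b+3) = Leaf"
    using Leaf.hyps by simp
  have "exec ?w s 2 s"
    by (intro exec_WhileFalseI) (simp_all add: L)
  then show ?case
    unfolding L by (intro exI[of _ 2] exI[of _ s]) simp
next
  case (Pair x xs)
  have L: "s (b+3) = tree.Pair x xs"
    using Pair.hyps(3) by simp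
  let ?e = "s (b+1)" and ?a = "s (b+2)"
  let ?p = "tree.Pair ?e (tree.Pair ?a x)"
  let ?n = "f (tsize ?e + B + tsize (s (b+3)) + 2)"
  have bounded: "tsize ?a \<le> B" "?p \<in> D" "tfold_bounded D B F ?e (F ?p) xs"
    using Pair.prems unfolding L by auto
  define s1 where "s1 = s(b+4 := ?p)"
  have 1: "exec (Assign (b+4) (Cns (Var (b+1)) (Cns (Var (b+2)) (Hd (Var (b+3)))))) s 7 s1"
    by (intro exec_AssignI) (simp_all add: s1_def L)
  have "s1 (b+4) = ?p"
    by (simp add: s1_def)
  then obtain t s2 where 2: "exec c s1 t s2" "t \<le> f (tsize ?p)" "s2 (b+4) = F ?p"
    "\<And>i. i < b + 4 \<Longrightarrow> s2 i = s1 i"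
    using computes_atE[OF c _ bounded(2)] by blast
  have s2: "s2 i = s i" if "i < b + 4" for i
    using 2(4)[OF that] that by (simp add: s1_def)
  define s3 where "s3 = s2(b+2 := F ?p)"
  have 3: "exec (Assign (b+2) (Var (b+4))) s2 2 s3"
    using 2(3) by (intro exec_AssignI) (simp_all add: s3_def)
  define s4 where "s4 = s3(b+3 := xs)"
  have "s3 (b+3) = tree.Pair x xs"
    using s2[of "b+3"] by (simp add: s3_def L)
  then have 4: "exec (Assign (b+3) (Tl (Var (b+3)))) s3 3 s4"
    by (intro exec_AssignI) (simp_all add: s4_def)
  have s4: "s4 (b+1) = ?e" "s4 (b+2) = F ?p" "s4 (b+3) = xs" "\<And>i. i < b + 2 \<Longrightarrow> s4 i = s i"
    using s2 by (auto simp: s4_def s3_def)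
  obtain t' s5 where 5: "exec ?w s4 t' s5" "t' \<le> (f (tsize ?e + B + tsize xs + 2) + 20) * tsize xs"
    "s5 (b+2) = tfold F ?e (F ?p) xs" "\<And>i. i < b+2 \<Longrightarrow> s5 i = s4 i"
    using Pair.hyps(2)[of s4] bounded(3) unfolding s4(1,2,3) by auto
  have size: "tsize (s (b+3)) = tsize x + tsize xs + 1"
    by (simp add: L)
  have "tsize ?p \<le> tsize ?e + B + tsize (s (b+3)) + 2" 
    using bounded(1) size by simp
  then have t: "t \<le> ?n"
    using 2(2) monoD[OF assms(1)] order_trans by blast
  have "f (tsize ?e + B + tsize xs + 2) \<le> ?n"
    by (rule monoD[OF assms(1)]) (simp add: size)
  then have "t' \<le> (?n + 20) * tsize xs"
    using 5(2) by (meson add_le_mono1 mult_le_mono1 order_trans)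
  then have total: "2 + (7 + t + (2 + 3)) + t' \<le> (?n + 20) * tsize (s (b+3))"
    using t unfolding size by (simp add: algebra_simps)
  have E: "exec ?w s (2 + (7 + t + (2 + 3)) + t') s5"
    using exec.WhileTrue[of "Var (b+3)" s, OF _
        exec.Seq[OF exec.Seq[OF 1 2(1)] exec.Seq[OF 3 4]] 5(1)]
    by (simp add: L)
  show ?case
    by (intro exI conjI, rule E) (use total 5 s4 in \<open>auto simp: L\<close>)
qed

lemma tree_poly_fold:
  assumes "tree_poly D' F" "tree_poly D I" "tree_poly D L" "poly_bounded h"
    and "\<And>x. x \<in> D \<Longrightarrow> tfold_bounded D' (h (tsize x)) F x (I x) (L x)"
  shows "tree_poly D (\<lambda>x. tfold F x (I x) (L x))"
proof -
  obtain f where f: "poly_bounded f" "mono f" "\<And>x. x \<in> D' \<Longrightarrow> tsize (F x) \<le> f (tsize x)"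
    "\<And>b. \<exists>c. computes_at b c D' F f"
    using tree_polyE[OF assms(1)] by blast
  obtain g where g: "poly_bounded g" "mono g" "\<And>x. x \<in> D \<Longrightarrow> tsize (I x) \<le> g (tsize x)"
    "\<And>b. \<exists>c. computes_at b c D I g"
    using tree_polyE[OF assms(2)] by blast
  obtain l where l: "poly_bounded l" "mono l" "\<And>x. x \<in> D \<Longrightarrow> tsize (L x) \<le> l (tsize x)"
    "\<And>b. \<exists>c. computes_at b c D L l"
    using tree_polyE[OF assms(3)] by blast
  let ?T = "\<lambda>n. g n + l n + (f (n + h n + l n + 2) + 20) * l n + 12"
  let ?R = "\<lambda>x. tfold F x (I x) (L x)"
  show ?thesis
  proof (rule tree_polyI)
    show "poly_bounded h" by fact
    show "poly_bounded ?T"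
      by (intro poly_bounded_intros g(1) l(1) assms(4) poly_bounded_comp[OF f(1)])
    show "tsize (?R x) \<le> h (tsize x)" if "x \<in> D" for x
      by (rule tsize_tfold[OF assms(5)[OF that]])
    fix b
    obtain cf ci cl where c: "computes_at (b+4) cf D' F f" "computes_at (b+2) ci D I g"
      "computes_at (b+3) cl D L l"
      using f(4) g(4) l(4) by blast
    let ?w = "While (Var (b+3)) (Seq (Seq (Assign (b+4)
      (Cns (Var (b+1)) (Cns (Var (b+2)) (Hd (Var (b+3)))))) cf)
      (Seq (Assign (b+2) (Var (b+4))) (Assign (b+3) (Tl (Var (b+3))))))"
    let ?c = "Seq (Assign (b+1) (Var b)) (Seq (Seq (Assign (b+2) (Var b)) ci)
      (Seq (Seq (Assign (b+3) (Var b)) cl) (Seq ?w (Assign b (Var (b+2))))))"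
    have "computes_at b ?c D ?R ?T"
    proof (rule computes_atI)
      fix s :: store and x
      assume x: "x \<in> D" "s b = x"
      let ?n = "tsize x"
      define s1 where "s1 = s(b+1 := x)"
      have 1: "exec (Assign (b+1) (Var b)) s 2 s1"
        by (intro exec_AssignI) (simp_all add: s1_def x)
      define s2 where "s2 = s1(b+2 := x)"
      have 2: "exec (Assign (b+2) (Var b)) s1 2 s2"
        by (intro exec_AssignI) (simp_all add: s1_def s2_def x)
      have "s2 (b+2) = x"
        by (simp add: s2_def)
      then obtain t3 s3 where 3: "exec ci s2 t3 s3" "t3 \<le> g ?n" "s3 (b+2) = I x"
        "\<And>i. i < b+2 \<Longrightarrow> s3 i = s2 i"
        using computes_atE[OF c(2) _ x(1)] by blast
      define s4 where "s4 = s3(b+3 := x)"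
      have 4: "exec (Assign (b+3) (Var b)) s3 2 s4"
        using 3(4)[of b] by (intro exec_AssignI) (simp_all add: s1_def s2_def s4_def x)
      have "s4 (b+3) = x"
        by (simp add: s4_def)
      then obtain t5 s5 where 5: "exec cl s4 t5 s5" "t5 \<le> l ?n" "s5 (b+3) = L x"
        "\<And>i. i < b+3 \<Longrightarrow> s5 i = s4 i"
        using computes_atE[OF c(3) _ x(1)] by blast
      have s5: "s5 (b+1) = x" "s5 (b+2) = I x" "\<And>i. i \<le> b \<Longrightarrow> s5 i = s i"
        using 5(4) 3(3,4) by (auto simp: s1_def s2_def s4_def)
      have bd: "tfold_bounded D' (h ?n) F (s5 (b+1)) (s5 (b+2)) (s5 (b+3))"
        using assms(5)[OF x(1)] s5 5(3) by simp
      obtain t6 s6 where 6: "exec ?w s5 t6 s6"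
        "t6 \<le> (f (?n + h ?n + tsize (L x) + 2) + 20) * tsize (L x)"
        "s6 (b+2) = ?R x" "\<And>i. i < b+2 \<Longrightarrow> s6 i = s5 i"
        using exec_tfold_loop[OF f(2) c(1) bd] unfolding s5 5(3) by blast
      have t6: "t6 \<le> (f (?n + h ?n + l ?n + 2) + 20) * l ?n"
      proof -
        have "f (?n + h ?n + tsize (L x) + 2) \<le> f (?n + h ?n + l ?n + 2)"
          by (rule monoD[OF f(2)]) (simp add: l(3) x)
        then show ?thesis
          using 6(2) l(3)[OF x(1)] by (meson add_le_mono1 mult_le_mono order_trans)
      qed
      define s7 where "s7 = s6(b := s6 (b+2))"
      have 7: "exec (Assign b (Var (b+2))) s6 2 s7"
        by (intro exec_AssignI) (simp_all add: s7_def)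
      have E: "exec ?c s (2 + (2 + t3 + (2 + t5 + (t6 + 2)))) s7"
        by (intro exec.Seq[OF 1] exec.Seq[OF exec.Seq[OF 2 3(1)]] exec.Seq[OF exec.Seq[OF 4 5(1)]]
            exec.Seq[OF 6(1) 7])
      show "\<exists>t s'. exec ?c s t s' \<and> t \<le> ?T ?n \<and> s' b = ?R x \<and> (\<forall>i < b. s' i = s i)"
        by (intro exI conjI, rule E) (use 3(2) 5(2) t6 6(3,4) s5(3) in \<open>auto simp: s7_def\<close>)
    qed
    then show "\<exists>c. computes_at b c D ?R ?T" ..
  qed
qed


section \<open>Polynomial-time functions on encoded data\<close>

class treeable =
  fixes to_tree :: "'a \<Rightarrow> tree"

instantiation bool :: treeable
begin
definition to_tree_bool :: "bool \<Rightarrow> tree" where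
  "to_tree_bool b = (if b then Pair Leaf Leaf else Leaf)"
instance ..
end

text \<open>Unary, and the same tree as \<open>replicate n True\<close>: a number can serve as a
  list to fold over. Time polynomial in the value is affordable because \<open>enc_nat\<close> is
  unary as well.\<close>

instantiation nat :: treeable
begin
primrec to_tree_nat :: "nat \<Rightarrow> tree" where
  "to_tree_nat 0 = Leaf"
| "to_tree_nat (Suc n) = Pair (Pair Leaf Leaf) (to_tree_nat n)"
instance ..
end

instantiation prod :: (treeable, treeable) treeable
begin
definition to_tree_prod :: "'a \<times> 'b \<Rightarrow> tree" where
  "to_tree_prod p = Pair (to_tree (fst p)) (to_tree (snd p))"
instance ..
end

instantiation list :: (treeable) treeable
begin
primrec to_tree_list :: "'a list \<Rightarrow> tree" where
  "to_tree_list [] = Leaf"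
| "to_tree_list (x # xs) = Pair (to_tree x) (to_tree_list xs)"
instance ..
end

lemma tree_of_bits_eq: "tree_of_bits = to_tree"
proof
  show "tree_of_bits x = to_tree x" for x
    by (induction x) (auto simp: to_tree_bool_def)
qed

abbreviation tsz :: "'a::treeable \<Rightarrow> nat" where
  "tsz x \<equiv> tsize (to_tree x)"

abbreviation codes :: "'a::treeable itself \<Rightarrow> tree set" where
  "codes _ \<equiv> range (to_tree :: 'a \<Rightarrow> tree)"

lemma tsz_prod: "tsz p = tsz (fst p) + tsz (snd p) + 1"
  by (simp add: to_tree_prod_def)

lemma tsz_nat: "tsz (n::nat) = 4 * n + 1"
  by (induction n) auto

lemma tsz_append: "tsz (xs @ ys) + 1 = tsz xs + tsz ys"
  by (induction xs) auto

lemma tsz_member: "y \<in> set ys \<Longrightarrow> tsz y < tsz ys"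
  by (induction ys) auto

lemma length_less_tsz: "length ys < tsz ys"
  by (induction ys) auto

lemma to_tree_replicate: "to_tree (replicate n True) = to_tree n"
  by (induction n) (auto simp: to_tree_bool_def)

definition poly_time :: "('a::treeable \<Rightarrow> 'b::treeable) \<Rightarrow> bool" where
  "poly_time f \<longleftrightarrow> (\<exists>F. tree_poly (codes TYPE('a)) F \<and>
     (\<forall>x. F (to_tree x) = to_tree (f x)))"

named_theorems pt_intros

lemma poly_timeE:
  fixes f :: "'a::treeable \<Rightarrow> 'b::treeable"
  assumes "poly_time f"
  obtains F where "tree_poly (codes TYPE('a)) F" "\<And>x. F (to_tree x) = to_tree (f x)"
  using assms unfolding poly_time_def by blast

lemma poly_time_size:
  assumes "poly_time f"
  obtains h where "poly_bounded h" "mono h" "\<And>x. tsz (f x) \<le> h (tsz x)"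
proof -
  obtain F where F: "tree_poly (codes TYPE('a)) F" "\<And>x. F (to_tree x) = to_tree (f x)"
    using poly_timeE[OF assms] by blast
  obtain h where "poly_bounded h" "mono h"
    "\<And>x. x \<in> codes TYPE('a) \<Longrightarrow> tsize (F x) \<le> h (tsize x)"
    "\<And>b. \<exists>c. computes_at b c (codes TYPE('a)) F h"
    using tree_polyE[OF F(1)] by blast
  then show ?thesis
    using that F(2) by (metis rangeI)
qed

text \<open>Only the trees matter to a program, so the result types of \<open>f\<close> and
  \<open>g\<close> may differ. This makes the passage from a number to a list of that length
  free.\<close>

lemma poly_time_same_tree:
  assumes "poly_time f" "\<And>x. to_tree (g x) = to_tree (f x)"
  shows "poly_time g"
  using assms unfolding poly_time_def by auto

lemma poly_time_cong: "poly_time f \<Longrightarrow> (\<And>x. f x = g x) \<Longrightarrow> poly_time g"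
  by (erule poly_time_same_tree) simp

lemma poly_time_id [pt_intros]: "poly_time (\<lambda>x. x)"
  unfolding poly_time_def using tree_poly_id by blast

lemma poly_time_const [pt_intros]: "poly_time (\<lambda>_. c)"
  unfolding poly_time_def using tree_poly_const by blast

lemma poly_time_comp:
  assumes "poly_time g" "poly_time f"
  shows "poly_time (\<lambda>x. g (f x))"
proof -
  obtain F where F: "tree_poly (codes TYPE('c)) F" "\<And>x. F (to_tree x) = to_tree (f x)"
    using poly_timeE[OF assms(2)] by blast
  obtain G where G: "tree_poly (codes TYPE('a)) G" "\<And>x. G (to_tree x) = to_tree (g x)"
    using poly_timeE[OF assms(1)] by blast
  show ?thesis
    unfolding poly_time_def
  proof (intro exI conjI allI)
    show "tree_poly (codes TYPE('c)) (\<lambda>x. G (F x))"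
      by (rule tree_poly_comp[OF G(1) F(1)]) (use F(2) in auto)
  qed (simp add: F G)
qed

lemma poly_time_Pair [pt_intros]:
  assumes "poly_time f" "poly_time g"
  shows "poly_time (\<lambda>x. (f x, g x))"
proof -
  obtain F where F: "tree_poly (codes TYPE('a)) F" "\<And>x. F (to_tree x) = to_tree (f x)"
    using poly_timeE[OF assms(1)] by blast
  obtain G where G: "tree_poly (codes TYPE('a)) G" "\<And>x. G (to_tree x) = to_tree (g x)"
    using poly_timeE[OF assms(2)] by blast
  show ?thesis
    unfolding poly_time_def
    by (rule exI[of _ "\<lambda>x. Pair (F x) (G x)"])
      (simp add: F G tree_poly_pair[OF F(1) G(1)] to_tree_prod_def)
qed

lemma poly_time_comp2:
  assumes "poly_time (\<lambda>p. g (fst p) (snd p))" "poly_time f" "poly_time h"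
  shows "poly_time (\<lambda>x. g (f x) (h x))"
  using poly_time_comp[OF assms(1) poly_time_Pair[OF assms(2,3)]] by simp

lemma poly_time_comp3:
  assumes "poly_time (\<lambda>p. g (fst p) (fst (snd p)) (snd (snd p)))"
    "poly_time f" "poly_time h" "poly_time k"
  shows "poly_time (\<lambda>x. g (f x) (h x) (k x))"
  using poly_time_comp[OF assms(1) poly_time_Pair[OF assms(2) poly_time_Pair[OF assms(3,4)]]] by simp

lemma poly_time_fst [pt_intros]:
  assumes "poly_time f"
  shows "poly_time (\<lambda>x. fst (f x))"
  by (rule poly_time_comp[where g = fst, OF _ assms], unfold poly_time_def, rule exI[of _ left])
    (simp add: tree_poly_left to_tree_prod_def)

lemma poly_time_snd [pt_intros]:
  assumes "poly_time f"
  shows "poly_time (\<lambda>x. snd (f x))"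
  by (rule poly_time_comp[where g = snd, OF _ assms], unfold poly_time_def, rule exI[of _ right])
    (simp add: tree_poly_right to_tree_prod_def)

lemma poly_time_Cons [pt_intros]:
  "poly_time f \<Longrightarrow> poly_time g \<Longrightarrow> poly_time (\<lambda>x. f x # g x)"
  using poly_time_Pair[of f g] unfolding poly_time_def by (simp add: to_tree_prod_def)

lemma right_to_tree_list: "right (to_tree xs) = to_tree (tl xs)"
  by (cases xs) auto

lemma poly_time_tl [pt_intros]:
  assumes "poly_time f"
  shows "poly_time (\<lambda>x. tl (f x))"
  by (rule poly_time_comp[where g = tl, OF _ assms], unfold poly_time_def, rule exI[of _ right])
    (simp add: tree_poly_right right_to_tree_list)

lemma poly_time_Suc [pt_intros]:
  assumes "poly_time f"
  shows "poly_time (\<lambda>x. Suc (f x))"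
  by (rule poly_time_comp[where g = Suc, OF _ assms], unfold poly_time_def,
      rule exI[of _ "\<lambda>t. Pair (Pair Leaf Leaf) t"])
    (simp add: tree_poly_pair tree_poly_const tree_poly_id)

lemma right_to_tree_nat: "right (to_tree n) = to_tree (n - 1 :: nat)"
  by (cases n) auto

lemma poly_time_pred:
  assumes "poly_time f"
  shows "poly_time (\<lambda>x. f x - 1 :: nat)"
  by (rule poly_time_comp[where g = "\<lambda>n. n - 1", OF _ assms], unfold poly_time_def,
      rule exI[of _ right]) (simp add: tree_poly_right right_to_tree_nat)

lemma poly_time_if_Leaf:
  assumes "poly_time h" "poly_time f" "poly_time g"
  shows "poly_time (\<lambda>x. if to_tree (h x) \<noteq> Leaf then f x else g x)"
proof -
  obtain F where F: "tree_poly (codes TYPE('a)) F" "\<And>x. F (to_tree x) = to_tree (f x)"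
    using poly_timeE[OF assms(2)] by blast
  obtain G where G: "tree_poly (codes TYPE('a)) G" "\<And>x. G (to_tree x) = to_tree (g x)"
    using poly_timeE[OF assms(3)] by blast
  obtain H where H: "tree_poly (codes TYPE('a)) H" "\<And>x. H (to_tree x) = to_tree (h x)"
    using poly_timeE[OF assms(1)] by blast
  show ?thesis
    unfolding poly_time_def
    by (rule exI[of _ "\<lambda>x. if H x \<noteq> Leaf then F x else G x"])
      (simp add: F G H tree_poly_if[OF H(1) F(1) G(1)])
qed

lemma poly_time_if [pt_intros]:
  assumes "poly_time P" "poly_time f" "poly_time g"
  shows "poly_time (\<lambda>x. if P x then f x else g x)"
  by (rule poly_time_cong[OF poly_time_if_Leaf[OF assms]]) (simp add: to_tree_bool_def)

lemma poly_time_not [pt_intros]: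
  assumes "poly_time P"
  shows "poly_time (\<lambda>x. \<not> P x)"
  by (rule poly_time_cong[OF poly_time_if[OF assms poly_time_const[of False] poly_time_const[of True]]])
    simp

lemma poly_time_conj [pt_intros]:
  assumes "poly_time P" "poly_time Q"
  shows "poly_time (\<lambda>x. P x \<and> Q x)"
  by (rule poly_time_cong[OF poly_time_if[OF assms poly_time_const[of False]]]) simp

lemma poly_time_disj [pt_intros]:
  assumes "poly_time P" "poly_time Q"
  shows "poly_time (\<lambda>x. P x \<or> Q x)"
  by (rule poly_time_cong[OF poly_time_if[OF assms(1) poly_time_const[of True] assms(2)]]) simp

lemma poly_time_imp [pt_intros]:
  assumes "poly_time P" "poly_time Q"
  shows "poly_time (\<lambda>x. P x \<longrightarrow> Q x)"
  by (rule poly_time_cong[OF poly_time_if[OF assms poly_time_const[of True]]]) simp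

lemma poly_time_eq_bool [pt_intros]:
  assumes "poly_time P" "poly_time Q"
  shows "poly_time (\<lambda>x. (P x :: bool) = Q x)"
  by (rule poly_time_cong[OF poly_time_if[OF assms poly_time_not[OF assms(2)]]]) simp

lemma poly_time_eq_Nil [pt_intros]:
  assumes "poly_time f"
  shows "poly_time (\<lambda>x. f x = [])"
proof (rule poly_time_cong[OF poly_time_if_Leaf[OF assms poly_time_const[of False] poly_time_const[of True]]])
  show "(if to_tree (f x) \<noteq> Leaf then False else True) = (f x = [])" for x
    by (cases "f x") auto
qed

lemma poly_time_eq_0:
  assumes "poly_time f"
  shows "poly_time (\<lambda>x. f x = (0::nat))"
proof (rule poly_time_cong[OF poly_time_if_Leaf[OF assms poly_time_const[of False] poly_time_const[of True]]])
  show "(if to_tree (f x) \<noteq> Leaf then False else True) = (f x = 0)" for x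
    by (cases "f x") auto
qed

text \<open>The size bound is demanded after every prefix \<open>ys\<close> of the list, since a
  large intermediate accumulator is not excluded by a small final one.\<close>

lemma poly_time_foldl:
  fixes l :: "'a::treeable \<Rightarrow> 'b::treeable list" and init :: "'a \<Rightarrow> 'c::treeable"
  assumes "poly_time (\<lambda>p. step (fst p) (fst (snd p)) (snd (snd p)))" "poly_time init" "poly_time l"
    and "poly_bounded h"
    and "\<And>x ys zs. l x = ys @ zs \<Longrightarrow> tsz (foldl (step x) (init x) ys) \<le> h (tsz x)"
  shows "poly_time (\<lambda>x. foldl (step x) (init x) (l x))"
proof -
  obtain F where F: "tree_poly (codes TYPE('a \<times> 'c \<times> 'b)) F"
    "\<And>p. F (to_tree p) = to_tree (step (fst p) (fst (snd p)) (snd (snd p)))"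
    using poly_timeE[OF assms(1)] by blast
  obtain I where I: "tree_poly (codes TYPE('a)) I" "\<And>x. I (to_tree x) = to_tree (init x)"
    using poly_timeE[OF assms(2)] by blast
  obtain L where L: "tree_poly (codes TYPE('a)) L" "\<And>x. L (to_tree x) = to_tree (l x)"
    using poly_timeE[OF assms(3)] by blast
  have step: "F (Pair (to_tree x) (Pair (to_tree a) (to_tree y))) = to_tree (step x a y)" for x a y
    using F(2)[of "(x, a, y)"] by (simp add: to_tree_prod_def)
  have range: "Pair (to_tree x) (Pair (to_tree a) (to_tree y)) \<in> codes TYPE('a \<times> 'c \<times> 'b)"
    for x :: 'a and a :: 'c and y :: 'b
    by (rule image_eqI[of _ _ "(x, a, y)"]) (simp_all add: to_tree_prod_def)
  have fold: "tfold F (to_tree x) (to_tree a) (to_tree ys) = to_tree (foldl (step x) a ys)" for x a ys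
    by (induction ys arbitrary: a) (auto simp: step)
  have bounded: "tfold_bounded (codes TYPE('a \<times> 'c \<times> 'b)) B F (to_tree x) (to_tree a) (to_tree ys)"
    if "\<And>us vs. ys = us @ vs \<Longrightarrow> tsz (foldl (step x) a us) \<le> B" for B x a ys
    using that
  proof (induction ys arbitrary: a)
    case Nil
    then show ?case by simp
  next
    case (Cons y ys)
    have "tfold_bounded (codes TYPE('a \<times> 'c \<times> 'b)) B F (to_tree x) (to_tree (step x a y)) (to_tree ys)"
    proof (rule Cons.IH)
      show "tsz (foldl (step x) (step x a y) us) \<le> B" if "ys = us @ vs" for us vs
        using Cons.prems[of "y # us" vs] that by simp
    qed
    moreover have "tsz a \<le> B"
      using Cons.prems[of "[]"] by simp
    ultimately show ?case
      using range step by simp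
  qed
  have "tree_poly (codes TYPE('a)) (\<lambda>x. tfold F x (I x) (L x))"
  proof (rule tree_poly_fold[OF F(1) I(1) L(1) assms(4)])
    fix t
    assume "t \<in> codes TYPE('a)"
    then obtain x :: 'a where t: "t = to_tree x" by blast
    show "tfold_bounded (codes TYPE('a \<times> 'c \<times> 'b)) (h (tsize t)) F t (I t) (L t)"
      unfolding t I(2) L(2) by (rule bounded) (rule assms(5))
  qed
  then show ?thesis
    unfolding poly_time_def by (intro exI conjI allI) (auto simp: I L fold)
qed

text \<open>A step may add a polynomial in the environment and the list element, but nothing that
  depends on the accumulator. The growth then adds up over the list instead of compounding, which
  covers most folds below.\<close>

lemma poly_time_foldl_additive:
  fixes l :: "'a::treeable \<Rightarrow> 'b::treeable list" and init :: "'a \<Rightarrow> 'c::treeable"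
  assumes "poly_time (\<lambda>p. step (fst p) (fst (snd p)) (snd (snd p)))" "poly_time init" "poly_time l"
    and "poly_bounded h"
    and "\<And>x a y. tsz (step x a y) \<le> tsz a + h (tsz x + tsz y)"
  shows "poly_time (\<lambda>x. foldl (step x) (init x) (l x))"
proof -
  obtain h' where h': "poly_bounded h'" "mono h'" "\<And>n. h n \<le> h' n"
    using poly_bounded_mono[OF assms(4)] by blast
  obtain li where li: "poly_bounded li" "mono li" "\<And>x. tsz (init x) \<le> li (tsz x)"
    using poly_time_size[OF assms(2)] by blast
  obtain ll where ll: "poly_bounded ll" "mono ll" "\<And>x. tsz (l x) \<le> ll (tsz x)"
    using poly_time_size[OF assms(3)] by blast
  have *: "tsz (foldl (step x) a ys) \<le> tsz a + length ys * h' (tsz x + B)"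
    if "\<And>y. y \<in> set ys \<Longrightarrow> tsz y \<le> B" for x a ys B
    using that
  proof (induction ys arbitrary: a)
    case Nil
    then show ?case by simp
  next
    case (Cons y ys)
    have "h (tsz x + tsz y) \<le> h' (tsz x + tsz y)" by (rule h'(3))
    also have "\<dots> \<le> h' (tsz x + B)"
      by (rule monoD[OF h'(2)]) (simp add: Cons.prems)
    finally have "tsz (step x a y) \<le> tsz a + h' (tsz x + B)"
      using assms(5)[of x a y] by simp
    then show ?case
      using Cons.IH[of "step x a y"] Cons.prems by simp
  qed
  show ?thesis
  proof (rule poly_time_foldl[OF assms(1-3)])
    show "poly_bounded (\<lambda>n. li n + ll n * h' (n + ll n))"
      by (intro poly_bounded_intros li(1) ll(1) poly_bounded_comp[OF h'(1)])
    fix x ys zs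
    assume lx: "l x = ys @ zs"
    have 1: "tsz (foldl (step x) (init x) ys) \<le> tsz (init x) + length ys * h' (tsz x + ll (tsz x))"
    proof (rule *)
      fix y assume "y \<in> set ys"
      then have "tsz y < tsz (l x)"
        using tsz_member lx by (metis UnI1 set_append)
      then show "tsz y \<le> ll (tsz x)"
        using ll(3)[of x] by simp
    qed
    have "length ys \<le> ll (tsz x)"
      using length_less_tsz[of "l x"] lx ll(3)[of x] by simp
    then have 2: "length ys * h' (tsz x + ll (tsz x)) \<le> ll (tsz x) * h' (tsz x + ll (tsz x))"
      by (rule mult_le_mono1)
    show "tsz (foldl (step x) (init x) ys) \<le> li (tsz x) + ll (tsz x) * h' (tsz x + ll (tsz x))"
      using 1 2 li(3)[of x] by linarith
  qed
qed

section \<open>Lists, arithmetic and bounded quantifiers\<close>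

lemma poly_time_rev [pt_intros]: "poly_time f \<Longrightarrow> poly_time (\<lambda>x. rev (f x))"
proof -
  assume "poly_time f"
  then have "poly_time (\<lambda>x. foldl (\<lambda>a y. y # a) [] (f x))"
    by (intro poly_time_foldl_additive[where h = "\<lambda>n. n + 1"] pt_intros poly_bounded_intros) auto
  moreover have "foldl (\<lambda>a y. y # a) [] xs = rev xs" for xs :: "'b list"
    by (induction xs rule: rev_induct) auto
  ultimately show ?thesis by simp
qed

lemma poly_time_append [pt_intros]:
  assumes "poly_time f" "poly_time g"
  shows "poly_time (\<lambda>x. f x @ g x)"
proof -
  have "poly_time (\<lambda>x. foldl (\<lambda>a y. y # a) (g x) (rev (f x)))"
    by (intro poly_time_foldl_additive[where h = "\<lambda>n. n + 1"] pt_intros poly_bounded_intros assms)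
      auto
  moreover have "foldl (\<lambda>a y. y # a) ys (rev xs) = xs @ ys" for xs ys :: "'b list"
    by (induction xs) auto
  ultimately show ?thesis by simp
qed

lemma poly_time_map [pt_intros]:
  fixes F :: "'a::treeable \<Rightarrow> 'b::treeable \<Rightarrow> 'c::treeable"
  assumes "poly_time (\<lambda>p. F (fst p) (snd p))" "poly_time l"
  shows "poly_time (\<lambda>x. map (F x) (l x))"
proof -
  obtain h where h: "poly_bounded h" "mono h" "\<And>p. tsz (F (fst p) (snd p)) \<le> h (tsz p)"
    using poly_time_size[OF assms(1)] by blast
  have F: "tsz (F x y) \<le> h (tsz x + tsz y + 1)" for x y
    using h(3)[of "(x, y)"] by (simp add: tsz_prod)
  have "poly_time (\<lambda>x. foldl (\<lambda>a y. F x y # a) [] (l x))"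
  proof (rule poly_time_foldl_additive[where h = "\<lambda>n. h (n + 1) + 1"])
    show "poly_time (\<lambda>p. F (fst p) (snd (snd p)) # fst (snd p))"
      by (intro pt_intros poly_time_comp2[OF assms(1)])
    show "poly_bounded (\<lambda>n. h (n + 1) + 1)"
      by (intro poly_bounded_intros poly_bounded_comp[OF h(1)])
    show "tsz (F x y # a) \<le> tsz a + (h (tsz x + tsz y + 1) + 1)" for x a y
      using F[of x y] by simp
  qed (intro pt_intros assms)+
  moreover have "foldl (\<lambda>a y. F x y # a) [] xs = rev (map (F x) xs)" for x xs
    by (induction xs rule: rev_induct) auto
  ultimately have "poly_time (\<lambda>x. rev (map (F x) (l x)))" by simp
  from poly_time_rev[OF this] show ?thesis by simp
qed

lemma poly_time_filter [pt_intros]: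
  fixes P :: "'a::treeable \<Rightarrow> 'b::treeable \<Rightarrow> bool"
  assumes "poly_time (\<lambda>p. P (fst p) (snd p))" "poly_time l"
  shows "poly_time (\<lambda>x. filter (P x) (l x))"
proof -
  have "poly_time (\<lambda>x. foldl (\<lambda>a y. if P x y then y # a else a) [] (l x))"
    by (intro poly_time_foldl_additive[where h = "\<lambda>n. n + 1"] pt_intros assms
        poly_bounded_intros poly_time_comp2[OF assms(1)]) auto
  moreover have "foldl (\<lambda>a y. if P x y then y # a else a) [] xs = rev (filter (P x) xs)" for x xs
    by (induction xs rule: rev_induct) auto
  ultimately have "poly_time (\<lambda>x. rev (filter (P x) (l x)))" by simp
  from poly_time_rev[OF this] show ?thesis by simp
qed

lemma poly_time_concat [pt_intros]:
  assumes "poly_time f"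
  shows "poly_time (\<lambda>x. concat (f x))"
proof -
  have "poly_time (\<lambda>x. foldl (\<lambda>a y. a @ y) [] (f x))"
  proof (intro poly_time_foldl_additive[where h = "\<lambda>n. n"] pt_intros assms poly_bounded_intros)
    show "tsz (a @ y) \<le> tsz a + (tsz x + tsz y)" for x :: 'a and a y :: "'b list"
      using tsz_append[of a y] by simp
  qed
  moreover have "foldl (\<lambda>a y. a @ y) [] xs = concat xs" for xs :: "'b list list"
    by (induction xs rule: rev_induct) auto
  ultimately show ?thesis by simp
qed

lemma poly_time_length [pt_intros]:
  assumes "poly_time f"
  shows "poly_time (\<lambda>x. length (f x))"
proof -
  have "poly_time (\<lambda>x. foldl (\<lambda>a _. Suc a) 0 (f x))"
    by (intro poly_time_foldl_additive[where h = "\<lambda>_. 4"] pt_intros assms poly_bounded_intros) auto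
  moreover have "foldl (\<lambda>a _. Suc a) 0 xs = length xs" for xs :: "'b list"
    by (induction xs rule: rev_induct) auto
  ultimately show ?thesis by simp
qed

lemma poly_time_replicate_True:
  "poly_time f \<Longrightarrow> poly_time (\<lambda>x. replicate (f x) True)"
  by (erule poly_time_same_tree) (simp add: to_tree_replicate)

lemma poly_time_funpow:
  fixes F :: "'a::treeable \<Rightarrow> 'b::treeable \<Rightarrow> 'b"
  assumes "poly_time (\<lambda>p. F (fst p) (snd p))" "poly_time f" "poly_time n"
    and "poly_bounded h" "\<And>x a. tsz (F x a) \<le> tsz a + h (tsz x)"
  shows "poly_time (\<lambda>x. (F x ^^ n x) (f x))"
proof -
  obtain h' where h': "poly_bounded h'" "mono h'" "\<And>n. h n \<le> h' n"
    using poly_bounded_mono[OF assms(4)] by blast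
  have "poly_time (\<lambda>x. foldl (\<lambda>a _. F x a) (f x) (replicate (n x) True))"
  proof (rule poly_time_foldl_additive[where h = h'])
    show "poly_time (\<lambda>p. F (fst p) (fst (snd p)))"
      by (intro poly_time_comp2[OF assms(1)] pt_intros)
    show "tsz (F x a) \<le> tsz a + h' (tsz x + tsz y)" for x a and y :: bool
      using assms(5)[of x a] h'(3)[of "tsz x"] monoD[OF h'(2), of "tsz x" "tsz x + tsz y"] by simp
  qed (intro assms h' poly_time_replicate_True)+
  moreover have "foldl (\<lambda>a _. F x a) b (replicate k True) = (F x ^^ k) b" for x b k
    by (induction k arbitrary: b) (auto simp: funpow_swap1)
  ultimately show ?thesis by simp
qed

lemma poly_time_add [pt_intros]:
  assumes "poly_time f" "poly_time g"
  shows "poly_time (\<lambda>x. f x + g x :: nat)"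
proof -
  have "poly_time (\<lambda>x. (Suc ^^ g x) (f x))"
    by (rule poly_time_funpow[where h = "\<lambda>_. 4"])
      (intro pt_intros assms poly_bounded_intros | simp)+
  moreover have "(Suc ^^ n) m = m + n" for m n
    by (induction n) auto
  ultimately show ?thesis by (simp only:)
qed

lemma poly_time_mult [pt_intros]:
  assumes "poly_time f" "poly_time g"
  shows "poly_time (\<lambda>x. f x * g x :: nat)"
proof -
  have "poly_time (\<lambda>p::nat \<times> nat. ((\<lambda>a. a + fst p) ^^ snd p) 0)"
    by (rule poly_time_funpow[where h = "\<lambda>n. n"])
      (intro pt_intros poly_bounded_intros | simp add: tsz_prod tsz_nat)+
  moreover have "((\<lambda>a. a + m) ^^ n) 0 = m * n" for m n :: nat
    by (induction n) auto
  ultimately have "poly_time (\<lambda>p::nat \<times> nat. fst p * snd p)" by simp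
  from poly_time_comp2[OF this assms] show ?thesis .
qed

lemma poly_time_power [pt_intros]: "poly_time f \<Longrightarrow> poly_time (\<lambda>x. f x ^ e :: nat)"
  by (induction e) (auto intro: pt_intros)

lemma poly_time_diff [pt_intros]:
  assumes "poly_time f" "poly_time g"
  shows "poly_time (\<lambda>x. f x - g x :: nat)"
proof -
  have "poly_time (\<lambda>x. ((\<lambda>a. a - 1) ^^ g x) (f x))"
    by (rule poly_time_funpow[where h = "\<lambda>_. 0"])
      (intro pt_intros poly_time_pred assms poly_bounded_intros | simp add: tsz_nat)+
  moreover have "((\<lambda>a. a - 1) ^^ n) m = m - n" for m n :: nat
    by (induction n) auto
  ultimately show ?thesis by simp
qed

lemma poly_time_drop [pt_intros]:
  assumes "poly_time f" "poly_time g"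
  shows "poly_time (\<lambda>x. drop (f x) (g x))"
proof -
  have "tsz (tl a) \<le> tsz a" for a :: "'b list"
    by (cases a) auto
  then have "poly_time (\<lambda>x. (tl ^^ f x) (g x))"
    by (intro poly_time_funpow[where h = "\<lambda>_. 0"] pt_intros assms poly_bounded_intros) simp
  moreover have "(tl ^^ n) xs = drop n xs" for n and xs :: "'b list"
    by (induction n) (auto simp: drop_Suc tl_drop)
  ultimately show ?thesis by simp
qed

lemma poly_time_take [pt_intros]:
  assumes "poly_time f" "poly_time g"
  shows "poly_time (\<lambda>x. take (f x) (g x))"
proof -
  have "poly_time (\<lambda>x. rev (drop (length (g x) - f x) (rev (g x))))"
    by (intro pt_intros assms)
  then show ?thesis
  proof (rule poly_time_cong)
    show "rev (drop (length (g x) - f x) (rev (g x))) = take (f x) (g x)" for x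
      by (cases "f x \<le> length (g x)") (auto simp: drop_rev)
  qed
qed

lemma poly_time_le [pt_intros]:
  "poly_time f \<Longrightarrow> poly_time g \<Longrightarrow> poly_time (\<lambda>x. (f x :: nat) \<le> g x)"
  using poly_time_eq_0[OF poly_time_diff[of f g]] by simp

lemma poly_time_less [pt_intros]:
  "poly_time f \<Longrightarrow> poly_time g \<Longrightarrow> poly_time (\<lambda>x. (f x :: nat) < g x)"
  using poly_time_le[OF poly_time_Suc[of f], of g] by (simp add: Suc_le_eq)

lemma poly_time_eq_nat [pt_intros]:
  "poly_time f \<Longrightarrow> poly_time g \<Longrightarrow> poly_time (\<lambda>x. (f x :: nat) = g x)"
  using poly_time_conj[OF poly_time_le[of f g] poly_time_le[of g f]] by (simp add: eq_iff)

text \<open>The functions of the reduction index lists by \<open>nth_default\<close>: a program must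
  agree with its function on every input, and out of range \<open>nth\<close> has no specified value
  to agree with.\<close>

lemma poly_time_nth_default [pt_intros]:
  fixes f :: "'a::treeable \<Rightarrow> 'b::treeable list"
  assumes "poly_time d" "poly_time f" "poly_time g"
  shows "poly_time (\<lambda>x. nth_default (d x) (f x) (g x))"
proof -
  let ?hd = "\<lambda>d xs. if to_tree xs \<noteq> Leaf then hd xs else d :: 'b"
  have "tree_poly (codes TYPE('b \<times> 'b list))
    (\<lambda>x. if right x \<noteq> Leaf then left (right x) else left x)"
    by (intro tree_poly_if tree_poly_right tree_poly_left
        tree_poly_comp[OF tree_poly_left[of UNIV] tree_poly_right]) auto
  moreover have "(if right (to_tree p) \<noteq> Leaf then left (right (to_tree p)) else left (to_tree p))
    = to_tree (?hd (fst p) (snd p))" for p :: "'b \<times> 'b list"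
    by (cases "snd p") (auto simp: to_tree_prod_def)
  ultimately have "poly_time (\<lambda>p. ?hd (fst p) (snd p))"
    unfolding poly_time_def by blast
  from poly_time_comp2[OF this assms(1) poly_time_drop[OF assms(3,2)]]
  have "poly_time (\<lambda>x. ?hd (d x) (drop (g x) (f x)))" .
  moreover have "?hd c (drop n xs) = nth_default c xs n" for c xs n
  proof (cases "n < length xs")
    case True
    then show ?thesis
      by (simp add: nth_default_def hd_drop_conv_nth Cons_nth_drop_Suc[symmetric])
  qed (simp add: nth_default_def)
  ultimately show ?thesis by simp
qed

lemma poly_time_ball [pt_intros]:
  assumes "poly_time (\<lambda>p. P (fst p) (snd p))" "poly_time l"
  shows "poly_time (\<lambda>x. \<forall>y \<in> set (l x). P x y)"
proof -
  have "poly_time (\<lambda>x. filter (\<lambda>y. \<not> P x y) (l x) = [])"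
    by (intro pt_intros assms)
  then show ?thesis by (simp add: filter_empty_conv)
qed

lemma poly_time_bex [pt_intros]:
  assumes "poly_time (\<lambda>p. P (fst p) (snd p))" "poly_time l"
  shows "poly_time (\<lambda>x. \<exists>y \<in> set (l x). P x y)"
proof -
  have "poly_time (\<lambda>x. \<not> (\<forall>y \<in> set (l x). \<not> P x y))"
    by (intro pt_intros assms)
  then show ?thesis by simp
qed

text \<open>The appended element is the length of the accumulator, so the step is not additive; the
  prefixes \<open>[0..<m]\<close> are instead bounded directly, by a quadratic polynomial.\<close>

lemma poly_time_upt [pt_intros]:
  assumes "poly_time f"
  shows "poly_time (\<lambda>x. [0..<f x])"
proof -
  have up: "foldl (\<lambda>a _. a @ [length a]) [] xs = [0..<length xs]" for xs :: "bool list"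
    by (induction xs rule: rev_induct) auto
  have size: "tsz [0..<n] \<le> n * (4 * n + 2) + 1" for n
  proof (induction n)
    case (Suc n)
    then show ?case
      using tsz_append[of "[0..<n]" "[n]"] by (simp add: tsz_nat algebra_simps)
  qed simp
  obtain h where h: "poly_bounded h" "mono h" "\<And>x. tsz (f x) \<le> h (tsz x)"
    using poly_time_size[OF assms] by blast
  have "poly_time (\<lambda>x. foldl (\<lambda>a _. a @ [length a]) [] (replicate (f x) True))"
  proof (rule poly_time_foldl)
    show "poly_bounded (\<lambda>n. h n * (4 * h n + 2) + 1)"
      by (intro poly_bounded_intros h(1))
    fix x ys zs
    assume "replicate (f x) True = ys @ zs"
    then have "length ys \<le> f x"
      by (metis length_append length_replicate le_add1)
    then have "length ys \<le> h (tsz x)"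
      using h(3)[of x] by (simp add: tsz_nat)
    then show "tsz (foldl (\<lambda>a _. a @ [length a]) [] ys) \<le> h (tsz x) * (4 * h (tsz x) + 2) + 1"
      using size[of "length ys"] unfolding up
      by (meson add_le_mono1 mult_le_mono mult_le_mono2 order_trans)
  qed (intro pt_intros poly_time_replicate_True assms)+
  then show ?thesis by (simp add: up)
qed

lemma poly_time_all_less [pt_intros]:
  assumes "poly_time (\<lambda>p. P (fst p) (snd p))" "poly_time n"
  shows "poly_time (\<lambda>x. \<forall>i < n x :: nat. P x i)"
proof -
  have "poly_time (\<lambda>x. \<forall>i \<in> set [0..<n x]. P x i)"
    by (intro pt_intros assms)
  then show ?thesis by (simp add: Ball_def)
qed

lemma poly_time_replicate [pt_intros]:
  assumes "poly_time n" "poly_time c"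
  shows "poly_time (\<lambda>x. replicate (n x) (c x))"
proof -
  have "poly_time (\<lambda>x. map (\<lambda>_. c x) [0..<n x])"
    by (intro pt_intros assms poly_time_comp[OF assms(2)])
  then show ?thesis by (simp add: map_replicate_const)
qed

text \<open>The exponent \<open>a\<close> is a constant: induction on it composes a fixed number of
  polynomial-time maps. With \<open>a\<close> as part of the input, the output would be
  exponential.\<close>

lemma poly_time_n_lists [pt_intros]:
  assumes "poly_time l"
  shows "poly_time (\<lambda>x. List.n_lists a (l x))"
  by (induction a) (auto intro!: pt_intros poly_time_comp[OF assms])

lemma list_eq_iff_nth_default:
  "xs = ys \<longleftrightarrow> length xs = length ys \<and> (\<forall>i < length xs. nth_default c xs i = nth_default c ys i)"
  by (auto simp: list_eq_iff_nth_eq nth_default_def)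

lemma poly_time_eq_bits:
  assumes "poly_time f" "poly_time g"
  shows "poly_time (\<lambda>x. (f x :: bool list) = g x)"
  unfolding list_eq_iff_nth_default[where c = False]
  by (intro pt_intros poly_time_comp[OF assms(1)] poly_time_comp[OF assms(2)] assms)

lemma poly_time_distinct:
  assumes "poly_time f"
  shows "poly_time (\<lambda>x. distinct (f x :: nat list))"
proof -
  have "distinct xs \<longleftrightarrow> (\<forall>i < length xs. \<forall>j < length xs. i = j \<or>
      \<not> nth_default 0 xs i = nth_default 0 xs j)" for xs :: "nat list"
    by (auto simp: distinct_conv_nth nth_default_def)
  then show ?thesis
    by (simp only:) (intro pt_intros poly_time_comp[OF assms] assms)
qed


section \<open>Composing fpt-reductions with polynomial-time reductions\<close>

text \<open>Height is the measure that sharing cannot inflate: evaluating an expression raises it by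
  at most the cost of the expression. As a bit string lies along the right spine, height bounds its
  length.\<close>

primrec theight :: "tree \<Rightarrow> nat" where
  "theight Leaf = 0"
| "theight (Pair a b) = max (theight a) (theight b) + 1"

lemma theight_eval: "(\<And>i. theight (s i) \<le> H) \<Longrightarrow> theight (eval e s) \<le> H + cost e"
proof (induction e)
  case (Hd e)
  then show ?case by (cases "eval e s") fastforce+
next
  case (Tl e)
  then show ?case by (cases "eval e s") fastforce+
next
  case (Cns e1 e2)
  then show ?case by fastforce
qed (auto intro: le_SucI)

lemma theight_exec:
  "exec c s t s' \<Longrightarrow> (\<And>i. theight (s i) \<le> H) \<Longrightarrow> theight (s' i) \<le> H + t"
proof (induction c s t s' arbitrary: H i rule: exec.induct)
  case (Assign j e s)
  then show ?case using theight_eval[of s H e] by (simp add: trans_le_add1 le_SucI)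
next
  case (Seq c s t s' c' t' s'')
  then show ?case by (metis add.assoc)
next
  case (IfTrue e s c t s' c')
  then show ?case by (meson add_le_mono le_add2 le_refl order_trans)
next
  case (IfFalse e s c' t s' c)
  then show ?case by (meson add_le_mono le_add2 le_refl order_trans)
next
  case (WhileFalse e s c)
  then show ?case by (metis trans_le_add1)
next
  case (WhileTrue e s c t s' t' s'')
  have "theight (s'' i) \<le> (H + t) + t'"
    using WhileTrue.IH WhileTrue.prems by blast
  then show ?case by simp
qed

lemma theight_bits: "length x \<le> theight (tree_of_bits x)" "theight (tree_of_bits x) \<le> length x + 1"
  by (induction x) auto

lemma run_length:
  assumes "run c x t y"
  shows "length y \<le> length x + 1 + t"
proof -
  obtain s where s: "exec c ((\<lambda>_. Leaf)(0 := tree_of_bits x)) t s" "s 0 = tree_of_bits y"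
    using assms unfolding run_def by blast
  have "theight (s 0) \<le> length x + 1 + t"
    by (rule theight_exec[OF s(1)]) (use theight_bits(2)[of x] in auto)
  then show ?thesis
    using theight_bits(1)[of y] s(2) by simp
qed

lemma poly_time_program:
  fixes f :: "'a::treeable \<Rightarrow> 'b::treeable"
  assumes "poly_time f"
  obtains c h where "poly_bounded h" "mono h"
    "\<And>s x. s 0 = to_tree x \<Longrightarrow> \<exists>t s'. exec c s t s' \<and> t \<le> h (tsz x) \<and> s' 0 = to_tree (f x)"
proof -
  obtain F where F: "tree_poly (codes TYPE('a)) F" "\<And>x. F (to_tree x) = to_tree (f x)"
    using poly_timeE[OF assms] by blast
  obtain h where h: "poly_bounded h" "mono h"
    "\<And>x. x \<in> codes TYPE('a) \<Longrightarrow> tsize (F x) \<le> h (tsize x)"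
    "\<And>b. \<exists>c. computes_at b c (codes TYPE('a)) F h"
    using tree_polyE[OF F(1)] by blast
  obtain c where c: "computes_at 0 c (codes TYPE('a)) F h"
    using h(4) by blast
  show ?thesis
  proof (rule that[OF h(1,2)])
    fix s :: store and x :: 'a
    assume "s 0 = to_tree x"
    then obtain t s' where "exec c s t s'" "t \<le> h (tsz x)" "s' 0 = F (to_tree x)"
      using c unfolding computes_at_def by (metis rangeI)
    then show "\<exists>t s'. exec c s t s' \<and> t \<le> h (tsz x) \<and> s' 0 = to_tree (f x)"
      using F(2) by auto
  qed
qed

lemma computable_poly_time_comp:
  assumes "computable f" "poly_time H"
  shows "computable (\<lambda>n. H (f n))"
proof -
  obtain c where c: "\<And>n. \<exists>t. run c (replicate n True) t (replicate (f n) True)"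
    using assms(1) unfolding computable_def by blast
  obtain d h where d: "poly_bounded h" "mono h"
    "\<And>s x. s 0 = to_tree x \<Longrightarrow> \<exists>t s'. exec d s t s' \<and> t \<le> h (tsz x) \<and> s' 0 = to_tree (H x)"
    by (rule poly_time_program[OF assms(2)], rule that)
  show ?thesis
    unfolding computable_def
  proof (intro exI[of _ "Seq c d"] allI)
    fix n
    obtain t s where s: "exec c ((\<lambda>_. Leaf)(0 := tree_of_bits (replicate n True))) t s"
      "s 0 = tree_of_bits (replicate (f n) True)"
      using c unfolding run_def by blast
    obtain t' s' where "exec d s t' s'" "s' 0 = to_tree (H (f n))"
      using d(3)[of s "f n"] s(2) by (auto simp: tree_of_bits_eq to_tree_replicate)
    then show "\<exists>t. run (Seq c d) (replicate n True) t (replicate (H (f n)) True)"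
      using exec.Seq[OF s(1)] unfolding run_def
      by (metis tree_of_bits_eq to_tree_replicate)
  qed
qed

lemma tsz_bits: "tsz (x :: bits) \<le> 4 * length x + 1"
  by (induction x) (auto simp: to_tree_bool_def)

text \<open>The second program runs on \<open>R x\<close>, whose length is controlled only through
  the running time of the first. Its time is thus a power of \<open>f k * n ^ p\<close>, where
  \<open>k\<close> is the parameter; this splits into a function of \<open>k\<close> and a power of
  \<open>n\<close>. Monotonicity of \<open>g'\<close> is used because only an upper bound on the
  intermediate parameter is known.\<close>

lemma fpt_reducible_poly_time_trans:
  assumes red: "A \<le>\<^sub>f\<^sub>p\<^sub>t B" and R': "poly_time R'"
    and correct: "\<And>x. x \<in> fst B \<longleftrightarrow> R' x \<in> fst C"
    and par: "\<And>x. snd C (R' x) \<le> g' (snd B x)" and g': "poly_time g'" "mono g'"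
  shows "A \<le>\<^sub>f\<^sub>p\<^sub>t C"
proof -
  obtain R c f g p where fg: "computable f" "computable g"
    and R: "\<And>x. \<exists>t \<le> f (snd A x) * (length x + 1) ^ p. run c x t (R x)"
      "\<And>x. x \<in> fst A \<longleftrightarrow> R x \<in> fst B" "\<And>x. snd B (R x) \<le> g (snd A x)"
    using red unfolding fpt_reducible_def by blast
  obtain d h where d: "poly_bounded h" "mono h"
    "\<And>s x. s 0 = to_tree x \<Longrightarrow> \<exists>t s'. exec d s t s' \<and> t \<le> h (tsz x) \<and> s' 0 = to_tree (R' x)"
    by (rule poly_time_program[OF R'], rule that)
  obtain K q where K: "\<And>n. h n \<le> K * (n + 1) ^ q"
    using d(1) unfolding poly_bounded_def by blast
  \<comment> \<open>The first summand pays for the first program, the second for the second one. The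
    10 comes from \<open>tsz (R x) + 1 \<le> 4 * (n + t) + 2\<close> with
    \<open>n = length x + 1\<close>: 4 tree nodes per bit, and constants absorbed into powers of
    \<open>n\<close>.\<close>
  define H where "H = (\<lambda>m::nat. m + K * (10 * (m + 1)) ^ q)"
  have H: "poly_time H"
    unfolding H_def by (intro pt_intros)
  show ?thesis
    unfolding fpt_reducible_def
  proof (rule exI[of _ "\<lambda>x. R' (R x)"], rule exI[of _ "Seq c d"], rule exI[of _ "\<lambda>n. H (f n)"],
      rule exI[of _ "\<lambda>n. g' (g n)"], rule exI[of _ "p + (p + 1) * q"], intro conjI allI)
    show "computable (\<lambda>n. H (f n))" "computable (\<lambda>n. g' (g n))"
      by (rule computable_poly_time_comp[OF fg(1) H] computable_poly_time_comp[OF fg(2) g'(1)])+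
    fix x
    show "x \<in> fst A \<longleftrightarrow> R' (R x) \<in> fst C"
      using R(2) correct by simp
    show "snd C (R' (R x)) \<le> g' (g (snd A x))"
      using par[of "R x"] monoD[OF g'(2) R(3)[of x]] by simp
    let ?n = "length x + 1" and ?F = "f (snd A x)"
    obtain t where t: "t \<le> ?F * ?n ^ p" "run c x t (R x)"
      using R(1) by blast
    obtain s where s: "exec c ((\<lambda>_. Leaf)(0 := tree_of_bits x)) t s" "s 0 = tree_of_bits (R x)"
      using t(2) unfolding run_def by blast
    obtain t' s' where 2: "exec d s t' s'" "t' \<le> h (tsz (R x))" "s' 0 = to_tree (R' (R x))"
      using d(3)[of s "R x"] s(2) by (auto simp: tree_of_bits_eq)
    have np: "?n ^ p \<le> ?n ^ (p + 1)" "?n \<le> ?n ^ (p + 1)" "1 \<le> ?n ^ (p + 1)"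
      using power_increasing[of p "p + 1" ?n] power_increasing[of 1 "p + 1" ?n]
        power_increasing[of 0 "p + 1" ?n] by simp_all
    have "tsz (R x) + 1 \<le> 4 * (?n + t) + 2"
      using tsz_bits[of "R x"] run_length[OF t(2)] by simp
    also have "\<dots> \<le> 4 * (?n ^ (p + 1) + ?F * ?n ^ (p + 1)) + 2 * ?n ^ (p + 1)"
    proof -
      have "4 * (a + t) + 2 \<le> 4 * (X + Y) + 2 * X" if "a \<le> X" "1 \<le> X" "t \<le> Y" for a X Y :: nat
        using that by presburger
      from this[OF np(2,3) order_trans[OF t(1) mult_le_mono2[OF np(1)]]] show ?thesis .
    qed
    also have "\<dots> \<le> 10 * (?F + 1) * ?n ^ (p + 1)"
      by (simp add: algebra_simps)
    finally have "(tsz (R x) + 1) ^ q \<le> (10 * (?F + 1) * ?n ^ (p + 1)) ^ q"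
      by (rule power_mono) simp
    also have "\<dots> = (10 * (?F + 1)) ^ q * ?n ^ ((p + 1) * q)"
      by (simp only: power_mult_distrib power_mult)
    finally have "t' \<le> K * ((10 * (?F + 1)) ^ q * ?n ^ ((p + 1) * q))"
      using 2(2) K[of "tsz (R x)"] by (meson mult_le_mono2 order_trans)
    moreover have "?n ^ ((p + 1) * q) \<le> ?n ^ (p + (p + 1) * q)" "?n ^ p \<le> ?n ^ (p + (p + 1) * q)"
      using power_increasing[of "(p + 1) * q" "p + (p + 1) * q" ?n]
        power_increasing[of p "p + (p + 1) * q" ?n] by simp_all
    ultimately have "t + t' \<le> ?F * ?n ^ (p + (p + 1) * q) +
        K * ((10 * (?F + 1)) ^ q * ?n ^ (p + (p + 1) * q))"
      using t(1) by (meson add_mono mult_le_mono2 order_trans)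
    then have "t + t' \<le> H ?F * ?n ^ (p + (p + 1) * q)"
      by (simp add: H_def algebra_simps)
    moreover have "run (Seq c d) x (t + t') (R' (R x))"
      unfolding run_def using exec.Seq[OF s(1) 2(1)] 2(3) by (auto simp: tree_of_bits_eq)
    ultimately show "\<exists>t \<le> H ?F * ?n ^ (p + (p + 1) * q). run (Seq c d) x t (R' (R x))"
      by blast
  qed
qed


section \<open>From binary constraint satisfaction to disjoint paths\<close>

text \<open>A discrete intermediate value theorem: a walk with unit steps cannot jump over a
  number.\<close>

lemma walk_covers:
  fixes p :: "nat list"
  assumes "successively (\<lambda>u v. v = u + 1 \<or> u = v + 1) p" "p \<noteq> []"
    and "hd p \<le> w \<and> w \<le> last p \<or> last p \<le> w \<and> w \<le> hd p"
  shows "w \<in> set p"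
  using assms
proof (induction p)
  case (Cons u p)
  show ?case
  proof (cases "p = [] \<or> w = u")
    case False
    then have "hd p = u + 1 \<or> u = hd p + 1" "successively (\<lambda>u v. v = u + 1 \<or> u = v + 1) p" "p \<noteq> []"
      using Cons.prems(1) by (auto simp: successively_Cons)
    then show ?thesis
      using Cons.IH Cons.prems(3) False by auto
  qed (use Cons.prems in auto)
qed simp

lemma successively_const:
  assumes "successively (\<lambda>u v. f u = f v) p" "v \<in> set p"
  shows "f v = f (hd p)"
  using assms
proof (induction p)
  case (Cons u p)
  then show ?case by (cases p) (auto simp: successively_Cons)
qed simp

text \<open>At least as many disjoint nonempty sets as there are points to share: counting leaves
  exactly one point per set and no point over. It is applied to the sets of hubs on the routed
  paths.\<close>

lemma card_disjoint_nonempty: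
  assumes "finite M" "finite H" "card H \<le> card M"
    and "\<And>m. m \<in> M \<Longrightarrow> S m \<noteq> {} \<and> S m \<subseteq> H"
    and "\<And>m m'. m \<in> M \<Longrightarrow> m' \<in> M \<Longrightarrow> m \<noteq> m' \<Longrightarrow> S m \<inter> S m' = {}"
    and "h \<in> H"
  shows "\<exists>m \<in> M. S m = {h}"
proof -
  have fin: "finite (S m)" if "m \<in> M" for m
    using assms(2,4) that finite_subset by blast
  have pos: "1 \<le> card (S m)" if "m \<in> M" for m
    using assms(4)[OF that] fin[OF that] by (simp add: Suc_le_eq card_gt_0_iff)
  have union: "card (\<Union>m\<in>M. S m) = (\<Sum>m\<in>M. card (S m))"
    using assms(1,5) fin by (intro card_UN_disjoint) auto
  have sub: "(\<Union>m\<in>M. S m) \<subseteq> H"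
    using assms(4) by blast
  then have le: "(\<Sum>m\<in>M. card (S m)) \<le> card H"
    using union card_mono[OF assms(2)] by metis
  have ge: "card M \<le> (\<Sum>m\<in>M. card (S m))"
    using sum_mono[of M "\<lambda>_. 1" "\<lambda>m. card (S m)"] pos by simp
  have "(\<Union>m\<in>M. S m) = H"
    using card_subset_eq[OF assms(2) sub] union le ge assms(3) by simp
  then obtain m where m: "m \<in> M" "h \<in> S m"
    using assms(6) by blast
  have "card (S m) = 1"
  proof (rule ccontr)
    assume "card (S m) \<noteq> 1"
    then have "(\<Sum>m\<in>M. 1) < (\<Sum>m\<in>M. card (S m))"
      using pos m(1) assms(1) by (intro sum_strict_mono_ex1) (auto intro!: bexI[of _ m] simp: le_neq_implies_less)
    then show False
      using le assms(3) by simp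
  qed
  then show ?thesis
    using m by (metis One_nat_def card_1_singleton_iff singletonD)
qed

lemma max_ndp_ge_iff:
  assumes "finite M"
  shows "l \<le> max_ndp V E cap M \<longleftrightarrow> (\<exists>M' \<subseteq> M. routable V E cap M' \<and> l \<le> card M')"
proof -
  have "finite {M'. M' \<subseteq> M \<and> routable V E cap M'}"
    using assms by (rule rev_finite_subset[OF finite_Pow_iff[THEN iffD2]]) auto
  moreover have "{} \<in> {M'. M' \<subseteq> M \<and> routable V E cap M'}"
    by (auto simp: routable_def)
  ultimately show ?thesis
    unfolding max_ndp_def by (subst Max_ge_iff) auto
qed

text \<open>Indexing the paths by \<open>I\<close> avoids handling the pairs themselves. Distinct
  indices have distinct pairs because every path contains its first terminal.\<close>

lemma routable_disjoint_paths:
  assumes "finite I" "\<And>h. h \<in> I \<Longrightarrow> pr h \<in> M"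
    and path: "\<And>h. h \<in> I \<Longrightarrow> is_path V E (fst (pr h)) (ph h) (snd (pr h))"
    and disj: "\<And>h h' v. h \<in> I \<Longrightarrow> h' \<in> I \<Longrightarrow> v \<in> set (ph h) \<Longrightarrow> v \<in> set (ph h') \<Longrightarrow> h = h'"
  shows "\<exists>M' \<subseteq> M. routable V E (\<lambda>_. 1) M' \<and> card I \<le> card M'"
proof (intro exI conjI)
  have inj: "inj_on pr I"
  proof (rule inj_onI)
    fix h h' assume h: "h \<in> I" "h' \<in> I" "pr h = pr h'"
    have "fst (pr h) \<in> set (ph h)" if "h \<in> I" for h
      using path[OF that] unfolding is_path_def by (metis hd_in_set)
    then show "h = h'"
      using disj h by metis
  qed
  show "pr ` I \<subseteq> M"
    using assms(2) by blast
  show "card I \<le> card (pr ` I)"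
    using inj by (simp add: card_image)
  show "routable V E (\<lambda>_. 1) (pr ` I)"
    unfolding routable_def
  proof (intro exI[of _ "\<lambda>m. ph (inv_into I pr m)"] conjI ballI)
    fix v
    have "{m \<in> pr ` I. v \<in> set (ph (inv_into I pr m))} \<subseteq> pr ` {h \<in> I. v \<in> set (ph h)}"
      using inj by (auto simp: inv_into_f_f)
    then have "card {m \<in> pr ` I. v \<in> set (ph (inv_into I pr m))} \<le> card (pr ` {h \<in> I. v \<in> set (ph h)})"
      using assms(1) by (intro card_mono) auto
    also have "\<dots> \<le> card {h \<in> I. v \<in> set (ph h)}"
      using assms(1) by (intro card_image_le) auto
    also have "\<dots> \<le> 1"
      using disj assms(1) by (auto simp: card_le_Suc0_iff_eq)
    finally show "card {m \<in> pr ` I. v \<in> set (ph (inv_into I pr m))} \<le> 1" .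
  next
    fix m assume "m \<in> pr ` I"
    then obtain h where h: "h \<in> I" "m = pr h" by blast
    then show "case m of (s, t) \<Rightarrow> is_path V E s (ph (inv_into I pr (s, t))) t"
      using path[OF h(1)] inj by (simp add: case_prod_unfold inv_into_f_f)
  qed
qed

section \<open>The graph and the terminal pairs of a constraint satisfaction problem\<close>

definition csp_solvable :: "nat \<Rightarrow> nat \<Rightarrow> (nat \<Rightarrow> nat \<Rightarrow> nat \<Rightarrow> nat \<Rightarrow> bool) \<Rightarrow> bool" where
  "csp_solvable K N ok \<longleftrightarrow>
     (\<exists>f. (\<forall>i < K. f i < N) \<and> (\<forall>i < K. \<forall>j < K. i \<le> j \<longrightarrow> ok i (f i) j (f j)))"

definition line_len :: "nat \<Rightarrow> nat \<Rightarrow> nat" where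
  "line_len K N = N * (K + 2)"

definition lvert :: "nat \<Rightarrow> nat \<Rightarrow> nat \<Rightarrow> nat \<Rightarrow> nat" where
  "lvert K N a p = a * line_len K N + p"

definition cell :: "nat \<Rightarrow> nat \<Rightarrow> nat \<Rightarrow> nat" where
  "cell K x c = x * (K + 2) + c"

definition hub_base :: "nat \<Rightarrow> nat \<Rightarrow> nat" where
  "hub_base K N = 2 * K * line_len K N"

text \<open>A mixed-radix numbering of the triples \<open>(t, i, j)\<close> with
  \<open>t < 3\<close> and \<open>i, j < K\<close>. Hence the block of \<open>3 * K * K\<close>
  numbers after the lines; those that belong to no hub are isolated vertices.\<close>

definition hub :: "nat \<Rightarrow> nat \<Rightarrow> nat \<times> nat \<times> nat \<Rightarrow> nat" where
  "hub K N h = hub_base K N + (fst h * K + fst (snd h)) * K + snd (snd h)"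

definition hubs :: "nat \<Rightarrow> (nat \<times> nat \<times> nat) list" where
  "hubs K = map (\<lambda>i. (0, i, 0)) [0..<K] @ map (\<lambda>i. (1, i, 0)) [0..<K] @
     concat (map (\<lambda>i. map (\<lambda>j. (2, i, j)) (filter (\<lambda>j. i < j) [0..<K])) [0..<K])"

text \<open>There are \<open>2 * K\<close> disjoint lines \<open>L\<^sub>0, \<dots>, L\<^sub>K\<^sub>-\<^sub>1, M\<^sub>0, \<dots>, M\<^sub>K\<^sub>-\<^sub>1\<close>, each with one block of
  \<open>K + 2\<close> vertices per value. The hubs \<open>(0, i, 0)\<close> and \<open>(1, i, 0)\<close> join \<open>L\<^sub>i\<close> and \<open>M\<^sub>i\<close> to a ring, and
  \<open>(2, i, j)\<close> with \<open>i < j\<close> joins \<open>L\<^sub>i\<close> and \<open>L\<^sub>j\<close>. Two pairs routed around the ring of \<open>i\<close> block all of \<open>L\<^sub>i\<close>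
  except the interior of one block \<open>x\<close>; in it, the vertex at offset \<open>1 + j\<close> is the terminal for the
  constraint between \<open>i = x\<close> and \<open>j\<close>.\<close>

definition hub_nbs :: "nat \<Rightarrow> nat \<Rightarrow> nat \<times> nat \<times> nat \<Rightarrow> nat list" where
  "hub_nbs K N h =
     (if fst h = 0 then
        [lvert K N (fst (snd h)) 0, lvert K N (K + fst (snd h)) (line_len K N - 1)]
      else if fst h = 1 then
        [lvert K N (fst (snd h)) (line_len K N - 1), lvert K N (K + fst (snd h)) 0]
      else concat (map (\<lambda>x. [lvert K N (fst (snd h)) (cell K x (1 + snd (snd h))),
        lvert K N (snd (snd h)) (cell K x (1 + fst (snd h)))]) [0..<N]))"

definition csp_edges :: "nat \<Rightarrow> nat \<Rightarrow> (nat \<times> nat) list" where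
  "csp_edges K N =
     concat (map (\<lambda>a. map (\<lambda>p. (lvert K N a p, lvert K N a (p + 1))) [0..<line_len K N - 1]) [0..<2 * K]) @
     concat (map (\<lambda>h. map (\<lambda>v. (hub K N h, v)) (hub_nbs K N h)) (hubs K))"

text \<open>Constraints enter only through the choice of pairs: the case \<open>i = j\<close> of
  \<open>ok\<close> restricts the blocks that the ring of \<open>i\<close> can select, the case
  \<open>i < j\<close> the pairs offered to the hub \<open>(2, i, j)\<close>. The offsets 0 and
  \<open>K + 1\<close> are exchanged between the two lines of a ring, matching the way its hubs join
  them.\<close>

definition hub_pairs ::
    "nat \<Rightarrow> nat \<Rightarrow> (nat \<Rightarrow> nat \<Rightarrow> nat \<Rightarrow> nat \<Rightarrow> bool) \<Rightarrow> nat \<times> nat \<times> nat \<Rightarrow> (nat \<times> nat) list" where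
  "hub_pairs K N ok h =
     (if fst h = 0 then
        map (\<lambda>x. (lvert K N (fst (snd h)) (cell K x 0), lvert K N (K + fst (snd h)) (cell K x (K + 1))))
          (filter (\<lambda>x. ok (fst (snd h)) x (fst (snd h)) x) [0..<N])
      else if fst h = 1 then
        map (\<lambda>x. (lvert K N (fst (snd h)) (cell K x (K + 1)), lvert K N (K + fst (snd h)) (cell K x 0)))
          (filter (\<lambda>x. ok (fst (snd h)) x (fst (snd h)) x) [0..<N])
      else concat (map (\<lambda>x. map (\<lambda>y. (lvert K N (fst (snd h)) (cell K x (1 + snd (snd h))),
          lvert K N (snd (snd h)) (cell K y (1 + fst (snd h)))))
        (filter (\<lambda>y. ok (fst (snd h)) x (snd (snd h)) y) [0..<N])) [0..<N]))"

definition csp_pairs ::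
    "nat \<Rightarrow> nat \<Rightarrow> (nat \<Rightarrow> nat \<Rightarrow> nat \<Rightarrow> nat \<Rightarrow> bool) \<Rightarrow> (nat \<times> nat) list" where
  "csp_pairs K N ok = concat (map (hub_pairs K N ok) (hubs K))"

definition csp_ndp ::
    "nat \<Rightarrow> nat \<Rightarrow> (nat \<Rightarrow> nat \<Rightarrow> nat \<Rightarrow> nat \<Rightarrow> bool) \<Rightarrow> ndp_instance" where
  "csp_ndp K N ok =
     (hub_base K N + 3 * K * K, csp_edges K N, csp_pairs K N ok, length (hubs K))"

locale csp_graph =
  fixes K N :: nat and ok :: "nat \<Rightarrow> nat \<Rightarrow> nat \<Rightarrow> nat \<Rightarrow> bool"
  assumes K_pos: "0 < K" and N_pos: "0 < N"
begin

abbreviation P :: nat where "P \<equiv> line_len K N"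
abbreviation B :: nat where "B \<equiv> hub_base K N"
abbreviation lv :: "nat \<Rightarrow> nat \<Rightarrow> nat" where "lv \<equiv> lvert K N"
abbreviation E :: "nat set set" where "E \<equiv> edges (csp_edges K N)"
abbreviation V :: "nat set" where "V \<equiv> {..<hub_base K N + 3 * K * K}"
abbreviation hb :: "nat \<times> nat \<times> nat \<Rightarrow> nat" where "hb \<equiv> hub K N"
abbreviation H :: "(nat \<times> nat \<times> nat) set" where "H \<equiv> set (hubs K)"
abbreviation nbs :: "nat \<times> nat \<times> nat \<Rightarrow> nat list" where "nbs \<equiv> hub_nbs K N"
abbreviation HB :: "nat set" where "HB \<equiv> {hub_base K N..<hub_base K N + 3 * K * K}"
abbreviation pairs :: "(nat \<times> nat) set" where "pairs \<equiv> set (csp_pairs K N ok)"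

section \<open>Numbering of vertices, adjacency and the feedback vertex set\<close>

lemma P_pos: "0 < P"
  using N_pos by (simp add: line_len_def)

lemma cell_less: "x < N \<Longrightarrow> c < K + 2 \<Longrightarrow> cell K x c < P"
  unfolding cell_def line_len_def
  by (metis add.commute div_less_iff_less_mult div_mult_self3 div_less less_add_eq_less add_0_right
      add_gr_0 less_not_refl2 zero_less_numeral)

lemma cell_less_iff:
  assumes "c < K + 2" "c' < K + 2"
  shows "cell K x c < cell K y c' \<longleftrightarrow> x < y \<or> x = y \<and> c < c'"
proof -
  have "cell K x c < cell K y c'" if "x < y" "c < K + 2" for x y c c'
  proof -
    have "x * (K + 2) + (K + 2) \<le> y * (K + 2)"
      using mult_le_mono1[of "Suc x" y "K + 2"] that(1) by simp
    then show ?thesis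
      using that(2) unfolding cell_def by linarith
  qed
  from this[of x y c c'] this[of y x c' c] show ?thesis
    using assms by (cases x y rule: linorder_cases) (auto simp: cell_def)
qed

lemma lv_div: "p < P \<Longrightarrow> lv a p div P = a"
  using P_pos by (simp add: lvert_def)

lemma lv_inj: "p < P \<Longrightarrow> q < P \<Longrightarrow> lv a p = lv b q \<longleftrightarrow> a = b \<and> p = q"
  using lv_div by (metis add_left_cancel lvert_def)

lemma lv_less: "a < 2 * K \<Longrightarrow> p < P \<Longrightarrow> lv a p < B"
proof -
  assume "a < 2 * K" "p < P"
  then have "lv a p < Suc a * P" "Suc a * P \<le> 2 * K * P"
    using mult_le_mono1[of "Suc a" "2 * K" P] by (auto simp: lvert_def)
  then show ?thesis by (simp add: hub_base_def)
qed

lemma hubs_cases: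
  "h \<in> H \<longleftrightarrow> (\<exists>i < K. h = (0, i, 0)) \<or> (\<exists>i < K. h = (1, i, 0)) \<or>
     (\<exists>i j. i < j \<and> j < K \<and> h = (2, i, j))"
  unfolding hubs_def by auto

lemma hb_inj: "inj_on hb (H)"
proof (rule inj_onI)
  fix h h' assume h: "h \<in> H" "h' \<in> H" "hb h = hb h'"
  have lt: "fst (snd h) < K \<and> snd (snd h) < K" if "h \<in> H" for h
    using that K_pos unfolding hubs_cases by auto
  have *: "(fst h * K + fst (snd h)) * K + snd (snd h) = (fst h' * K + fst (snd h')) * K + snd (snd h')"
    using h(3) by (simp add: hub_def)
  have dm: "a = a' \<and> b = b'" if "a * K + b = a' * K + b'" "b < K" "b' < K" for a b a' b'
    using that by (metis div_mult_self3 div_less add_0_right add_left_cancel less_nat_zero_code)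
  have "fst h * K + fst (snd h) = fst h' * K + fst (snd h') \<and> snd (snd h) = snd (snd h')"
    using dm[OF *] lt h by blast
  then show "h = h'"
    using dm[of "fst h" "fst (snd h)" "fst h'" "fst (snd h')"] lt h by (simp add: prod_eq_iff)
qed

lemma hb_bounds: "h \<in> H \<Longrightarrow> B \<le> hb h \<and> hb h < B + 3 * K * K"
proof
  assume h: "h \<in> H"
  show "B \<le> hb h" by (simp add: hub_def)
  have "fst h \<le> 2" "fst (snd h) < K" "snd (snd h) < K"
    using h K_pos unfolding hubs_cases by auto
  then have "fst h * K + fst (snd h) < 3 * K"
    using mult_le_mono1[of "fst h" 2 K] by linarith
  then have "Suc (fst h * K + fst (snd h)) * K \<le> 3 * K * K"
    by (intro mult_le_mono1) simp
  then show "hb h < B + 3 * K * K"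
    using \<open>snd (snd h) < K\<close> by (simp add: hub_def)
qed

lemma distinct_hubs: "distinct (hubs K)"
proof -
  have "distinct (concat (map (\<lambda>i. map (\<lambda>j. (2 :: nat, i, j)) (filter (\<lambda>j. i < j) [0..<K])) [0..<n]))"
    for n
    by (induction n) (auto simp: distinct_map inj_on_def)
  then show ?thesis
    unfolding hubs_def by (auto simp: distinct_map inj_on_def)
qed

text \<open>The quotient by \<open>P\<close> is the index of the line. It has to agree, since the
  last vertex of one line and the first of the next have consecutive numbers without being
  adjacent.\<close>

definition line_adj :: "nat \<Rightarrow> nat \<Rightarrow> bool" where
  "line_adj u v \<longleftrightarrow> u div P = v div P \<and> (v = u + 1 \<or> u = v + 1)"

lemma hub_nbs_less: "h \<in> H \<Longrightarrow> v \<in> set (nbs h) \<Longrightarrow> v < B"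
  unfolding hubs_cases using P_pos
  by (auto simp: hub_nbs_def intro!: lv_less cell_less split: if_splits)

lemma edge_cases:
  assumes "{u, v} \<in> E"
  shows "u < B \<and> v < B \<and> line_adj u v \<or>
    (\<exists>h \<in> H. u = hb h \<and> v \<in> set (nbs h) \<or> v = hb h \<and> u \<in> set (nbs h))"
proof -
  obtain a b where ab: "(a, b) \<in> set (csp_edges K N)" "{u, v} = {a, b}"
    using assms unfolding edges_def by auto
  from ab(1) consider
    (line) c p where "c < 2 * K" "p < P - 1" "a = lv c p" "b = lv c (p + 1)"
    | (hub) h where "h \<in> H" "a = hb h" "b \<in> set (nbs h)"
    unfolding csp_edges_def by auto
  then show ?thesis
  proof cases
    case line
    have "a < B" "b < B" "a div P = c" "b div P = c" "b = a + 1"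
      using line lv_less[of c p] lv_less[of c "p + 1"] lv_div[of p c] lv_div[of "p + 1" c]
      by (auto simp: lvert_def)
    then show ?thesis
      using ab(2) by (auto simp: line_adj_def doubleton_eq_iff)
  next
    case hub
    then show ?thesis
      using ab(2) by (auto simp: doubleton_eq_iff)
  qed
qed

lemma line_edge: "a < 2 * K \<Longrightarrow> p + 1 < P \<Longrightarrow> {lv a p, lv a (p + 1)} \<in> E"
  unfolding edges_def csp_edges_def by force

lemma hub_edge: "h \<in> H \<Longrightarrow> v \<in> set (nbs h) \<Longrightarrow> {hb h, v} \<in> E"
  unfolding edges_def csp_edges_def by force

lemma simple_graph: "simple_graph V E"
  unfolding simple_graph_def
proof (intro conjI ballI)
  fix e assume e: "e \<in> E"
  then obtain u v where uv: "e = {u, v}"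
    unfolding edges_def by auto
  have "u < B + 3 * K * K \<and> v < B + 3 * K * K \<and> u \<noteq> v"
    using edge_cases[OF e[unfolded uv]]
  proof (elim disjE bexE conjE)
    fix h assume "h \<in> H" "u = hb h" "v \<in> set (nbs h)"
    then show ?thesis
      using hb_bounds[of h] hub_nbs_less[of h v] by simp
  next
    fix h assume "h \<in> H" "v = hb h" "u \<in> set (nbs h)"
    then show ?thesis
      using hb_bounds[of h] hub_nbs_less[of h u] by simp
  qed (auto simp: line_adj_def)
  then show "e \<subseteq> V" "card e = 2"
    unfolding uv by auto
qed simp

text \<open>Without hubs, adjacent vertices differ by 1. Both neighbours on a cycle of its largest
  vertex would therefore be that vertex minus 1, hence equal, which is impossible on a cycle of
  length at least 3.\<close>

lemma line_forest: "is_forest (V - HB) {e \<in> E. e \<inter> HB = {}}"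
  unfolding is_forest_def
proof
  assume "\<exists>p. is_cycle (V - HB) {e \<in> E. e \<inter> HB = {}} p"
  then obtain p where p: "length p \<ge> 3" "set p \<subseteq> V - HB" "distinct p"
    and succ: "successively (\<lambda>x y. {x, y} \<in> {e \<in> E. e \<inter> HB = {}}) p"
    and close: "{last p, hd p} \<in> {e \<in> E. e \<inter> HB = {}}"
    unfolding is_cycle_def by blast
  let ?n = "length p"
  have adj: "v = u + 1 \<or> u = v + 1" if "{u, v} \<in> {e \<in> E. e \<inter> HB = {}}" for u v
    using that edge_cases[of u v] hb_bounds unfolding line_adj_def by fastforce
  have step: "p ! (Suc i mod ?n) = p ! i + 1 \<or> p ! i = p ! (Suc i mod ?n) + 1" if "i < ?n" for i
  proof (cases "Suc i < ?n")
    case True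
    then show ?thesis
      using succ adj that by (auto simp: successively_conv_nth)
  next
    case False
    then have "Suc i = ?n" using that by simp
    moreover have "p ! i = last p" "p ! 0 = hd p"
      using \<open>Suc i = ?n\<close> p(1) last_conv_nth[of p] hd_conv_nth[of p]
      by (metis diff_Suc_1 list.size(3) nat.distinct(1))+
    ultimately show ?thesis
      using adj[OF close] by auto
  qed
  obtain i where i: "i < ?n" "p ! i = Max (set p)"
    using Max_in[of "set p"] p(1) by (metis List.finite_set in_set_conv_nth list.size(3) not_numeral_le_zero set_empty)
  define j where "j = (i + ?n - 1) mod ?n"
  have n: "0 < ?n" using p(1) by linarith
  have j: "j < ?n" "Suc j mod ?n = i" "Suc i mod ?n < ?n"
    using n i(1) by (auto simp: j_def mod_Suc_eq)
  have max: "p ! k \<le> p ! i" if "k < ?n" for k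
    unfolding i(2) using that by (intro Max_ge) auto
  have "p ! j + 1 = p ! i" "p ! (Suc i mod ?n) + 1 = p ! i"
    using step[OF i(1)] step[OF j(1)] max[OF j(1)] max[OF j(3)] unfolding j(2) by auto
  then have "j = Suc i mod ?n"
    using p(3) j by (metis add_right_imp_eq nth_eq_iff_index_eq)
  then have "i = Suc (Suc i) mod ?n"
    using j(2) by (simp add: mod_Suc_eq)
  then show False
    using p(1) i(1) by (cases "Suc (Suc i) < ?n") (auto simp: mod_if split: if_splits)
qed

lemma fvs_number_le: "fvs_number V E \<le> 3 * K * K"
proof -
  have "feedback_vertex_set V E HB"
    unfolding feedback_vertex_set_def using line_forest by auto
  then show ?thesis
    unfolding fvs_number_def by (intro Least_le exI[of _ "HB"]) auto
qed

lemma csp_pairs_cases: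
  assumes "m \<in> pairs"
  obtains
    (V1) i x where "i < K" "x < N" "ok i x i x" "m = (lv i (cell K x 0), lv (K + i) (cell K x (K + 1)))"
  | (V2) i x where "i < K" "x < N" "ok i x i x" "m = (lv i (cell K x (K + 1)), lv (K + i) (cell K x 0))"
  | (E) i j x y where "i < j" "j < K" "x < N" "y < N" "ok i x j y"
      "m = (lv i (cell K x (1 + j)), lv j (cell K y (1 + i)))"
proof -
  obtain h where "h \<in> H" "m \<in> set (hub_pairs K N ok h)"
    using assms unfolding csp_pairs_def by auto
  then show ?thesis
    unfolding hubs_cases using V1 V2 E by (auto simp: hub_pairs_def)
qed

lemma pair_less:
  assumes "m \<in> pairs"
  shows "fst m < B" "snd m < B" "fst m div P \<noteq> snd m div P"
  using assms by (cases rule: csp_pairs_cases; auto intro!: lv_less cell_less simp: lv_div cell_less)+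

lemma csp_ndp_instance: "csp_ndp K N ok \<in> ndp_instances"
  unfolding ndp_instances_def csp_ndp_def using simple_graph pair_less by (fastforce simp: trans_less_add1)


section \<open>From disjoint paths to a solution\<close>

lemma path_vertex:
  assumes "successively (\<lambda>x y. {x, y} \<in> E) p" "hd p < B" "v \<in> set p"
  shows "v < B \<or> v \<in> hb ` H"
proof -
  obtain n where n: "n < length p" "v = p ! n"
    using assms(3) by (auto simp: in_set_conv_nth)
  show ?thesis
  proof (cases n)
    case 0
    then show ?thesis using assms(2,3) n by (metis hd_conv_nth length_greater_0_conv)
  next
    case (Suc k)
    then have "{p ! k, v} \<in> E"
      using assms(1) n by (simp add: successively_conv_nth)
    from edge_cases[OF this] show ?thesis
      using hub_nbs_less by auto
  qed
qed

text \<open>Hubs are the only way to change lines, so a walk below \<open>B\<close> stays on its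
  line and moves there by unit steps.\<close>

lemma line_walk:
  assumes "successively (\<lambda>x y. {x, y} \<in> E) p" "\<And>v. v \<in> set p \<Longrightarrow> v < B" "p \<noteq> []"
  shows "hd p div P = last p div P"
    and "hd p \<le> w \<and> w \<le> last p \<or> last p \<le> w \<and> w \<le> hd p \<Longrightarrow> w \<in> set p"
proof -
  have adj: "successively line_adj p"
  proof (rule successively_mono[OF assms(1)])
    fix u v assume uv: "u \<in> set p" "v \<in> set p" "{u, v} \<in> E"
    then have "u < B" "v < B"
      using assms(2) by auto
    then show "line_adj u v"
      using edge_cases[OF uv(3)] hb_bounds by (metis leD)
  qed
  show "hd p div P = last p div P"
    using successively_const[of "\<lambda>v. v div P" p "last p"] successively_mono[OF adj] assms(3)
    by (simp add: line_adj_def)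
  show "w \<in> set p" if "hd p \<le> w \<and> w \<le> last p \<or> last p \<le> w \<and> w \<le> hd p"
    by (rule walk_covers[OF successively_mono[OF adj] assms(3) that]) (simp add: line_adj_def)
qed

lemma path_uses_hub:
  assumes "is_path V E s p t" "s < B" "t < B" "s div P \<noteq> t div P"
  shows "set p \<inter> hb ` H \<noteq> {}"
proof
  assume *: "set p \<inter> hb ` H = {}"
  have p: "p \<noteq> []" "hd p = s" "last p = t" "successively (\<lambda>x y. {x, y} \<in> E) p"
    using assms(1) by (auto simp: is_path_def)
  have "v < B" if "v \<in> set p" for v
    using path_vertex[OF p(4) _ that] assms(2) p(2) that * by auto
  from line_walk(1)[OF p(4) this p(1)] show False
    using p assms(4) by simp
qed

text \<open>A path visits its only hub once; removing the hub leaves two walks, each confined to one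
  line and therefore covering everything between a terminal and a neighbour of the hub.\<close>

lemma path_through_hub:
  assumes path: "is_path V E s p t" and "s < B" "t < B" and h: "h \<in> H"
    and only: "set p \<inter> hb ` H = {hb h}"
  obtains a b where "a \<in> set (nbs h)" "b \<in> set (nbs h)"
    "s div P = a div P" "t div P = b div P"
    "\<And>w. s \<le> w \<and> w \<le> a \<or> a \<le> w \<and> w \<le> s \<Longrightarrow> w \<in> set p"
    "\<And>w. t \<le> w \<and> w \<le> b \<or> b \<le> w \<and> w \<le> t \<Longrightarrow> w \<in> set p"
proof -
  have p: "hd p = s" "last p = t" "successively (\<lambda>x y. {x, y} \<in> E) p" "distinct p"
    using path by (auto simp: is_path_def)
  obtain p1 p2 where split: "p = p1 @ hb h # p2"
    using only split_list[of "hb h" p] by auto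
  have hB: "B \<le> hb h"
    using hb_bounds[OF h] by simp
  have ne: "p1 \<noteq> []" "p2 \<noteq> []"
    using p(1,2) split assms(2,3) hB by auto
  have less: "v < B" if "v \<in> set p1 \<union> set p2" for v
  proof -
    have "v \<in> set p" "v \<noteq> hb h"
      using that p(4) split by auto
    then show ?thesis
      using path_vertex[OF p(3)] p(1) assms(2) only by auto
  qed
  have succ: "successively (\<lambda>x y. {x, y} \<in> E) p1" "successively (\<lambda>x y. {x, y} \<in> E) p2"
    "{last p1, hb h} \<in> E" "{hb h, hd p2} \<in> E"
    using p(3) ne unfolding split by (auto simp: successively_append_iff successively_Cons)
  have nbs: "a \<in> set (nbs h)" if "{a, hb h} \<in> E" "a < B" for a
    using edge_cases[OF that(1)]
  proof (elim disjE bexE conjE)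
    fix h' assume "h' \<in> H" "hb h = hb h'" "a \<in> set (nbs h')"
    then show ?thesis
      using inj_onD[OF hb_inj _ h, of h'] by simp
  next
    fix h' assume "h' \<in> H" "a = hb h'"
    then show ?thesis
      using hb_bounds[of h'] that(2) by simp
  qed (use hB in simp)
  have less1: "v < B" if "v \<in> set p1" for v using less that by blast
  have less2: "v < B" if "v \<in> set p2" for v using less that by blast
  have ends: "hd p1 = s" "last p2 = t"
    using p(1,2) ne split by auto
  show ?thesis
  proof (rule that[of "last p1" "hd p2"])
    show "last p1 \<in> set (nbs h)" "hd p2 \<in> set (nbs h)"
      using nbs succ(3,4) less1[of "last p1"] less2[of "hd p2"] ne by (auto simp: insert_commute)
    show "s div P = last p1 div P" "t div P = hd p2 div P"
      using line_walk(1)[OF succ(1) less1 ne(1)] line_walk(1)[OF succ(2) less2 ne(2)] ends by auto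
    show "w \<in> set p" if "s \<le> w \<and> w \<le> last p1 \<or> last p1 \<le> w \<and> w \<le> s" for w
      using line_walk(2)[OF succ(1) less1 ne(1), of w] ends that split by auto
    show "w \<in> set p" if "t \<le> w \<and> w \<le> hd p2 \<or> hd p2 \<le> w \<and> w \<le> t" for w
      using line_walk(2)[OF succ(2) less2 ne(2), of w] ends that split by auto
  qed
qed

text \<open>The lines of the hub's neighbours force the pair to be a ring pair of \<open>i\<close>.
  It need not be a pair listed for this hub: a pair meant for one ring hub may be routed through the
  other. Both orders of \<open>c\<close> and \<open>c'\<close> are therefore left open here and
  settled when the two ring paths are compared.\<close>

lemma hub01_path:
  assumes m: "m \<in> pairs" and path: "is_path V E (fst m) p (snd m)"
    and i: "i < K" and t: "t < 2" and only: "set p \<inter> hb ` H = {hb (t, i, 0)}"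
  obtains x c c' where "x < N" "ok i x i x" "c = 0 \<and> c' = K + 1 \<or> c = K + 1 \<and> c' = 0"
    "\<And>q. q < P \<Longrightarrow> (if t = 0 then q \<le> cell K x c else cell K x c \<le> q) \<Longrightarrow> lv i q \<in> set p"
    "\<And>q. q < P \<Longrightarrow> (if t = 0 then cell K x c' \<le> q else q \<le> cell K x c') \<Longrightarrow> lv (K + i) q \<in> set p"
proof -
  note * = that
  have h: "(t, i, 0) \<in> H"
    using i t unfolding hubs_cases by (auto simp: less_2_cases_iff)
  obtain a b where ab: "a \<in> set (nbs (t, i, 0))" "b \<in> set (nbs (t, i, 0))"
    and line: "fst m div P = a div P" "snd m div P = b div P"
    and cover: "\<And>w. fst m \<le> w \<and> w \<le> a \<or> a \<le> w \<and> w \<le> fst m \<Longrightarrow> w \<in> set p"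
      "\<And>w. snd m \<le> w \<and> w \<le> b \<or> b \<le> w \<and> w \<le> snd m \<Longrightarrow> w \<in> set p"
    using path_through_hub[OF path pair_less(1,2)[OF m] h only] by blast
  have nbs: "a = lv i 0 \<or> a = lv i (P - 1) \<or> a = lv (K + i) 0 \<or> a = lv (K + i) (P - 1)"
    if "a \<in> set (nbs (t, i, 0))" for a
    using that t by (auto simp: hub_nbs_def less_2_cases_iff split: if_splits)
  have div: "a div P = i \<or> a div P = K + i" if "a \<in> set (nbs (t, i, 0))" for a
    using nbs[OF that] P_pos by (auto simp: lv_div)
  have aL: "a = (if t = 0 then lv i 0 else lv i (P - 1))" if "a div P < K"
    using ab(1) that t P_pos by (auto simp: hub_nbs_def less_2_cases_iff lv_div split: if_splits)
  have bM: "b = (if t = 0 then lv (K + i) (P - 1) else lv (K + i) 0)" if "b div P \<ge> K"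
    using ab(2) that t i P_pos by (auto simp: hub_nbs_def less_2_cases_iff lv_div split: if_splits)
  have V: thesis if "i' < K" "x < N" "ok i' x i' x" "c = 0 \<and> c' = K + 1 \<or> c = K + 1 \<and> c' = 0"
    "m = (lv i' (cell K x c), lv (K + i') (cell K x c'))" for i' x c c'
  proof -
    have less: "cell K x c < P" "cell K x c' < P"
      using that(2,4) by (auto intro!: cell_less)
    have "a div P = i'" "b div P = K + i'"
      using line that(5) less by (auto simp: lv_div)
    then have i': "i' = i" and a: "a = (if t = 0 then lv i 0 else lv i (P - 1))"
      and b: "b = (if t = 0 then lv (K + i) (P - 1) else lv (K + i) 0)"
      using div[OF ab(1)] aL bM that(1) by auto
    show thesis
    proof (rule *[OF that(2) that(3)[unfolded i'] that(4)])
      fix q assume q: "q < P" "if t = 0 then q \<le> cell K x c else cell K x c \<le> q"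
      show "lv i q \<in> set p"
        by (rule cover(1)) (use q in \<open>auto simp: that(5) i' a lvert_def split: if_splits\<close>)
    next
      fix q assume q: "q < P" "if t = 0 then cell K x c' \<le> q else q \<le> cell K x c'"
      show "lv (K + i) q \<in> set p"
        by (rule cover(2)) (use q in \<open>auto simp: that(5) i' b lvert_def split: if_splits\<close>)
    qed
  qed
  show thesis
    using m
  proof (cases rule: csp_pairs_cases)
    case (V1 i' x)
    then show ?thesis using V[of i' x 0 "K + 1"] by blast
  next
    case (V2 i' x)
    then show ?thesis using V[of i' x "K + 1" 0] by blast
  next
    \<comment> \<open>Both terminals lie on lines below \<open>K\<close>, on two different ones,
      whereas the hub offers only one such line, that of index \<open>i\<close>.\<close>
    case (E i' j' x y)
    have "cell K x (1 + j') < P" "cell K y (1 + i') < P"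
      using E by (auto intro!: cell_less)
    then have "a div P = i'" "b div P = j'"
      using line E(6) by (auto simp: lv_div)
    then show ?thesis
      using div[OF ab(1)] div[OF ab(2)] E i by auto
  qed
qed

text \<open>The hub reaches only the lines \<open>i\<close> and \<open>j\<close>, both below
  \<open>K\<close>, so ring pairs and constraint pairs of other indices cannot use it. The hub may
  be entered from another block than that of the terminal, but the terminals themselves are on the
  path, and they encode an allowed pair of values.\<close>

lemma hub2_path:
  assumes m: "m \<in> pairs" and path: "is_path V E (fst m) p (snd m)"
    and ij: "i < j" "j < K" and only: "set p \<inter> hb ` H = {hb (2, i, j)}"
  obtains x y where "x < N" "y < N" "ok i x j y"
    "lv i (cell K x (1 + j)) \<in> set p" "lv j (cell K y (1 + i)) \<in> set p"
proof -
  have h: "(2, i, j) \<in> H"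
    using ij unfolding hubs_cases by auto
  obtain a b where ab: "a \<in> set (nbs (2, i, j))" "b \<in> set (nbs (2, i, j))"
    and line: "fst m div P = a div P" "snd m div P = b div P"
    and cover: "\<And>w. fst m \<le> w \<and> w \<le> a \<or> a \<le> w \<and> w \<le> fst m \<Longrightarrow> w \<in> set p"
      "\<And>w. snd m \<le> w \<and> w \<le> b \<or> b \<le> w \<and> w \<le> snd m \<Longrightarrow> w \<in> set p"
    using path_through_hub[OF path pair_less(1,2)[OF m] h only] by blast
  have div: "a div P = i \<or> a div P = j" if "a \<in> set (nbs (2, i, j))" for a
    using that ij by (auto simp: hub_nbs_def lv_div cell_less)
  have ends: "fst m \<in> set p" "snd m \<in> set p"
    using path unfolding is_path_def by (metis hd_in_set, metis last_in_set)
  show thesis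
    using m
  proof (cases rule: csp_pairs_cases)
    case (V1 i' x)
    then show ?thesis
      using line div[OF ab(2)] ij by (auto simp: lv_div cell_less)
  next
    case (V2 i' x)
    then show ?thesis
      using line div[OF ab(2)] ij by (auto simp: lv_div cell_less)
  next
    case (E i' j' x y)
    have "i' = i \<or> i' = j" "j' = i \<or> j' = j"
      using line div[OF ab(1)] div[OF ab(2)] E by (auto simp: lv_div cell_less)
    then have "i' = i" "j' = j"
      using E(1) ij by auto
    then show ?thesis
      using that[of x y] E ends by simp
  qed
qed

text \<open>By counting, every hub has a path of which it is the only hub. The two ring paths of
  \<open>i\<close> select a value \<open>f i\<close>; the path of the hub \<open>(2, i, j)\<close>
  is disjoint from them, so its terminals must lie in the selected blocks of \<open>i\<close> and
  \<open>j\<close>.\<close>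

lemma routable_imp_csp_solvable:
  assumes M': "M' \<subseteq> pairs" and "routable V E (\<lambda>_. 1) M'"
    and card: "length (hubs K) \<le> card M'"
  shows "csp_solvable K N ok"
proof -
  obtain Q where Q: "\<And>m. m \<in> M' \<Longrightarrow> is_path V E (fst m) (Q m) (snd m)"
    "\<And>v. v \<in> V \<Longrightarrow> card {m \<in> M'. v \<in> set (Q m)} \<le> 1"
    using assms(2) unfolding routable_def by (auto simp: case_prod_unfold)
  have fin: "finite M'"
    using M' finite_subset by blast
  have unique: "m = m'" if "m \<in> M'" "m' \<in> M'" "v \<in> set (Q m)" "v \<in> set (Q m')" for m m' v
  proof -
    have "v \<in> V"
      using Q(1)[OF that(1)] that(3) by (auto simp: is_path_def)
    then show ?thesis
      using Q(2)[of v] that fin by (simp add: card_le_Suc0_iff_eq del: split_paired_All)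
  qed
  define S where "S m = set (Q m) \<inter> hb ` H" for m
  have "card (hb ` H) = length (hubs K)"
    by (simp add: card_image[OF hb_inj] distinct_card[OF distinct_hubs])
  then have ex: "\<exists>m \<in> M'. S m = {hb h}" if "h \<in> H" for h
  proof (intro card_disjoint_nonempty[OF fin _, where H = "hb ` H"])
    show "S m \<noteq> {} \<and> S m \<subseteq> hb ` H" if "m \<in> M'" for m
      using path_uses_hub[OF Q(1)[OF that]] pair_less M' that unfolding S_def by blast
    show "S m \<inter> S m' = {}" if "m \<in> M'" "m' \<in> M'" "m \<noteq> m'" for m m'
      using unique that unfolding S_def by blast
  qed (use card that in auto)
  have "\<exists>x < N. ok i x i x \<and> (\<forall>m \<in> M'. \<forall>h \<in> H. fst h = 2 \<longrightarrow> S m = {hb h} \<longrightarrow>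
      (\<forall>y < N. \<forall>c < K + 2. lv i (cell K y c) \<in> set (Q m) \<longrightarrow> y = x))" if i: "i < K" for i
  proof -
    have hubs: "(0, i, 0) \<in> H" "(1, i, 0) \<in> H"
      using i unfolding hubs_cases by auto
    obtain m1 m2 where m1: "m1 \<in> M'" "S m1 = {hb (0, i, 0)}" and m2: "m2 \<in> M'" "S m2 = {hb (1, i, 0)}"
      using ex[OF hubs(1)] ex[OF hubs(2)] by blast
    have neq: "hb h \<noteq> hb h'" if "h \<in> H" "h' \<in> H" "h \<noteq> h'" for h h'
      using hb_inj that by (auto dest: inj_onD)
    have m12: "m1 \<noteq> m2"
      using m1 m2 neq[OF hubs] by auto
    obtain x c c' where x: "x < N" "ok i x i x" "c = 0 \<and> c' = K + 1 \<or> c = K + 1 \<and> c' = 0"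
      "\<And>q. q < P \<Longrightarrow> q \<le> cell K x c \<Longrightarrow> lv i q \<in> set (Q m1)"
      "\<And>q. q < P \<Longrightarrow> cell K x c' \<le> q \<Longrightarrow> lv (K + i) q \<in> set (Q m1)"
      using hub01_path[OF subsetD[OF M' m1(1)] Q(1)[OF m1(1)] i _ m1(2)[unfolded S_def]] by auto
    obtain y d d' where y: "y < N" "ok i y i y" "d = 0 \<and> d' = K + 1 \<or> d = K + 1 \<and> d' = 0"
      "\<And>q. q < P \<Longrightarrow> cell K y d \<le> q \<Longrightarrow> lv i q \<in> set (Q m2)"
      "\<And>q. q < P \<Longrightarrow> q \<le> cell K y d' \<Longrightarrow> lv (K + i) q \<in> set (Q m2)"
      using hub01_path[OF subsetD[OF M' m2(1)] Q(1)[OF m2(1)] i _ m2(2)[unfolded S_def]] by auto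
    have cd: "c < K + 2" "c' < K + 2" "d < K + 2" "d' < K + 2"
      using x(3) y(3) by auto
    \<comment> \<open>Disjointness on the line \<open>i\<close> gives \<open>x \<le> y\<close>, and
      on the line \<open>K + i\<close>, where the roles of the ends are exchanged,
      \<open>y \<le> x\<close>. Once the blocks coincide, the strict inequalities of the offsets
      exclude the exchanged routing.\<close>
    have "cell K x c < cell K y d"
      using x(4)[of "cell K x c"] y(4)[of "cell K x c"] unique[OF m1(1) m2(1)] m12
        cell_less[OF x(1) cd(1)] by (meson le_refl not_le)
    moreover have "cell K y d' < cell K x c'"
      using x(5)[of "cell K x c'"] y(5)[of "cell K x c'"] unique[OF m1(1) m2(1)] m12
        cell_less[OF x(1) cd(2)] by (meson le_refl not_le)
    ultimately have xy: "x = y" "c = 0" "d = K + 1"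
      using x(3) y(3) cd by (auto simp: cell_less_iff)
    have "z = x" if "m \<in> M'" "h \<in> H" "fst h = 2" "S m = {hb h}" "z < N" "e < K + 2"
      "lv i (cell K z e) \<in> set (Q m)" for m h z e
    proof -
      have "h \<noteq> (0, i, 0)" "h \<noteq> (1, i, 0)"
        using that(3) by auto
      then have "m \<noteq> m1" "m \<noteq> m2"
        using that(4) m1(2) m2(2) neq[OF that(2) hubs(1)] neq[OF that(2) hubs(2)] by auto
      then have "lv i (cell K z e) \<notin> set (Q m1)" "lv i (cell K z e) \<notin> set (Q m2)"
        using unique[OF that(1) m1(1) that(7)] unique[OF that(1) m2(1) that(7)] by auto
      \<comment> \<open>The ring paths cover the line \<open>i\<close> up to offset 0 and from
        offset \<open>K + 1\<close> of the block \<open>x\<close>; only the interior of this block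
        is left.\<close>
      then have "cell K x 0 < cell K z e" "cell K z e < cell K x (K + 1)"
        using x(4)[of "cell K z e"] y(4)[of "cell K z e"] cell_less[OF that(5,6)] xy by (meson not_le)+
      then show "z = x"
        using that(6) by (auto simp: cell_less_iff)
    qed
    then show ?thesis
      using x(1,2) by blast
  qed
  then obtain f where f: "\<And>i. i < K \<Longrightarrow> f i < N \<and> ok i (f i) i (f i) \<and>
      (\<forall>m \<in> M'. \<forall>h \<in> H. fst h = 2 \<longrightarrow> S m = {hb h} \<longrightarrow>
      (\<forall>y < N. \<forall>c < K + 2. lv i (cell K y c) \<in> set (Q m) \<longrightarrow> y = f i))"
    by metis
  have "ok i (f i) j (f j)" if ij: "i < j" "j < K" for i j
  proof -
    have h: "(2, i, j) \<in> H"
      using ij unfolding hubs_cases by auto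
    obtain m where m: "m \<in> M'" "S m = {hb (2, i, j)}"
      using ex[OF h] by blast
    obtain x y where xy: "x < N" "y < N" "ok i x j y"
      "lv i (cell K x (1 + j)) \<in> set (Q m)" "lv j (cell K y (1 + i)) \<in> set (Q m)"
      using hub2_path[OF subsetD[OF M' m(1)] Q(1)[OF m(1)] ij m(2)[unfolded S_def]] by blast
    have "fst (2 :: nat, i, j) = 2" "1 + j < K + 2" "1 + i < K + 2" "i < K"
      using ij by auto
    then have "x = f i" "y = f j"
      using f[of i] f[of j] m h xy ij(2) by blast+
    then show ?thesis
      using xy(3) by simp
  qed
  then show ?thesis
    unfolding csp_solvable_def using f by (metis le_neq_implies_less)
qed

section \<open>From a solution to disjoint paths\<close>

lemma successively_line:
  assumes "a < 2 * K" "n \<le> P"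
  shows "successively (\<lambda>x y. {x, y} \<in> E) (map (lv a) [m..<n])"
    and "successively (\<lambda>x y. {x, y} \<in> E) (rev (map (lv a) [m..<n]))"
proof -
  show *: "successively (\<lambda>x y. {x, y} \<in> E) (map (lv a) [m..<n])"
    using line_edge[OF assms(1)] assms(2) by (auto simp: successively_conv_nth)
  show "successively (\<lambda>x y. {x, y} \<in> E) (rev (map (lv a) [m..<n]))"
    using * unfolding successively_rev by (simp add: insert_commute)
qed

lemma csp_solvable_imp_routable:
  assumes "csp_solvable K N ok"
  shows "\<exists>M' \<subseteq> pairs. routable V E (\<lambda>_. 1) M' \<and> length (hubs K) \<le> card M'"
proof -
  obtain f where f: "\<And>i. i < K \<Longrightarrow> f i < N" "\<And>i j. i < K \<Longrightarrow> j < K \<Longrightarrow> i \<le> j \<Longrightarrow> ok i (f i) j (f j)"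
    using assms unfolding csp_solvable_def by blast
  define l r where "l i = cell K (f i) 0" and "r i = cell K (f i) (K + 1)" for i
  have lr: "l i < P" "r i < P" "l i < r i" if "i < K" for i
    using f(1)[OF that] by (auto simp: l_def r_def cell_less cell_less_iff)
  define w where "w i j = cell K (f i) (1 + j)" for i j
  have w: "w i j < P" "l i < w i j" "w i j < r i" "w i j - l i - 1 = j" if "i < K" "j < K" for i j
    using f(1)[OF that(1)] that by (auto simp: w_def l_def r_def cell_less cell_less_iff)
      (simp add: cell_def)
  define pr where "pr h = (case h of (t, i, j) \<Rightarrow>
    if t = 0 then (lv i (l i), lv (K + i) (r i)) else if t = 1 then (lv i (r i), lv (K + i) (l i))
    else (lv i (w i j), lv j (w j i)))" for h :: "nat \<times> nat \<times> nat"
  \<comment> \<open>A ring path runs outwards from the selected block to an end of the line, through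
    the hub, and inwards on the other line up to the selected block there; it avoids the interiors
    of both blocks.\<close>
  define ph where "ph h = (case h of (t, i, j) \<Rightarrow>
    if t = 0 then rev (map (lv i) [0..<Suc (l i)]) @ hb h # rev (map (lv (K + i)) [r i..<P])
    else if t = 1 then map (lv i) [r i..<P] @ hb h # map (lv (K + i)) [0..<Suc (l i)]
    else [lv i (w i j), hb h, lv j (w j i)])" for h
  \<comment> \<open>The owner of a vertex is the only hub whose path may contain it, so disjointness
    needs one check per path instead of one per pair of paths. Inside the selected block, the offset
    minus 1 is the other index of the constraint.\<close>
  define own where "own v = (if B \<le> v then inv_into (H) hb v else
    let a = v div P; p = v mod P in
    if a < K then
      (if p \<le> l a then (0, a, 0) else if r a \<le> p then (1, a, 0)
       else let j = p - l a - 1 in if a < j then (2, a, j) else (2, j, a))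
    else (if r (a - K) \<le> p then (0, a - K, 0) else (1, a - K, 0)))" for v
  have own_hub: "own (hb h) = h" if "h \<in> H" for h
    using hb_bounds[OF that] inv_into_f_f[OF hb_inj that] by (simp add: own_def)
  have lv_mod: "lv a p mod P = p" if "p < P" for a p
    using that by (simp add: lvert_def)
  have own_L: "own (lv i p) = (if p \<le> l i then (0, i, 0) else if r i \<le> p then (1, i, 0)
      else let j = p - l i - 1 in if i < j then (2, i, j) else (2, j, i))" if "i < K" "p < P" for i p
    using lv_less[of i p] that by (simp add: own_def lv_div lv_mod)
  have own_M: "own (lv (K + i) p) = (if r i \<le> p then (0, i, 0) else (1, i, 0))" if "i < K" "p < P" for i p
    using lv_less[of "K + i" p] that by (simp add: own_def lv_div lv_mod)
  have own: "own v = h" if h: "h \<in> H" and "v \<in> set (ph h)" for h v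
    using h[unfolded hubs_cases]
  proof (elim disjE exE conjE)
    fix i assume i: "i < K" "h = (0, i, 0)"
    then show ?thesis
      using that(2) own_hub[OF h] lr[OF i(1)] by (auto simp: ph_def own_L own_M)
  next
    fix i assume i: "i < K" "h = (1, i, 0)"
    then show ?thesis
      using that(2) own_hub[OF h] lr[OF i(1)] by (auto simp: ph_def own_L own_M)
  next
    fix i j assume ij: "i < j" "j < K" "h = (2, i, j)"
    then show ?thesis
      using that(2) own_hub[OF h] w[of i j] w[of j i] by (auto simp: ph_def own_L Let_def)
  qed
  have in_V: "lv a p \<in> V" if "a < 2 * K" "p < P" for a p
    using lv_less[OF that] by simp
  have "\<exists>M' \<subseteq> pairs. routable V E (\<lambda>_. 1) M' \<and> card (H) \<le> card M'"
  proof (rule routable_disjoint_paths[where pr = pr and ph = ph])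
    show "finite (H)" by simp
    show "h = h'" if "h \<in> H" "h' \<in> H" "v \<in> set (ph h)" "v \<in> set (ph h')" for h h' v
      using own that by metis
    fix h assume h: "h \<in> H"
    have "pr h \<in> set (hub_pairs K N ok h)"
      using h f unfolding hubs_cases
      by (auto simp: pr_def hub_pairs_def l_def r_def w_def intro!: image_eqI bexI)
    then show "pr h \<in> pairs"
      using h unfolding csp_pairs_def by auto
    have hV: "hb h \<in> V" "B \<le> hb h"
      using hb_bounds[OF h] by auto
    have hE: "{hb h, v} \<in> E" "{v, hb h} \<in> E" if "v \<in> set (nbs h)" for v
      using hub_edge[OF h that] by (auto simp: insert_commute)
    have neq: "lv a p \<noteq> hb h" "hb h \<noteq> lv a p" if "a < 2 * K" "p < P" for a p
      using lv_less[OF that] hV by simp_all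
    have inj: "inj_on (lv a) {..<P}" for a
      by (auto simp: inj_on_def lv_inj)
    show "is_path V E (fst (pr h)) (ph h) (snd (pr h))"
      using h[unfolded hubs_cases]
    proof (elim disjE exE conjE)
      fix i assume i: "i < K" "h = (0, i, 0)"
      have nb: "lv i 0 \<in> set (nbs h)" "lv (K + i) (P - 1) \<in> set (nbs h)"
        by (auto simp: i hub_nbs_def)
      have ph: "ph h = rev (map (lv i) [0..<Suc (l i)]) @ hb h # rev (map (lv (K + i)) [r i..<P])"
        and pr: "pr h = (lv i (l i), lv (K + i) (r i))"
        by (auto simp: ph_def pr_def i)
      have "distinct (ph h)"
        using lr[OF i(1)] i(1)
        by (auto simp: ph distinct_map lv_inj neq intro!: inj_on_subset[OF inj])
      moreover have "successively (\<lambda>x y. {x, y} \<in> E) (ph h)"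
        using successively_line(2)[of i "Suc (l i)" 0] successively_line(2)[of "K + i" P "r i"]
          lr[OF i(1)] i(1) hE[OF nb(1)] hE[OF nb(2)]
        unfolding ph by (simp add: successively_append_iff successively_Cons last_rev hd_rev
            last_map upt_conv_Cons[of 0] del: upt_Suc)
      moreover have "set (ph h) \<subseteq> V"
        using lr[OF i(1)] i(1) hV(1) in_V by (auto simp: ph)
      ultimately show ?thesis
        using lr[OF i(1)] unfolding is_path_def ph pr by (simp add: upt_conv_Cons[of "r i" P])
    next
      fix i assume i: "i < K" "h = (1, i, 0)"
      have nb: "lv i (P - 1) \<in> set (nbs h)" "lv (K + i) 0 \<in> set (nbs h)"
        by (auto simp: i hub_nbs_def)
      have ph: "ph h = map (lv i) [r i..<P] @ hb h # map (lv (K + i)) [0..<Suc (l i)]"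
        and pr: "pr h = (lv i (r i), lv (K + i) (l i))"
        by (auto simp: ph_def pr_def i)
      have "distinct (ph h)"
        using lr[OF i(1)] i(1)
        by (auto simp: ph distinct_map lv_inj neq intro!: inj_on_subset[OF inj])
      moreover have "successively (\<lambda>x y. {x, y} \<in> E) (ph h)"
        using successively_line(1)[of "K + i" "Suc (l i)" 0] successively_line(1)[of i P "r i"]
          lr[OF i(1)] i(1) hE[OF nb(1)] hE[OF nb(2)]
        unfolding ph by (simp add: successively_append_iff successively_Cons last_map
            upt_conv_Cons[of 0] del: upt_Suc)
      moreover have "set (ph h) \<subseteq> V"
        using lr[OF i(1)] i(1) hV(1) in_V by (auto simp: ph)
      ultimately show ?thesis
        using lr[OF i(1)] unfolding is_path_def ph pr by (simp add: upt_conv_Cons[of "r i" P])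
    next
      fix i j assume ij: "i < j" "j < K" "h = (2, i, j)"
      have nb: "lv i (w i j) \<in> set (nbs h)" "lv j (w j i) \<in> set (nbs h)"
        using f(1)[of i] f(1)[of j] ij by (auto simp: hub_nbs_def w_def)
      show ?thesis
        using ij hE[OF nb(1)] hE[OF nb(2)] w[of i j] w[of j i] neq[of i "w i j"] neq[of j "w j i"] hV(1)
          in_V[of i "w i j"] in_V[of j "w j i"]
        by (auto simp: is_path_def ph_def pr_def lv_inj)
    qed
  qed
  then show ?thesis
    by (simp add: distinct_card[OF distinct_hubs])
qed

lemma csp_ndp_yes:
  "length (hubs K) \<le> max_ndp V E (\<lambda>_. 1) (pairs) \<longleftrightarrow> csp_solvable K N ok"
  using routable_imp_csp_solvable csp_solvable_imp_routable by (subst max_ndp_ge_iff) auto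

end


section \<open>From weighted satisfiability to binary constraint satisfaction\<close>

type_synonym cnf = "(nat \<times> bool) list list"

definition sat_cnf :: "(nat \<Rightarrow> bool) \<Rightarrow> cnf \<Rightarrow> bool" where
  "sat_cnf v A \<longleftrightarrow> (\<forall>C \<in> set A. \<exists>l \<in> set C. v (fst l) = snd l)"

definition weighted_sat :: "nat \<Rightarrow> nat \<Rightarrow> cnf list \<Rightarrow> bool" where
  "weighted_sat n k As \<longleftrightarrow>
     (\<exists>bs. length bs = n \<and> count_list bs True = k \<and> (\<exists>A \<in> set As. sat_cnf ((!) bs) A))"

text \<open>The true inputs \<open>t\<^sub>1 < \<dots> < t\<^sub>k\<close>, shifted by 1 and completed by \<open>t\<^sub>0 = 0\<close> and \<open>t\<^sub>k\<^sub>+\<^sub>1 = n + 1\<close>,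
  cut \<open>{1, \<dots>, n}\<close> into the gaps \<open>{t\<^sub>j <.. t\<^sub>j\<^sub>+\<^sub>1}\<close>. The gap that contains an input determines its value,
  so a falsified clause is witnessed by at most as many gaps as it has literals.\<close>

definition falsified :: "nat \<times> bool \<Rightarrow> nat \<times> nat \<Rightarrow> bool" where
  "falsified l g \<longleftrightarrow> fst g < fst l + 1 \<and> fst l + 1 \<le> snd g \<and> \<not> (fst l + 1 = snd g) = snd l"

definition slots :: "nat \<Rightarrow> nat \<Rightarrow> nat list list" where
  "slots a k = List.n_lists a [0..<k + 1]"

definition gap_pairs :: "nat \<Rightarrow> (nat \<times> nat) list" where
  "gap_pairs n = concat (map (\<lambda>l. map (\<lambda>r. (l, r)) [0..<n + 2]) [0..<n + 2])"

definition slot_vals :: "nat \<Rightarrow> nat \<Rightarrow> nat \<Rightarrow> (nat \<times> (nat \<times> nat) list) list" where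
  "slot_vals a n m =
     concat (map (\<lambda>\<alpha>. map (\<lambda>gs. (\<alpha>, gs)) (List.n_lists a (gap_pairs n))) [0..<m])"

text \<open>The unary constraint. It anchors the first and the last gap at the two ends, and tests
  whole clauses, which is possible because the tuple brings together as many gaps as a clause has
  literals.\<close>

definition slot_valid :: "nat \<Rightarrow> nat \<Rightarrow> nat \<Rightarrow> cnf list \<Rightarrow> nat list \<Rightarrow> nat \<times> (nat \<times> nat) list \<Rightarrow> bool" where
  "slot_valid a n k As J v \<longleftrightarrow>
     (\<forall>p < a. (nth_default 0 J p = 0 \<longrightarrow> fst (nth_default (0, 0) (snd v) p) = 0) \<and>
        (nth_default 0 J p = k \<longrightarrow> snd (nth_default (0, 0) (snd v) p) = n + 1) \<and>
        fst (nth_default (0, 0) (snd v) p) < snd (nth_default (0, 0) (snd v) p)) \<and>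
     (\<forall>C \<in> set (nth_default [] As (fst v)). \<exists>l \<in> set C. \<forall>g \<in> set (snd v). \<not> falsified l g)"

text \<open>The binary constraint that glues local guesses: gaps with equal indices are equal, and
  gaps with consecutive indices share their boundary.\<close>

definition slots_agree ::
    "nat \<Rightarrow> nat list \<Rightarrow> (nat \<times> nat) list \<Rightarrow> nat list \<Rightarrow> (nat \<times> nat) list \<Rightarrow> bool" where
  "slots_agree a J gs J' gs' \<longleftrightarrow> (\<forall>p < a. \<forall>q < a.
     (nth_default 0 J p = nth_default 0 J' q \<longrightarrow>
        fst (nth_default (0, 0) gs p) = fst (nth_default (0, 0) gs' q) \<and>
        snd (nth_default (0, 0) gs p) = snd (nth_default (0, 0) gs' q)) \<and>
     (Suc (nth_default 0 J p) = nth_default 0 J' q \<longrightarrow>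
        snd (nth_default (0, 0) gs p) = fst (nth_default (0, 0) gs' q)))"

definition slot_ok ::
    "nat \<Rightarrow> nat \<Rightarrow> nat \<Rightarrow> cnf list \<Rightarrow> nat list \<Rightarrow> nat \<times> (nat \<times> nat) list \<Rightarrow>
     nat list \<Rightarrow> nat \<times> (nat \<times> nat) list \<Rightarrow> bool" where
  "slot_ok a n k As J v J' v' \<longleftrightarrow> fst v = fst v' \<and> slot_valid a n k As J v \<and>
     slots_agree a J (snd v) J' (snd v') \<and> slots_agree a J' (snd v') J (snd v)"

definition csp_ok ::
    "nat \<Rightarrow> nat \<Rightarrow> nat \<Rightarrow> cnf list \<Rightarrow> nat \<Rightarrow> nat \<Rightarrow> nat \<Rightarrow> nat \<Rightarrow> bool" where
  "csp_ok a n k As i x j y \<longleftrightarrow>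
     x < length (slot_vals a n (length As)) \<and> y < length (slot_vals a n (length As)) \<and>
     slot_ok a n k As (nth_default [] (slots a k) i) (nth_default (0, []) (slot_vals a n (length As)) x)
       (nth_default [] (slots a k) j) (nth_default (0, []) (slot_vals a n (length As)) y)"

lemma set_n_lists_iff: "xs \<in> set (List.n_lists a ys) \<longleftrightarrow> length xs = a \<and> set xs \<subseteq> set ys"
  by (auto simp: set_n_lists)

lemma set_gap_pairs: "(l, r) \<in> set (gap_pairs n) \<longleftrightarrow> l \<le> n + 1 \<and> r \<le> n + 1"
  unfolding gap_pairs_def set_concat set_map set_upt by force

lemma set_slot_vals:
  "(\<alpha>, gs) \<in> set (slot_vals a n m) \<longleftrightarrow> \<alpha> < m \<and> length gs = a \<and> set gs \<subseteq> set (gap_pairs n)"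
  unfolding slot_vals_def set_concat set_map set_upt set_n_lists_iff[symmetric] by force

lemma index_function:
  obtains ix where "\<And>x. x \<in> set xs \<Longrightarrow> ix x < length xs \<and> xs ! ix x = x"
proof -
  have "\<forall>x \<in> set xs. \<exists>i. i < length xs \<and> xs ! i = x"
    by (auto simp: in_set_conv_nth)
  from bchoice[OF this] show ?thesis
    using that by blast
qed

text \<open>The passage from indices into lists to the tuples and values themselves.
  \<open>Suc\<close> keeps the set of values nonempty, as the lines of the graph require; the
  additional value is rejected by \<open>csp_ok\<close>.\<close>

lemma csp_solvable_iff_slots:
  "csp_solvable (length (slots a k)) (Suc (length (slot_vals a n (length As)))) (csp_ok a n k As) \<longleftrightarrow>
   (\<exists>F. \<forall>J \<in> set (slots a k). F J \<in> set (slot_vals a n (length As)) \<and>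
      (\<forall>J' \<in> set (slots a k). slot_ok a n k As J (F J) J' (F J')))"
  (is "csp_solvable ?K (Suc ?N) _ \<longleftrightarrow> ?R")
proof
  let ?s = "\<lambda>i. nth_default [] (slots a k) i"
  let ?v = "\<lambda>x. nth_default (0, []) (slot_vals a n (length As)) x"
  assume "csp_solvable ?K (Suc ?N) (csp_ok a n k As)"
  then obtain f where "\<forall>i < ?K. \<forall>j < ?K. i \<le> j \<longrightarrow> csp_ok a n k As i (f i) j (f j)"
    unfolding csp_solvable_def by (elim exE conjE)
  then have f: "csp_ok a n k As i (f i) j (f j)" if "i < ?K" "j < ?K" "i \<le> j" for i j
    using that by simp
  have less: "f i < ?N" if "i < ?K" for i
    using f[OF that that] by (simp add: csp_ok_def)
  have ok: "slot_ok a n k As (?s i) (?v (f i)) (?s j) (?v (f j))" if ij: "i < ?K" "j < ?K" for i j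
  proof (cases "i \<le> j")
    case True
    then show ?thesis using f[OF ij] by (simp add: csp_ok_def)
  next
    case False
    \<comment> \<open>All parts of \<open>slot_ok\<close> are symmetric except
      \<open>slot_valid\<close>, which the diagonal constraint supplies.\<close>
    then show ?thesis using f[OF ij(2,1)] f[OF ij(1,1)] by (simp add: csp_ok_def slot_ok_def)
  qed
  obtain ix where ix: "\<And>J. J \<in> set (slots a k) \<Longrightarrow> ix J < ?K \<and> slots a k ! ix J = J"
    by (rule index_function[of "slots a k"], rule that)
  show ?R
  proof (intro exI[of _ "\<lambda>J. ?v (f (ix J))"] ballI conjI)
    fix J assume J: "J \<in> set (slots a k)"
    then have "f (ix J) < ?N"
      using less ix by blast
    then show "?v (f (ix J)) \<in> set (slot_vals a n (length As))"
      by (simp add: nth_default_def)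
    fix J' assume "J' \<in> set (slots a k)"
    then show "slot_ok a n k As J (?v (f (ix J))) J' (?v (f (ix J')))"
      using ok[of "ix J" "ix J'"] ix J by (simp add: nth_default_def)
  qed
next
  assume ?R
  then obtain F where F: "\<And>J. J \<in> set (slots a k) \<Longrightarrow> F J \<in> set (slot_vals a n (length As))"
    "\<And>J J'. J \<in> set (slots a k) \<Longrightarrow> J' \<in> set (slots a k) \<Longrightarrow> slot_ok a n k As J (F J) J' (F J')"
    by blast
  obtain ix where ix: "\<And>v. v \<in> set (slot_vals a n (length As)) \<Longrightarrow>
      ix v < ?N \<and> slot_vals a n (length As) ! ix v = v"
    by (rule index_function[of "slot_vals a n (length As)"], rule that)
  have s: "slots a k ! i \<in> set (slots a k)" if "i < ?K" for i
    using that by simp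
  show "csp_solvable ?K (Suc ?N) (csp_ok a n k As)"
    unfolding csp_solvable_def
  proof (intro exI[of _ "\<lambda>i. ix (F (slots a k ! i))"] conjI allI impI)
    show "ix (F (slots a k ! i)) < Suc ?N" if "i < ?K" for i
      using ix[OF F(1)[OF s[OF that]]] by simp
    show "csp_ok a n k As i (ix (F (slots a k ! i))) j (ix (F (slots a k ! j)))"
      if "i < ?K" "j < ?K" for i j
      using ix[OF F(1)[OF s[OF that(1)]]] ix[OF F(1)[OF s[OF that(2)]]] F(2)[OF s[OF that(1)] s[OF that(2)]] that
      by (simp add: csp_ok_def nth_default_def)
  qed
qed

text \<open>The boundaries increase strictly, so none lies strictly inside a gap. The right end of
  the last gap is the sentinel \<open>n + 1\<close>, which is no input; \<open>y < n\<close>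
  excludes it.\<close>

lemma gap_truth:
  fixes t :: "nat \<Rightarrow> nat"
  assumes mono: "\<And>i j. i < j \<Longrightarrow> j \<le> k + 1 \<Longrightarrow> t i < t j" and "t (k + 1) = n + 1"
    and "j \<le> k" "t j < y + 1" "y + 1 \<le> t (j + 1)" "y < n"
  shows "y + 1 \<in> t ` {1..k} \<longleftrightarrow> y + 1 = t (j + 1)"
proof
  assume "y + 1 \<in> t ` {1..k}"
  then obtain i where i: "1 \<le> i" "i \<le> k" "y + 1 = t i" by auto
  have "\<not> i \<le> j"
    using mono[of i j] i assms(3,4) by (metis add.commute le_neq_implies_less not_less_iff_gr_or_eq trans_le_add2)
  moreover have "\<not> j + 1 < i"
    using mono[of "j + 1" i] i assms(5) by auto
  ultimately show "y + 1 = t (j + 1)"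
    using i by (metis Suc_eq_plus1 not_less_eq linorder_neqE_nat not_le)
next
  assume "y + 1 = t (j + 1)"
  moreover have "j \<noteq> k"
    using calculation assms(2,6) by auto
  ultimately show "y + 1 \<in> t ` {1..k}"
    using assms(3) by (intro image_eqI[of _ _ "j + 1"]) auto
qed

lemma exists_gap:
  fixes t :: "nat \<Rightarrow> nat"
  assumes "t 0 < y" "y \<le> t (k + 1)"
  shows "\<exists>j \<le> k. t j < y \<and> y \<le> t (j + 1)"
proof (rule ccontr)
  assume *: "\<not> (\<exists>j \<le> k. t j < y \<and> y \<le> t (j + 1))"
  have "t i < y" if "i \<le> k + 1" for i
    using that
  proof (induction i)
    case (Suc i)
    then show ?case using * by (metis Suc_eq_plus1 Suc_le_mono le_Suc_eq not_le)
  qed (rule assms(1))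
  then show False
    using assms(2) by fastforce
qed

text \<open>Agreement makes every tuple a restriction of one global list of gaps, whose inner
  boundaries are the true inputs. If a clause of the chosen CNF were false, each of its literals
  would be falsified by some gap; these gaps form a tuple, which contradicts the validity of that
  tuple.\<close>

lemma slots_imp_weighted_sat:
  assumes a: "0 < a"
    and lits: "\<And>A C. A \<in> set As \<Longrightarrow> C \<in> set A \<Longrightarrow> length C \<le> a \<and> (\<forall>l \<in> set C. fst l < n)"
    and F: "\<And>J. J \<in> set (slots a k) \<Longrightarrow> F J \<in> set (slot_vals a n (length As))"
    and ok: "\<And>J J'. J \<in> set (slots a k) \<Longrightarrow> J' \<in> set (slots a k) \<Longrightarrow> slot_ok a n k As J (F J) J' (F J')"
  shows "weighted_sat n k As"
proof -
  have slot: "J \<in> set (slots a k) \<longleftrightarrow> length J = a \<and> (\<forall>j \<in> set J. j \<le> k)" for J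
    unfolding slots_def set_n_lists_iff by auto
  \<comment> \<open>The constant tuples serve as reference: every other tuple is compared with them
    entry by entry.\<close>
  define G where "G j = nth_default (0, 0) (snd (F (replicate a j))) 0" for j
  have rep: "replicate a j \<in> set (slots a k)" if "j \<le> k" for j
    using that by (simp add: slot)
  have rep0: "nth_default 0 (replicate a j) 0 = j" for j
    using a by (simp add: nth_default_def)
  have G: "snd (F J) = map G J" if J: "J \<in> set (slots a k)" for J
  proof (rule nth_equalityI)
    have len: "length J = a" "length (snd (F J)) = a"
      using J F[OF J] by (auto simp: slot slot_vals_def set_n_lists_iff)
    then show "length (snd (F J)) = length (map G J)" by simp
    fix p assume "p < length (snd (F J))"
    then have p: "p < a" using len by simp
    have "J ! p \<le> k"
      using J p len by (simp add: slot)
    from ok[OF J rep[OF this]] have "slots_agree a J (snd (F J)) (replicate a (J ! p)) (snd (F (replicate a (J ! p))))"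
      by (simp add: slot_ok_def)
    moreover have "nth_default 0 J p = nth_default 0 (replicate a (J ! p)) 0"
      using p len rep0 by (simp add: nth_default_nth)
    ultimately have "nth_default (0, 0) (snd (F J)) p = G (J ! p)"
      using a p unfolding slots_agree_def G_def prod_eq_iff by blast
    then show "snd (F J) ! p = map G J ! p"
      using p len by (simp add: nth_default_nth)
  qed
  have valid: "slot_valid a n k As J (F J)" if "J \<in> set (slots a k)" for J
    using ok[OF that that] by (simp add: slot_ok_def)
  have G_bounds: "fst (G j) < snd (G j)" "j = 0 \<Longrightarrow> fst (G j) = 0" "j = k \<Longrightarrow> snd (G j) = n + 1"
    if "j \<le> k" for j
    using valid[OF rep[OF that], unfolded slot_valid_def, THEN conjunct1, THEN spec, THEN mp, OF a,
        unfolded rep0, folded G_def] by auto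
  have G_chain: "snd (G j) = fst (G (Suc j))" if "Suc j \<le> k" for j
    using ok[OF rep rep, of j "Suc j"] a rep0 that unfolding slot_ok_def slots_agree_def G_def
    by (metis Suc_leD)
  define \<alpha> where "\<alpha> = fst (F (replicate a 0))"
  have \<alpha>: "fst (F J) = \<alpha>" if "J \<in> set (slots a k)" for J
    using ok[OF that rep[of 0]] by (simp add: \<alpha>_def slot_ok_def)
  have "\<alpha> < length As"
    using F[OF rep[of 0]] unfolding \<alpha>_def slot_vals_def by auto
  then have A: "As ! \<alpha> \<in> set As" "nth_default [] As \<alpha> = As ! \<alpha>"
    by (auto simp: nth_default_nth)
  \<comment> \<open>The \<open>k + 1\<close> gaps have \<open>k + 2\<close> boundaries: their left
    ends and the right end of the last one.\<close>
  define t where "t j = (if j \<le> k then fst (G j) else n + 1)" for j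
  have snd_G: "snd (G j) = t (j + 1)" if "j \<le> k" for j
    using that G_chain[of j] G_bounds(3)[OF that] by (cases "j = k") (auto simp: t_def)
  have t_Suc: "t j < t (j + 1)" if "j \<le> k" for j
    using G_bounds(1)[OF that] snd_G[OF that] that by (simp add: t_def)
  have mono: "t i < t j" if "i < j" "j \<le> k + 1" for i j
    using that
  proof (induction j)
    case (Suc j)
    then show ?case
      using t_Suc[of j] by (cases "i = j") auto
  qed simp
  have t0: "t 0 = 0" "t (k + 1) = n + 1"
    using G_bounds(2)[of 0] by (auto simp: t_def)
  have T_le: "1 \<le> t j" "t j \<le> n" if "j \<in> {1..k}" for j
    using mono[of 0 j] mono[of j "k + 1"] that t0 by auto
  define bs where "bs = map (\<lambda>y. y + 1 \<in> t ` {1..k}) [0..<n]"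
  have len: "length bs = n"
    by (simp add: bs_def)
  have "count_list bs True = card {y. y < n \<and> y + 1 \<in> t ` {1..k}}"
    unfolding count_list_eq_length_filter length_filter_conv_card
    by (rule arg_cong[of _ _ card]) (auto simp: bs_def)
  also have "\<dots> = card (t ` {1..k})"
  proof (rule card_bij_eq[of "\<lambda>y. y + 1" _ _ "\<lambda>y. y - 1"])
    show "(\<lambda>y. y - 1) ` t ` {1..k} \<subseteq> {y. y < n \<and> y + 1 \<in> t ` {1..k}}"
    proof (clarsimp simp del: One_nat_def)
      fix j assume "1 \<le> j" "j \<le> k"
      then show "t j - 1 < n \<and> t j - 1 + 1 \<in> t ` {1..k}"
        using T_le[of j] by auto
    qed
    show "inj_on (\<lambda>y. y - 1) (t ` {1..k})"
    proof (rule inj_onI)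
      fix x y assume xy: "x \<in> t ` {1..k}" "y \<in> t ` {1..k}" "x - 1 = y - 1"
      then have "1 \<le> x" "1 \<le> y"
        using T_le by auto
      then show "x = y"
        using xy(3) by simp
    qed
  qed auto
  also have "\<dots> = k"
  proof -
    have "inj_on t {1..k}"
    proof (rule inj_onI)
      fix i j assume "i \<in> {1..k}" "j \<in> {1..k}" "t i = t j"
      then show "i = j"
        using mono[of i j] mono[of j i] by (cases i j rule: linorder_cases) auto
    qed
    then show ?thesis by (simp add: card_image)
  qed
  finally have count: "count_list bs True = k" .
  have "sat_cnf ((!) bs) (As ! \<alpha>)"
    unfolding sat_cnf_def
  proof (rule ballI, rule ccontr)
    fix C assume C: "C \<in> set (As ! \<alpha>)" and false: "\<not> (\<exists>l \<in> set C. bs ! fst l = snd l)"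
    note lC = lits[OF A(1) C]
    have "\<exists>j \<le> k. falsified l (G j)" if l: "l \<in> set C" for l
    proof -
      have y: "fst l < n"
        using lC l by blast
      obtain j where j: "j \<le> k" "t j < fst l + 1" "fst l + 1 \<le> t (j + 1)"
        using exists_gap[of t "fst l + 1" k] t0 y by auto
      have "bs ! fst l = (fst l + 1 = t (j + 1))"
        using gap_truth[OF mono t0(2) j y] y by (simp add: bs_def)
      moreover have "bs ! fst l \<noteq> snd l"
        using false l by blast
      ultimately show ?thesis
        using j snd_G[OF j(1)] by (intro exI[of _ j]) (auto simp: falsified_def t_def)
    qed
    then obtain js where js: "\<And>l. l \<in> set C \<Longrightarrow> js l \<le> k \<and> falsified l (G (js l))"
      by metis
    \<comment> \<open>Clauses may be shorter than \<open>a\<close>; any index at most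
      \<open>k\<close> can pad the tuple, as additional gaps cannot undo a falsification.\<close>
    define J where "J = map js C @ replicate (a - length C) 0"
    have J: "J \<in> set (slots a k)"
      unfolding slot J_def using lC js by auto
    obtain l where l: "l \<in> set C" "\<forall>g \<in> set (snd (F J)). \<not> falsified l g"
      using valid[OF J] C \<alpha>[OF J] A(2) unfolding slot_valid_def by auto
    moreover have "G (js l) \<in> set (snd (F J))"
      unfolding G[OF J] using l(1) by (simp add: J_def)
    ultimately show False
      using js by blast
  qed
  then show ?thesis
    unfolding weighted_sat_def using len count A(1) by blast
qed

text \<open>All variables take the actual gaps of the assignment and the CNF that it satisfies. By
  \<open>gap_truth\<close>, an actual gap never falsifies a literal that is true, so one true
  literal per clause makes every tuple valid.\<close>

lemma weighted_sat_imp_slots: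
  assumes lits: "\<And>A C. A \<in> set As \<Longrightarrow> C \<in> set A \<Longrightarrow> length C \<le> a \<and> (\<forall>l \<in> set C. fst l < n)"
    and "weighted_sat n k As"
  shows "\<exists>F. \<forall>J \<in> set (slots a k). F J \<in> set (slot_vals a n (length As)) \<and>
      (\<forall>J' \<in> set (slots a k). slot_ok a n k As J (F J) J' (F J'))"
proof -
  obtain bs A where bs: "length bs = n" "count_list bs True = k" and A: "A \<in> set As" "sat_cnf ((!) bs) A"
    using assms(2) unfolding weighted_sat_def by blast
  obtain \<alpha> where \<alpha>: "\<alpha> < length As" "As ! \<alpha> = A"
    using A(1) by (auto simp: in_set_conv_nth)
  define T where "T = Suc ` {y. y < n \<and> bs ! y}"
  have "card T = card {y. y < n \<and> bs ! y}"
    unfolding T_def by (rule card_image) simp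
  also have "\<dots> = k"
    using bs(2) unfolding count_list_eq_length_filter length_filter_conv_card bs(1) by simp
  finally have cardT: "card T = k" .
  have T: "finite T" "\<And>y. y \<in> T \<Longrightarrow> 1 \<le> y \<and> y \<le> n" "\<And>y. y < n \<Longrightarrow> y + 1 \<in> T \<longleftrightarrow> bs ! y"
    unfolding T_def by auto
  \<comment> \<open>Inputs are shifted by 1 so that the sentinel 0 lies below all of them.\<close>
  define xs where "xs = 0 # sorted_list_of_set T @ [n + 1]"
  have len: "length xs = k + 2"
    using cardT by (simp add: xs_def)
  have "sorted_wrt (<) xs"
    using T(1,2) by (fastforce simp: xs_def sorted_wrt_append)
  define t where "t j = xs ! j" for j
  have mono: "t i < t j" if "i < j" "j \<le> k + 1" for i j
    using sorted_wrt_nth_less[OF \<open>sorted_wrt (<) xs\<close> that(1)] that(2) len by (simp add: t_def)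
  have t0: "t 0 = 0" "t (k + 1) = n + 1"
    using cardT by (auto simp: t_def xs_def nth_append)
  have "t ` {1..k} = set (sorted_list_of_set T)"
  proof -
    have "t (Suc i) = sorted_list_of_set T ! i" if "i < k" for i
      using that cardT by (simp add: t_def xs_def nth_append)
    moreover have "{1..k} = Suc ` {..<k}"
      by (auto simp: image_iff Suc_le_eq) (metis Suc_pred lessThan_iff Suc_le_eq)
    ultimately have "t ` {1..k} = (\<lambda>i. sorted_list_of_set T ! i) ` {..<k}"
      by (simp add: image_image)
    then show ?thesis
      using cardT by (auto simp: set_conv_nth)
  qed
  then have tT: "t ` {1..k} = T"
    using T(1) by simp
  define G where "G j = (t j, t (j + 1))" for j
  have slot: "J \<in> set (slots a k) \<longleftrightarrow> length J = a \<and> (\<forall>j \<in> set J. j \<le> k)" for J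
    unfolding slots_def set_n_lists_iff by auto
  have t_le: "t j \<le> n + 1" if "j \<le> k + 1" for j
    using mono[of j "k + 1"] t0(2) that by (cases "j = k + 1") auto
  show ?thesis
  proof (intro exI[of _ "\<lambda>J. (\<alpha>, map G J)"] ballI conjI)
    fix J assume J: "J \<in> set (slots a k)"
    have Jp: "J ! p \<le> k" "length J = a" if "p < a" for p
      using J that by (auto simp: slot)
    have "set (map G J) \<subseteq> set (gap_pairs n)"
    proof
      fix g assume "g \<in> set (map G J)"
      then obtain j where j: "j \<le> k" "g = G j"
        using J by (auto simp: slot)
      show "g \<in> set (gap_pairs n)"
        unfolding j(2) G_def set_gap_pairs using t_le[of j] t_le[of "j + 1"] j(1) by simp
    qed
    then show "(\<alpha>, map G J) \<in> set (slot_vals a n (length As))"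
      using \<alpha>(1) J by (simp add: set_slot_vals slot)
    have "slot_valid a n k As J (\<alpha>, map G J)"
      unfolding slot_valid_def
    proof (intro conjI allI impI ballI)
      fix p assume p: "p < a"
      note [simp] = Jp[OF p]
      show "fst (nth_default (0, 0) (snd (\<alpha>, map G J)) p) = 0" if "nth_default 0 J p = 0"
        using that p t0 by (simp add: nth_default_nth G_def)
      show "snd (nth_default (0, 0) (snd (\<alpha>, map G J)) p) = n + 1" if "nth_default 0 J p = k"
        using that p t0 by (simp add: nth_default_nth G_def)
      show "fst (nth_default (0, 0) (snd (\<alpha>, map G J)) p) < snd (nth_default (0, 0) (snd (\<alpha>, map G J)) p)"
        using p mono[of "J ! p" "J ! p + 1"] by (simp add: nth_default_nth G_def)
    next
      fix C assume "C \<in> set (nth_default [] As (fst (\<alpha>, map G J)))"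
      then have C: "C \<in> set A"
        using \<alpha> by (simp add: nth_default_nth)
      then obtain l where l: "l \<in> set C" "bs ! fst l = snd l"
        using A(2) unfolding sat_cnf_def by blast
      have y: "fst l < n"
        using lits[OF A(1) C] l(1) by blast
      have "\<not> falsified l g" if g: "g \<in> set (map G J)" for g
      proof
        assume f: "falsified l g"
        obtain j where j: "j \<le> k" "g = G j"
          using g J by (auto simp: slot)
        have *: "t j < fst l + 1" "fst l + 1 \<le> t (j + 1)" "\<not> (fst l + 1 = t (j + 1)) = snd l"
          using f by (auto simp: falsified_def j G_def)
        show False
          using gap_truth[OF mono t0(2) j(1) *(1,2) y] *(3) T(3)[OF y] l(2) unfolding tT by simp
      qed
      then show "\<exists>l \<in> set C. \<forall>g \<in> set (snd (\<alpha>, map G J)). \<not> falsified l g"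
        using l(1) unfolding snd_conv by blast
    qed
    moreover have agree: "slots_agree a J (map G J) J' (map G J')"
      if "J \<in> set (slots a k)" "J' \<in> set (slots a k)" for J J'
      using that by (auto simp: slots_agree_def slot nth_default_nth G_def)
    ultimately show "slot_ok a n k As J (\<alpha>, map G J) J' (\<alpha>, map G J')" if "J' \<in> set (slots a k)" for J'
      using J that by (simp add: slot_ok_def)
  qed
qed

lemma csp_solvable_iff_weighted_sat:
  assumes "0 < a"
    and "\<And>A C. A \<in> set As \<Longrightarrow> C \<in> set A \<Longrightarrow> length C \<le> a \<and> (\<forall>l \<in> set C. fst l < n)"
  shows "csp_solvable (length (slots a k)) (Suc (length (slot_vals a n (length As)))) (csp_ok a n k As)
    \<longleftrightarrow> weighted_sat n k As"
  unfolding csp_solvable_iff_slots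
proof
  assume "\<exists>F. \<forall>J \<in> set (slots a k). F J \<in> set (slot_vals a n (length As)) \<and>
      (\<forall>J' \<in> set (slots a k). slot_ok a n k As J (F J) J' (F J'))"
  then obtain F where "\<And>J. J \<in> set (slots a k) \<Longrightarrow> F J \<in> set (slot_vals a n (length As))"
    "\<And>J J'. J \<in> set (slots a k) \<Longrightarrow> J' \<in> set (slots a k) \<Longrightarrow> slot_ok a n k As J (F J) J' (F J')"
    by blast
  then show "weighted_sat n k As"
    using slots_imp_weighted_sat[of a As n k F] assms by blast
qed (use weighted_sat_imp_slots[of As a n k] assms(2) in blast)


section \<open>Circuits of weft 1 as alternatives of CNFs\<close>

text \<open>A gate as a pair of a tag, as in \<open>enc_gate\<close>, and its list of predecessors.\<close>

type_synonym raw_gate = "nat \<times> nat list"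

primrec raw :: "gate \<Rightarrow> raw_gate" where
  "raw (Neg i) = (0, [i])"
| "raw (And is) = (1, is)"
| "raw (Or is) = (2, is)"

lemma snd_raw: "snd (raw g) = preds g"
  by (cases g) auto

text \<open>Subtraction is truncated, so the result describes the node only if
  \<open>n \<le> v\<close>; the recursions below test \<open>v < n\<close> first.\<close>

definition node_gate :: "nat \<Rightarrow> raw_gate list \<Rightarrow> nat \<Rightarrow> raw_gate" where
  "node_gate n rs v = nth_default (0, []) rs (v - n)"

definition node_pred :: "nat \<Rightarrow> raw_gate list \<Rightarrow> nat \<Rightarrow> nat \<Rightarrow> nat" where
  "node_pred n rs v i = nth_default 0 (snd (node_gate n rs v)) i"

text \<open>The recursions run on a bound \<open>e\<close> for the depth of the node \<open>v\<close> instead of the circuit: for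
  constant \<open>e\<close>, the functions are then finite compositions, so no bound on intermediate results is
  needed to see that they take polynomial time.\<close>

primrec depth_le :: "nat \<Rightarrow> nat \<Rightarrow> raw_gate list \<Rightarrow> nat \<Rightarrow> bool" where
  "depth_le 0 n rs v = (v < n)"
| "depth_le (Suc e) n rs v =
     (v < n \<or> (\<forall>p \<in> set (snd (node_gate n rs v)). depth_le e n rs p))"

text \<open>Meaningful together with \<open>depth_le\<close> for the same bound: at bound 0 the node
  is then an input, below which there are no gates.\<close>

primrec weft0 :: "nat \<Rightarrow> nat \<Rightarrow> raw_gate list \<Rightarrow> nat \<Rightarrow> bool" where
  "weft0 0 n rs v = True"
| "weft0 (Suc e) n rs v =
     (v < n \<or> length (snd (node_gate n rs v)) \<le> 2 \<and>
        (\<forall>p \<in> set (snd (node_gate n rs v)). weft0 e n rs p))"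

primrec weft1 :: "nat \<Rightarrow> nat \<Rightarrow> raw_gate list \<Rightarrow> nat \<Rightarrow> bool" where
  "weft1 0 n rs v = True"
| "weft1 (Suc e) n rs v =
     (v < n \<or> (if length (snd (node_gate n rs v)) \<le> 2
        then \<forall>p \<in> set (snd (node_gate n rs v)). weft1 e n rs p
        else \<forall>p \<in> set (snd (node_gate n rs v)). weft0 e n rs p))"

text \<open>A CNF for the node having the value \<open>b\<close>. The flag absorbs negations by De
  Morgan: \<open>(tag = 1) = b\<close> holds for conjunctions to be made true and disjunctions to be
  made false, where all predecessors must have the value \<open>b\<close>. In the remaining case the
  two CNFs are multiplied out.\<close>

primrec node_cnf :: "nat \<Rightarrow> nat \<Rightarrow> raw_gate list \<Rightarrow> nat \<Rightarrow> bool \<Rightarrow> cnf" where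
  "node_cnf 0 n rs v b = [[(v, b)]]"
| "node_cnf (Suc e) n rs v b =
     (if v < n then [[(v, b)]]
      else if fst (node_gate n rs v) = 0 then node_cnf e n rs (node_pred n rs v 0) (\<not> b)
      else if (fst (node_gate n rs v) = 1) = b
      then node_cnf e n rs (node_pred n rs v 0) b @ node_cnf e n rs (node_pred n rs v 1) b
      else concat (map (\<lambda>C. map (\<lambda>C'. C @ C') (node_cnf e n rs (node_pred n rs v 1) b))
        (node_cnf e n rs (node_pred n rs v 0) b)))"

text \<open>A large disjunction becomes a choice between CNFs, a large conjunction a single large CNF.\<close>

primrec node_alts :: "nat \<Rightarrow> nat \<Rightarrow> raw_gate list \<Rightarrow> nat \<Rightarrow> bool \<Rightarrow> cnf list" where
  "node_alts 0 n rs v b = [[[(v, b)]]]"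
| "node_alts (Suc e) n rs v b =
     (if v < n then [[[(v, b)]]]
      else if fst (node_gate n rs v) = 0 then node_alts e n rs (node_pred n rs v 0) (\<not> b)
      else if length (snd (node_gate n rs v)) \<le> 2 then
        (if (fst (node_gate n rs v) = 1) = b
         then concat (map (\<lambda>A. map (\<lambda>A'. A @ A') (node_alts e n rs (node_pred n rs v 1) b))
           (node_alts e n rs (node_pred n rs v 0) b))
         else node_alts e n rs (node_pred n rs v 0) b @ node_alts e n rs (node_pred n rs v 1) b)
      else if (fst (node_gate n rs v) = 1) = b
      then [concat (map (\<lambda>p. node_cnf e n rs p b) (snd (node_gate n rs v)))]
      else map (\<lambda>p. node_cnf e n rs p b) (snd (node_gate n rs v)))"

section \<open>Values, depth and weft at the nodes of a circuit\<close>

definition node_values :: "(gate \<Rightarrow> 'v list \<Rightarrow> 'v) \<Rightarrow> 'v list \<Rightarrow> gate list \<Rightarrow> 'v list" where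
  "node_values f vs gs = foldl (\<lambda>us g. us @ [f g (map ((!) us) (preds g))]) vs gs"

lemma node_values_snoc:
  "node_values f vs (gs @ [g]) =
     node_values f vs gs @ [f g (map ((!) (node_values f vs gs)) (preds g))]"
  by (simp add: node_values_def)

lemma length_node_values: "length (node_values f vs gs) = length vs + length gs"
  by (induction gs rule: rev_induct) (auto simp: node_values_snoc, simp add: node_values_def)

lemma node_values_input: "i < length vs \<Longrightarrow> node_values f vs gs ! i = vs ! i"
  by (induction gs rule: rev_induct)
    (auto simp: node_values_snoc nth_append length_node_values, simp add: node_values_def)

text \<open>Entries never change once appended, and predecessors come earlier; so the value computed
  from a prefix of the list can be read off the final list.\<close>

lemma node_values_gate:
  assumes "\<And>j. j < length gs \<Longrightarrow> \<forall>i \<in> set (preds (gs ! j)). i < length vs + j" "j < length gs"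
  shows "node_values f vs gs ! (length vs + j) =
    f (gs ! j) (map ((!) (node_values f vs gs)) (preds (gs ! j)))"
  using assms
proof (induction gs rule: rev_induct)
  case (snoc g gs)
  have lt: "i < length vs + length gs" if "j \<le> length gs" "i \<in> set (preds ((gs @ [g]) ! j))" for i j
    using snoc.prems(1)[of j] that by fastforce
  have eq: "map ((!) (node_values f vs (gs @ [g]))) (preds ((gs @ [g]) ! j)) =
    map ((!) (node_values f vs gs)) (preds ((gs @ [g]) ! j))"
    using lt[of j] snoc.prems(2) by (auto simp: node_values_snoc nth_append length_node_values)
  have old: "node_values f vs gs ! (length vs + j) =
    f (gs ! j) (map ((!) (node_values f vs gs)) (preds (gs ! j)))" if "j < length gs"
  proof (rule snoc.IH[OF _ that])
    show "\<forall>i \<in> set (preds (gs ! j)). i < length vs + j" if "j < length gs" for j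
      using snoc.prems(1)[of j] that by (simp add: nth_append)
  qed
  show ?case
    unfolding eq using snoc.prems(2) old by (cases "j < length gs") (auto simp: node_values_snoc nth_append length_node_values)
qed simp

lemma at_output_eq:
  assumes "vs \<noteq> []"
  shows "at_output f vs gs = node_values f vs gs ! (length vs + length gs - 1)"
proof -
  have "node_values f vs gs \<noteq> []"
    using assms length_node_values[of f vs gs] by auto
  then show ?thesis
    unfolding at_output_def node_values_def[symmetric] by (simp add: last_conv_nth length_node_values)
qed

locale circuit =
  fixes n :: nat and gs :: "gate list"
  assumes wf: "wf_circuit n gs"
begin

abbreviation rs :: "raw_gate list" where "rs \<equiv> map raw gs"
abbreviation size :: nat where "size \<equiv> n + length gs"
abbreviation ps :: "nat \<Rightarrow> nat list" where "ps v \<equiv> snd (node_gate n rs v)"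
abbreviation tag :: "nat \<Rightarrow> nat" where "tag v \<equiv> fst (node_gate n rs v)"

lemma n_pos: "0 < n"
  using wf by (simp add: wf_circuit_def)

lemma node_gate_eq: "n \<le> v \<Longrightarrow> v < size \<Longrightarrow> node_gate n rs v = raw (gs ! (v - n))"
  by (simp add: node_gate_def nth_default_nth)

lemma ps_eq: "n \<le> v \<Longrightarrow> v < size \<Longrightarrow> ps v = preds (gs ! (v - n))"
  by (simp add: node_gate_eq snd_raw)

lemma ps_less: "n \<le> v \<Longrightarrow> v < size \<Longrightarrow> p \<in> set (ps v) \<Longrightarrow> p < v"
proof -
  assume v: "n \<le> v" "v < size" "p \<in> set (ps v)"
  then have "v - n < length gs" by simp
  then have "\<forall>i \<in> set (preds (gs ! (v - n))). i < n + (v - n)"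
    using wf unfolding wf_circuit_def by blast
  then show ?thesis
    using v by (simp add: ps_eq)
qed

lemma ps_neg: "n \<le> v \<Longrightarrow> v < size \<Longrightarrow> tag v = 0 \<Longrightarrow> ps v = [node_pred n rs v 0]"
  by (cases "gs ! (v - n)") (auto simp: node_pred_def node_gate_eq nth_default_def)

lemma ps_large:
  assumes v: "n \<le> v" "v < size" and "tag v \<noteq> 0"
  shows "2 \<le> length (ps v)" "tag v = 1 \<or> tag v = 2"
proof -
  have mem: "gs ! (v - n) \<in> set gs"
    using v by auto
  have len: "And is \<in> set gs \<or> Or is \<in> set gs \<Longrightarrow> 2 \<le> length is" for "is"
    using wf unfolding wf_circuit_def by blast
  show "2 \<le> length (ps v)"
    unfolding node_gate_eq[OF v]
    by (cases "gs ! (v - n)") (use mem len assms(3) in \<open>auto simp: node_gate_eq[OF v]\<close>)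
  show "tag v = 1 \<or> tag v = 2"
    using assms(3) unfolding node_gate_eq[OF v] by (cases "gs ! (v - n)") auto
qed

lemma ps_nonempty: "n \<le> v \<Longrightarrow> v < size \<Longrightarrow> ps v \<noteq> []"
  using ps_neg ps_large by (metis list.distinct(1) list.size(3) not_numeral_le_zero)

lemma ps_two:
  assumes "n \<le> v" "v < size" "tag v \<noteq> 0" "length (ps v) \<le> 2"
  shows "ps v = [node_pred n rs v 0, node_pred n rs v 1]"
proof -
  have "length (ps v) = 2"
    using ps_large[OF assms(1-3)] assms(4) by simp
  then obtain p q where "ps v = [p, q]"
    by (auto simp: numeral_2_eq_2 length_Suc_conv)
  then show ?thesis
    by (simp add: node_pred_def nth_default_def)
qed

lemma node_values_node:
  assumes "length vs = n" "n \<le> v" "v < size"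
  shows "node_values f vs gs ! v = f (gs ! (v - n)) (map ((!) (node_values f vs gs)) (ps v))"
proof -
  have "\<forall>i \<in> set (preds (gs ! j)). i < length vs + j" if "j < length gs" for j
    using wf that assms(1) unfolding wf_circuit_def by simp
  from node_values_gate[OF this, of "v - n" f] show ?thesis
    using assms by (simp add: ps_eq)
qed

lemma at_output_node: "at_output f vs gs = node_values f vs gs ! (size - 1)" if "length vs = n"
  using at_output_eq[of vs f gs] n_pos that by auto

lemma output_less: "size - 1 < size"
  using n_pos by simp

lemma depth_le_iff:
  assumes "v < size"
  shows "depth_le e n rs v \<longleftrightarrow>
    node_values (\<lambda>g ds. Max (set ds) + 1) (replicate n (0::nat)) gs ! v \<le> e"
  using assms
proof (induction e arbitrary: v)
  case 0
  then show ?case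
    using node_values_input[of v "replicate n (0::nat)"]
      node_values_node[of "replicate n (0::nat)" v "\<lambda>g ds. Max (set ds) + 1"] by (cases "v < n") auto
next
  case (Suc e)
  let ?d = "node_values (\<lambda>g ds. Max (set ds) + 1) (replicate n (0::nat)) gs"
  show ?case
  proof (cases "v < n")
    case True
    then show ?thesis
      using node_values_input[of v "replicate n (0::nat)"] by simp
  next
    case False
    have "?d ! v = Max ((!) ?d ` set (ps v)) + 1"
      using node_values_node[of "replicate n (0::nat)" v "\<lambda>g ds. Max (set ds) + 1"] False Suc.prems by simp
    then have "?d ! v \<le> Suc e \<longleftrightarrow> (\<forall>p \<in> set (ps v). ?d ! p \<le> e)"
      using ps_nonempty[of v] False Suc.prems by (simp add: Max_le_iff)
    moreover have "depth_le e n rs p \<longleftrightarrow> ?d ! p \<le> e" if "p \<in> set (ps v)" for p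
      using Suc.IH[of p] ps_less[of v p] that False Suc.prems by simp
    ultimately show ?thesis
      using False by simp
  qed
qed

text \<open>The depth bound ensures that the recursions of \<open>weft0\<close> and
  \<open>weft1\<close> end at inputs and not at a gate where the bound has run out.\<close>

lemma weft_iff:
  fixes e
  defines "w \<equiv> node_values (\<lambda>g ws. Max (set ws) + (if length (preds g) > 2 then 1 else 0)) (replicate n (0::nat)) gs"
  assumes "v < size" "depth_le e n rs v"
  shows "weft0 e n rs v \<longleftrightarrow> w ! v = 0" "weft1 e n rs v \<longleftrightarrow> w ! v \<le> 1"
proof -
  have input: "w ! v = 0" if "v < n" for v
    using node_values_input[of v "replicate n (0::nat)"] that by (simp add: w_def)
  have gate: "w ! v = Max ((!) w ` set (ps v)) + (if length (ps v) > 2 then 1 else 0)"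
    if "n \<le> v" "v < size" for v
    using node_values_node[of "replicate n (0::nat)" v
        "\<lambda>g ws. Max (set ws) + (if length (preds g) > 2 then 1 else 0)"] that ps_eq[OF that]
    by (simp add: w_def)
  have "(weft0 e n rs v \<longleftrightarrow> w ! v = 0) \<and> (weft1 e n rs v \<longleftrightarrow> w ! v \<le> 1)"
    using assms(2,3)
  proof (induction e arbitrary: v)
    case 0
    then show ?case using input by simp
  next
    case (Suc e)
    show ?case
    proof (cases "v < n")
      case True
      then show ?thesis using input by simp
    next
      case False
      have IH: "(weft0 e n rs p \<longleftrightarrow> w ! p = 0) \<and> (weft1 e n rs p \<longleftrightarrow> w ! p \<le> 1)" if "p \<in> set (ps v)" for p
        using Suc.IH[of p] ps_less[of v p] that False Suc.prems by simp
      have Max: "Max ((!) w ` set (ps v)) \<le> m \<longleftrightarrow> (\<forall>p \<in> set (ps v). w ! p \<le> m)" for m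
        using ps_nonempty[of v] False Suc.prems by (simp add: Max_le_iff)
      show ?thesis
        using gate[of v] False Suc.prems IH Max[of 0] Max[of 1] by auto
    qed
  qed
  then show "weft0 e n rs v \<longleftrightarrow> w ! v = 0" "weft1 e n rs v \<longleftrightarrow> w ! v \<le> 1"
    by auto
qed

lemma depth_weft_output:
  "weft n gs \<le> 1 \<and> depth n gs \<le> d \<longleftrightarrow> depth_le d n rs (size - 1) \<and> weft1 d n rs (size - 1)"
proof -
  have "depth n gs = node_values (\<lambda>g ds. Max (set ds) + 1) (replicate n (0::nat)) gs ! (size - 1)"
    "weft n gs = node_values (\<lambda>g ws. Max (set ws) + (if length (preds g) > 2 then 1 else 0))
       (replicate n (0::nat)) gs ! (size - 1)"
    unfolding depth_def weft_def by (rule at_output_node, simp)+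
  then show ?thesis
    using depth_le_iff[OF output_less, of d] weft_iff(2)[OF output_less, of d] by metis
qed

text \<open>Clauses are merged only when two CNFs are multiplied out, so their length at most
  doubles per level; without large gates two factors are enough at each gate.\<close>

lemma node_cnf_clauses:
  assumes "v < size" "depth_le e n rs v" "weft0 e n rs v" "C \<in> set (node_cnf e n rs v b)"
  shows "length C \<le> 2 ^ e \<and> (\<forall>l \<in> set C. fst l < n)"
  using assms
proof (induction e arbitrary: v b C)
  case (Suc e)
  show ?case
  proof (cases "v < n")
    case False
    then have v: "n \<le> v" "v < size" using Suc.prems by auto
    have IH: "length C \<le> 2 ^ e \<and> (\<forall>l \<in> set C. fst l < n)"
      if "p \<in> set (ps v)" "C \<in> set (node_cnf e n rs p b)" for p b C
      using Suc.IH[of p C b] ps_less[OF v that(1)] v that Suc.prems False by simp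
    show ?thesis
    proof (cases "tag v = 0")
      case True
      then have "node_pred n rs v 0 \<in> set (ps v)"
        using ps_neg[OF v] by simp
      then show ?thesis
        using IH[of "node_pred n rs v 0" C "\<not> b"] Suc.prems(4) True False by auto
    next
      case t: False
      have "length (ps v) \<le> 2"
        using Suc.prems(3) False by simp
      then have mem: "node_pred n rs v 0 \<in> set (ps v)" "node_pred n rs v 1 \<in> set (ps v)"
        using ps_two[OF v t] by (metis list.set_intros)+
      consider (one) p where "p \<in> set (ps v)" "C \<in> set (node_cnf e n rs p b)"
        | (two) C0 C1 where "C0 \<in> set (node_cnf e n rs (node_pred n rs v 0) b)"
          "C1 \<in> set (node_cnf e n rs (node_pred n rs v 1) b)" "C = C0 @ C1"
        using Suc.prems(4) t False mem by (auto split: if_splits)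
      then show ?thesis
      proof cases
        case one
        then show ?thesis using IH[of p C b] by auto
      next
        case two
        then show ?thesis using IH[OF mem(1), of C0 b] IH[OF mem(2), of C1 b] by auto
      qed
    qed
  qed (use Suc.prems in auto)
qed auto

text \<open>Above and at the large gates, clauses are only collected, chosen between or passed on,
  never merged; hence the width is that of \<open>node_cnf\<close>.\<close>

lemma node_alts_clauses:
  assumes "v < size" "depth_le e n rs v" "weft1 e n rs v" "A \<in> set (node_alts e n rs v b)" "C \<in> set A"
  shows "length C \<le> 2 ^ e \<and> (\<forall>l \<in> set C. fst l < n)"
  using assms
proof (induction e arbitrary: v b A C)
  case (Suc e)
  show ?case
  proof (cases "v < n")
    case False
    then have v: "n \<le> v" "v < size" using Suc.prems by auto
    have less: "p < size \<and> depth_le e n rs p" if "p \<in> set (ps v)" for p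
      using ps_less[OF v that] v that Suc.prems(2) False by simp
    show ?thesis
    proof (cases "length (ps v) \<le> 2")
      case small: True
      have IH: "length C \<le> 2 ^ e \<and> (\<forall>l \<in> set C. fst l < n)"
        if "p \<in> set (ps v)" "A \<in> set (node_alts e n rs p b)" "C \<in> set A" for p b A C
        using Suc.IH[of p A b C] less[OF that(1)] that Suc.prems(3) small False by simp
      show ?thesis
      proof (cases "tag v = 0")
        case True
        then have "node_pred n rs v 0 \<in> set (ps v)"
          using ps_neg[OF v] by simp
        then show ?thesis
          using IH[of "node_pred n rs v 0" A "\<not> b" C] Suc.prems(4,5) True False by auto
      next
        case t: False
        have mem: "node_pred n rs v 0 \<in> set (ps v)" "node_pred n rs v 1 \<in> set (ps v)"
          using ps_two[OF v t small] by (metis list.set_intros)+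
        have "\<exists>p \<in> set (ps v). \<exists>A' \<in> set (node_alts e n rs p b). C \<in> set A'"
          using Suc.prems(4,5) t False small mem by (auto split: if_splits) blast+
        then obtain p A' where "p \<in> set (ps v)" "A' \<in> set (node_alts e n rs p b)" "C \<in> set A'"
          by blast
        then show ?thesis
          using IH[of p A' b C] by auto
      qed
    next
      case large: False
      then have t: "tag v \<noteq> 0"
        using ps_neg[OF v] by fastforce
      have w: "weft0 e n rs p" if "p \<in> set (ps v)" for p
        using Suc.prems(3) large False that by simp
      obtain p where p: "p \<in> set (ps v)" "C \<in> set (node_cnf e n rs p b)"
        using Suc.prems(4,5) False t large by (auto split: if_splits)
      have "length C \<le> 2 ^ e \<and> (\<forall>l \<in> set C. fst l < n)"
        using node_cnf_clauses[OF _ _ w p(2)] less p(1) by blast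
      then show ?thesis by auto
    qed
  qed (use Suc.prems in auto)
qed auto

context
  fixes bs :: "bool list"
  assumes len: "length bs = n"
begin

abbreviation val :: "nat \<Rightarrow> bool" where "val v \<equiv> node_values gate_value bs gs ! v"

lemma val_neg: "n \<le> v \<Longrightarrow> v < size \<Longrightarrow> tag v = 0 \<Longrightarrow> val v = (\<not> val (node_pred n rs v 0))"
  using node_values_node[OF len, of v gate_value] ps_neg[of v]
  by (cases "gs ! (v - n)") (auto simp: node_gate_eq)

lemma val_gate:
  assumes v: "n \<le> v" "v < size" and t: "tag v \<noteq> 0"
  shows "val v = b \<longleftrightarrow> (if (tag v = 1) = b then \<forall>p \<in> set (ps v). val p = b else \<exists>p \<in> set (ps v). val p = b)"
  using node_values_node[OF len v, of gate_value] t node_gate_eq[OF v]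
  by (cases "gs ! (v - n)"; cases b) auto

lemma sat_node_cnf:
  assumes "v < size" "depth_le e n rs v" "weft0 e n rs v"
  shows "sat_cnf val (node_cnf e n rs v b) \<longleftrightarrow> val v = b"
  using assms
proof (induction e arbitrary: v b)
  case (Suc e)
  show ?case
  proof (cases "v < n")
    case False
    then have v: "n \<le> v" "v < size" using Suc.prems by auto
    have IH: "sat_cnf val (node_cnf e n rs p b) \<longleftrightarrow> val p = b" if "p \<in> set (ps v)" for p b
      using Suc.IH[of p b] ps_less[OF v that(1)] v that Suc.prems False by simp
    show ?thesis
    proof (cases "tag v = 0")
      case True
      then have "node_pred n rs v 0 \<in> set (ps v)"
        using ps_neg[OF v] by simp
      then show ?thesis
        using IH[of "node_pred n rs v 0" "\<not> b"] val_neg[OF v True] True False by auto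
    next
      case t: False
      have "length (ps v) \<le> 2"
        using Suc.prems(3) False by simp
      then have two: "set (ps v) = {node_pred n rs v 0, node_pred n rs v 1}"
        using ps_two[OF v t] by (metis list.set(1) list.set(2))
      have app: "sat_cnf val (A @ B) \<longleftrightarrow> sat_cnf val A \<and> sat_cnf val B" for A B
        by (auto simp: sat_cnf_def)
      have prod: "sat_cnf val (concat (map (\<lambda>C. map (\<lambda>C'. C @ C') B) A)) \<longleftrightarrow>
          sat_cnf val A \<or> sat_cnf val B" for A B
        unfolding sat_cnf_def by (simp add: bex_Un)
      show ?thesis
        using t False IH val_gate[OF v t, of b] unfolding two by (simp add: app prod)
    qed
  qed (auto simp: sat_cnf_def)
qed (auto simp: sat_cnf_def)

text \<open>A choice of CNFs commutes with small gates: a conjunctive one combines a choice on each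
  side, a disjunctive one unites the choices. At a large gate, all predecessors have weft 0 and a
  single CNF each.\<close>

lemma sat_node_alts:
  assumes "v < size" "depth_le e n rs v" "weft1 e n rs v"
  shows "(\<exists>A \<in> set (node_alts e n rs v b). sat_cnf val A) \<longleftrightarrow> val v = b"
  using assms
proof (induction e arbitrary: v b)
  case (Suc e)
  show ?case
  proof (cases "v < n")
    case False
    then have v: "n \<le> v" "v < size" using Suc.prems by auto
    have less: "p < size \<and> depth_le e n rs p" if "p \<in> set (ps v)" for p
      using ps_less[OF v that] v that Suc.prems(2) False by simp
    have app: "sat_cnf val (A @ B) \<longleftrightarrow> sat_cnf val A \<and> sat_cnf val B" for A B
      by (auto simp: sat_cnf_def)
    show ?thesis
    proof (cases "length (ps v) \<le> 2")
      case small: True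
      have IH: "(\<exists>A \<in> set (node_alts e n rs p b). sat_cnf val A) \<longleftrightarrow> val p = b" if "p \<in> set (ps v)" for p b
        using Suc.IH[of p b] less[OF that] that Suc.prems(3) small False by simp
      show ?thesis
      proof (cases "tag v = 0")
        case True
        then have "node_pred n rs v 0 \<in> set (ps v)"
          using ps_neg[OF v] by simp
        then show ?thesis
          using IH[of "node_pred n rs v 0" "\<not> b"] val_neg[OF v True] True False by auto
      next
        case t: False
        have two: "set (ps v) = {node_pred n rs v 0, node_pred n rs v 1}"
          using ps_two[OF v t small] by (metis list.set(1) list.set(2))
        have prod: "(\<exists>A \<in> set (concat (map (\<lambda>A. map (\<lambda>A'. A @ A') Bs) As)). sat_cnf val A) \<longleftrightarrow>
            (\<exists>A \<in> set As. sat_cnf val A) \<and> (\<exists>A \<in> set Bs. sat_cnf val A)" for As Bs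
          by (auto simp: app)
        have union: "(\<exists>A \<in> set (As @ Bs). sat_cnf val A) \<longleftrightarrow>
            (\<exists>A \<in> set As. sat_cnf val A) \<or> (\<exists>A \<in> set Bs. sat_cnf val A)" for As Bs
          by auto
        show ?thesis
          using t False small IH val_gate[OF v t, of b] unfolding two
          by (simp add: prod union del: set_append set_concat set_map)
      qed
    next
      case large: False
      then have t: "tag v \<noteq> 0"
        using ps_neg[OF v] by fastforce
      have cnf: "sat_cnf val (node_cnf e n rs p b) \<longleftrightarrow> val p = b" if "p \<in> set (ps v)" for p
        using sat_node_cnf[of p e b] less[OF that] Suc.prems(3) large False that by simp
      have conc: "sat_cnf val (concat (map F xs)) \<longleftrightarrow> (\<forall>x \<in> set xs. sat_cnf val (F x))" for F and xs :: "nat list"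
        by (auto simp: sat_cnf_def)
      show ?thesis
        using t False large cnf val_gate[OF v t, of b] by (simp add: conc)
    qed
  qed (auto simp: sat_cnf_def)
qed (auto simp: sat_cnf_def)

end

lemma weighted_sat_node_alts:
  assumes "weft n gs \<le> 1" "depth n gs \<le> d"
  shows "weighted_sat n k (node_alts d n rs (size - 1) True) \<longleftrightarrow>
    (\<exists>bs. length bs = n \<and> count_list bs True = k \<and> circuit_value gs bs)"
proof -
  have dw: "depth_le d n rs (size - 1)" "weft1 d n rs (size - 1)"
    using assms depth_weft_output by auto
  have "(\<exists>A \<in> set (node_alts d n rs (size - 1) True). sat_cnf ((!) bs) A) \<longleftrightarrow> circuit_value gs bs"
    if len: "length bs = n" for bs
  proof -
    \<comment> \<open>All literals speak about inputs, where the node values are the bits of the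
      assignment.\<close>
    have "sat_cnf ((!) bs) A \<longleftrightarrow> sat_cnf ((!) (node_values gate_value bs gs)) A"
      if "A \<in> set (node_alts d n rs (size - 1) True)" for A
      unfolding sat_cnf_def
      using node_alts_clauses[OF output_less dw that] node_values_input[of _ bs gate_value gs] len by auto
    then show ?thesis
      using sat_node_alts[OF len output_less dw, of True]
      by (simp add: circuit_value_def at_output_node len)
  qed
  then show ?thesis
    unfolding weighted_sat_def by blast
qed

end


section \<open>The reduction\<close>

definition tokens :: "bits \<Rightarrow> nat list" where
  "tokens x = fst (foldl (\<lambda>s b. if b then (fst s, Suc (snd s)) else (fst s @ [snd s], 0)) ([], 0) x)"

definition untokens :: "nat list \<Rightarrow> bits" where
  "untokens ts = concat (map enc_nat ts)"

text \<open>Every unary block is closed by a \<open>False\<close>, which resets the counter; so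
  after complete blocks the state is the list read so far with counter 0.\<close>

lemma tokens_untokens: "tokens (untokens ts) = ts"
proof -
  let ?F = "\<lambda>s b. if b then (fst s, Suc (snd s)) else (fst s @ [snd s], 0)"
  have one: "foldl ?F (ts, c) (replicate t True) = (ts, c + t)" for ts c t
    by (induction t arbitrary: c) auto
  have "foldl ?F ([], 0) (untokens ts) = (ts, 0)"
    by (induction ts rule: rev_induct) (auto simp: untokens_def enc_nat_def one)
  then show ?thesis
    by (simp add: tokens_def)
qed

definition gate_tokens :: "raw_gate \<Rightarrow> nat list" where
  "gate_tokens g =
     (if fst g = 0 then [0, nth_default 0 (snd g) 0] else fst g # length (snd g) # snd g)"

definition circuit_tokens :: "nat \<Rightarrow> raw_gate list \<Rightarrow> nat \<Rightarrow> nat list" where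
  "circuit_tokens n rs k = [n, length rs] @ concat (map gate_tokens rs) @ [k]"

lemma untokens_simps [simp]:
  "untokens [] = []" "untokens (t # ts) = enc_nat t @ untokens ts"
  "untokens (ts @ us) = untokens ts @ untokens us"
  by (simp_all add: untokens_def)

lemma enc_circuit_tokens: "enc_circuit (n, gs, k) = untokens (circuit_tokens n (map raw gs) k)"
proof -
  have "enc_gate g = untokens (gate_tokens (raw g))" for g
    by (cases g) (auto simp: gate_tokens_def enc_list_def untokens_def nth_default_def)
  then have "concat (map enc_gate gs) = untokens (concat (map gate_tokens (map raw gs)))"
    by (induction gs) auto
  then show ?thesis
    by (simp add: circuit_tokens_def enc_list_def)
qed

text \<open>The state consists of a position in \<open>ts\<close> and the gates read so far.\<close>

definition read_gate :: "nat list \<Rightarrow> nat \<times> raw_gate list \<Rightarrow> nat \<times> raw_gate list" where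
  "read_gate ts s =
     (if nth_default 0 ts (fst s) = 0
      then (fst s + 2, snd s @ [(0, [nth_default 0 ts (fst s + 1)])])
      else (fst s + (2 + nth_default 0 ts (fst s + 1)),
        snd s @ [(nth_default 0 ts (fst s), take (nth_default 0 ts (fst s + 1)) (drop (fst s + 2) ts))]))"

definition read_gates :: "nat list \<Rightarrow> nat \<times> raw_gate list" where
  "read_gates ts = (read_gate ts ^^ nth_default 0 ts 1) (2, [])"

text \<open>Characterises the lists of raw gates that come from gates.\<close>

definition canonical :: "raw_gate list \<Rightarrow> bool" where
  "canonical rs \<longleftrightarrow> (\<forall>g \<in> set rs. fst g \<le> 2 \<and> (fst g = 0 \<longrightarrow> length (snd g) = 1))"

lemma canonical_raw: "canonical (map raw gs)"
proof -
  have "fst (raw g) \<le> 2 \<and> (fst (raw g) = 0 \<longrightarrow> length (snd (raw g)) = 1)" for g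
    by (cases g) auto
  then show ?thesis
    by (simp add: canonical_def)
qed

lemma canonical_imp_raw: "canonical rs \<Longrightarrow> \<exists>gs. rs = map raw gs"
proof (induction rs)
  case (Cons g rs)
  have "\<exists>h. g = raw h"
  proof -
    have g: "fst g \<le> 2" "fst g = 0 \<longrightarrow> length (snd g) = 1"
      using Cons.prems by (auto simp: canonical_def)
    then consider "fst g = 0" | "fst g = 1" | "fst g = 2"
      by linarith
    then show ?thesis
    proof cases
      case 1
      then have "length (snd g) = 1" using g(2) by blast
      then obtain i where "snd g = [i]"
        by (auto simp: length_Suc_conv)
      then show ?thesis
        using 1 by (intro exI[of _ "Neg i"]) (simp add: prod_eq_iff)
    next
      case 2
      then show ?thesis by (intro exI[of _ "And (snd g)"]) (simp add: prod_eq_iff)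
    next
      case 3
      then show ?thesis by (intro exI[of _ "Or (snd g)"]) (simp add: prod_eq_iff)
    qed
  qed
  then obtain h where h: "g = raw h" ..
  obtain gs where "rs = map raw gs"
    using Cons by (auto simp: canonical_def)
  then have "g # rs = map raw (h # gs)"
    using h by simp
  then show ?case by (rule exI)
qed simp

lemma read_gate_tokens:
  assumes "fst g = 0 \<longrightarrow> length (snd g) = 1"
  shows "read_gate (us @ gate_tokens g @ vs) (length us, gs) =
    (length us + length (gate_tokens g), gs @ [g])"
proof (cases "fst g = 0")
  case True
  then have "length (snd g) = 1" using assms by blast
  then obtain i where "snd g = [i]"
    by (auto simp: length_Suc_conv)
  then show ?thesis
    using True by (auto simp: read_gate_def gate_tokens_def nth_default_def prod_eq_iff nth_append)
next
  case False
  then show ?thesis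
    by (auto simp: read_gate_def gate_tokens_def nth_default_def prod_eq_iff nth_append)
qed

lemma read_gates_tokens:
  assumes "canonical rs"
  shows "read_gates (circuit_tokens n rs k) = (2 + length (concat (map gate_tokens rs)), rs)"
proof -
  let ?ts = "circuit_tokens n rs k"
  have "(read_gate ?ts ^^ i) (2, []) = (2 + length (concat (map gate_tokens (take i rs))), take i rs)"
    if "i \<le> length rs" for i
    using that
  proof (induction i)
    case (Suc i)
    let ?us = "[n, length rs] @ concat (map gate_tokens (take i rs))"
    have "?ts = ?us @ gate_tokens (rs ! i) @ concat (map gate_tokens (drop (Suc i) rs)) @ [k]"
      using id_take_nth_drop[of i rs] Suc.prems unfolding circuit_tokens_def
      by (metis (no_types, lifting) Suc_le_lessD append.assoc concat.simps(2) concat_append list.simps(9) map_append)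
    moreover have "fst (rs ! i) = 0 \<longrightarrow> length (snd (rs ! i)) = 1"
      using assms Suc.prems by (simp add: canonical_def)
    ultimately have "read_gate ?ts (length ?us, take i rs) =
        (length ?us + length (gate_tokens (rs ! i)), take i rs @ [rs ! i])"
      using read_gate_tokens by metis
    then show ?case
      using Suc by (simp add: take_Suc_conv_app_nth)
  qed simp
  from this[of "length rs"] show ?thesis
    by (simp add: read_gates_def circuit_tokens_def nth_default_def)
qed

definition wf_raw :: "nat \<Rightarrow> raw_gate list \<Rightarrow> bool" where
  "wf_raw n rs \<longleftrightarrow> 0 < n \<and> (\<forall>j < length rs.
     (\<forall>i \<in> set (snd (nth_default (0, []) rs j)). i < n + j) \<and>
     distinct (snd (nth_default (0, []) rs j)) \<and>
     (\<not> fst (nth_default (0, []) rs j) = 0 \<longrightarrow> 2 \<le> length (snd (nth_default (0, []) rs j))))"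

lemma wf_raw_iff: "wf_raw n (map raw gs) \<longleftrightarrow> wf_circuit n gs"
proof -
  have "(\<forall>is. And is \<in> set gs \<or> Or is \<in> set gs \<longrightarrow> 2 \<le> length is) \<longleftrightarrow>
      (\<forall>g \<in> set gs. fst (raw g) \<noteq> 0 \<longrightarrow> 2 \<le> length (preds g))"
  proof
    assume *: "\<forall>is. And is \<in> set gs \<or> Or is \<in> set gs \<longrightarrow> 2 \<le> length is"
    show "\<forall>g \<in> set gs. fst (raw g) \<noteq> 0 \<longrightarrow> 2 \<le> length (preds g)"
    proof
      fix g assume g: "g \<in> set gs"
      show "fst (raw g) \<noteq> 0 \<longrightarrow> 2 \<le> length (preds g)"
        by (cases g) (use g * in auto)
    qed
  next
    assume *: "\<forall>g \<in> set gs. fst (raw g) \<noteq> 0 \<longrightarrow> 2 \<le> length (preds g)"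
    show "\<forall>is. And is \<in> set gs \<or> Or is \<in> set gs \<longrightarrow> 2 \<le> length is"
      using bspec[OF *, of "And _"] bspec[OF *, of "Or _"] by auto
  qed
  also have "\<dots> \<longleftrightarrow> (\<forall>j < length gs. fst (raw (gs ! j)) \<noteq> 0 \<longrightarrow> 2 \<le> length (preds (gs ! j)))"
    by (rule all_set_conv_all_nth)
  finally show ?thesis
    unfolding wf_raw_def wf_circuit_def by (auto simp: nth_default_nth snd_raw)
qed

definition inst_inputs :: "bits \<Rightarrow> nat" where
  "inst_inputs x = nth_default 0 (tokens x) 0"

definition inst_gates :: "bits \<Rightarrow> raw_gate list" where
  "inst_gates x = snd (read_gates (tokens x))"

definition inst_weight :: "bits \<Rightarrow> nat" where
  "inst_weight x = nth_default 0 (tokens x) (fst (read_gates (tokens x)))"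

definition inst_output :: "bits \<Rightarrow> nat" where
  "inst_output x = inst_inputs x + length (inst_gates x) - 1"

text \<open>The decoder never fails but returns something for every bit string. Malformed strings
  are recognised by encoding the result again and comparing with \<open>x\<close>.\<close>

definition is_instance :: "nat \<Rightarrow> bits \<Rightarrow> bool" where
  "is_instance d x \<longleftrightarrow> canonical (inst_gates x) \<and>
     untokens (circuit_tokens (inst_inputs x) (inst_gates x) (inst_weight x)) = x \<and>
     wf_raw (inst_inputs x) (inst_gates x) \<and>
     depth_le d (inst_inputs x) (inst_gates x) (inst_output x) \<and>
     weft1 d (inst_inputs x) (inst_gates x) (inst_output x)"

lemma inst_enc_circuit:
  "inst_inputs (enc_circuit (n, gs, k)) = n" "inst_gates (enc_circuit (n, gs, k)) = map raw gs"
  "inst_weight (enc_circuit (n, gs, k)) = k" "inst_output (enc_circuit (n, gs, k)) = n + length gs - 1"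
proof -
  note eqs = enc_circuit_tokens tokens_untokens read_gates_tokens[OF canonical_raw]
  show "inst_inputs (enc_circuit (n, gs, k)) = n" "inst_gates (enc_circuit (n, gs, k)) = map raw gs"
    unfolding inst_inputs_def inst_gates_def eqs
    by (auto simp: circuit_tokens_def nth_default_def)
  then show "inst_output (enc_circuit (n, gs, k)) = n + length gs - 1"
    unfolding inst_output_def by simp
  show "inst_weight (enc_circuit (n, gs, k)) = k"
    unfolding inst_weight_def eqs
    by (auto simp: circuit_tokens_def nth_default_def nth_append)
qed

lemma is_instance_enc_circuit:
  "is_instance d (enc_circuit (n, gs, k)) \<longleftrightarrow> wf_circuit n gs \<and> weft n gs \<le> 1 \<and> depth n gs \<le> d"
proof (cases "wf_circuit n gs")
  case True
  then show ?thesis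
    using circuit.depth_weft_output[OF circuit.intro[OF True], of d]
    unfolding is_instance_def inst_enc_circuit wf_raw_iff
    by (auto simp: canonical_raw enc_circuit_tokens simp del: enc_circuit.simps)
next
  case False
  then show ?thesis
    unfolding is_instance_def inst_enc_circuit wf_raw_iff by blast
qed

lemma is_instance_iff:
  "is_instance d x \<longleftrightarrow>
     x \<in> enc_circuit ` {(n, gs, k). wf_circuit n gs \<and> weft n gs \<le> 1 \<and> depth n gs \<le> d}"
proof
  assume x: "is_instance d x"
  then obtain gs where gs: "inst_gates x = map raw gs"
    using canonical_imp_raw unfolding is_instance_def by blast
  have "x = untokens (circuit_tokens (inst_inputs x) (inst_gates x) (inst_weight x))"
    using x unfolding is_instance_def by simp
  then have eq: "x = enc_circuit (inst_inputs x, gs, inst_weight x)"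
    unfolding enc_circuit_tokens gs .
  then have "is_instance d (enc_circuit (inst_inputs x, gs, inst_weight x))"
    using x by simp
  then show "x \<in> enc_circuit ` {(n, gs, k). wf_circuit n gs \<and> weft n gs \<le> 1 \<and> depth n gs \<le> d}"
    unfolding is_instance_enc_circuit by (intro image_eqI[where f = enc_circuit, OF eq]) simp
next
  assume "x \<in> enc_circuit ` {(n, gs, k). wf_circuit n gs \<and> weft n gs \<le> 1 \<and> depth n gs \<le> d}"
  then show "is_instance d x"
    using is_instance_enc_circuit by auto
qed

section \<open>The reduction and its correctness\<close>

definition inst_alts :: "nat \<Rightarrow> bits \<Rightarrow> cnf list" where
  "inst_alts d x = node_alts d (inst_inputs x) (inst_gates x) (inst_output x) True"

definition inst_ndp :: "nat \<Rightarrow> bits \<Rightarrow> ndp_instance" where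
  "inst_ndp d x = csp_ndp (length (slots (2 ^ d) (inst_weight x)))
     (Suc (length (slot_vals (2 ^ d) (inst_inputs x) (length (inst_alts d x)))))
     (csp_ok (2 ^ d) (inst_inputs x) (inst_weight x) (inst_alts d x))"

text \<open>Strings that encode no instance go to a fixed no-instance with parameter 0, the empty
  graph with a demand for one path.\<close>

definition reduction :: "nat \<Rightarrow> bits \<Rightarrow> bits" where
  "reduction d x = (if is_instance d x then enc_ndp (inst_ndp d x) else enc_ndp (0, [], [], 1))"

lemma length_slots: "length (slots a k) = (k + 1) ^ a"
  unfolding slots_def by (simp add: length_n_lists)

lemma max_ndp_empty: "max_ndp V E cap {} = 0"
proof -
  have "{M'. M' \<subseteq> {} \<and> routable V E cap M'} = {{}}"
    by (auto simp: routable_def)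
  then show ?thesis
    by (simp add: max_ndp_def)
qed

lemma encoded_problem_enc:
  assumes "inj enc" "i \<in> I"
  shows "enc i \<in> fst (encoded_problem enc I yes par) \<longleftrightarrow> yes i"
    and "snd (encoded_problem enc I yes par) (enc i) = par i"
  using assms by (auto simp: encoded_problem_def inj_image_mem_iff inv_into_f_f inj_on_subset dest: injD)

lemma ndp_no_instance: "enc_ndp (0, [], [], 1) \<notin> fst MaxNDP_unit_fvs"
  "snd MaxNDP_unit_fvs (enc_ndp (0, [], [], 1)) = 0"
proof -
  have inst: "(0, [], [], 1) \<in> ndp_instances"
    by (auto simp: ndp_instances_def simple_graph_def edges_def)
  show "enc_ndp (0, [], [], 1) \<notin> fst MaxNDP_unit_fvs"
    unfolding MaxNDP_unit_fvs_def
    by (subst encoded_problem_enc[OF inj_enc_ndp inst]) (simp add: max_ndp_empty)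
  have "feedback_vertex_set {..<0::nat} (edges []) {}"
    by (auto simp: feedback_vertex_set_def is_forest_def is_cycle_def)
  then have "fvs_number {..<0::nat} (edges []) \<le> 0"
    unfolding fvs_number_def by (intro Least_le) auto
  then show "snd MaxNDP_unit_fvs (enc_ndp (0, [], [], 1)) = 0"
    unfolding MaxNDP_unit_fvs_def by (subst encoded_problem_enc[OF inj_enc_ndp inst]) simp
qed

text \<open>The number of variables is \<open>K = (k + 1) ^ 2 ^ d\<close>, and at most
  \<open>3 * K * K\<close> vertices meet all cycles. The size of the circuit enters only the number
  of values, that is, the length of the lines.\<close>

lemma reduction_correct:
  "x \<in> fst (WCS 1 d) \<longleftrightarrow> reduction d x \<in> fst MaxNDP_unit_fvs"
  "snd MaxNDP_unit_fvs (reduction d x) \<le>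
     3 * (snd (WCS 1 d) x + 1) ^ 2 ^ d * (snd (WCS 1 d) x + 1) ^ 2 ^ d"
proof -
  let ?I = "{(n, gs, k). wf_circuit n gs \<and> weft n gs \<le> 1 \<and> depth n gs \<le> d}"
  have "(x \<in> fst (WCS 1 d) \<longleftrightarrow> reduction d x \<in> fst MaxNDP_unit_fvs) \<and>
    snd MaxNDP_unit_fvs (reduction d x) \<le>
     3 * (snd (WCS 1 d) x + 1) ^ 2 ^ d * (snd (WCS 1 d) x + 1) ^ 2 ^ d"
  proof (cases "is_instance d x")
    case True
    then obtain n gs k where x: "x = enc_circuit (n, gs, k)"
      and wf: "wf_circuit n gs" and wd: "weft n gs \<le> 1" "depth n gs \<le> d"
      unfolding is_instance_iff by auto
    interpret circuit n gs by (rule circuit.intro[OF wf])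
    let ?As = "node_alts d n rs (size - 1) True"
    let ?K = "length (slots (2 ^ d) k)" and ?N = "Suc (length (slot_vals (2 ^ d) n (length ?As)))"
    let ?ok = "csp_ok (2 ^ d) n k ?As"
    have in_I: "(n, gs, k) \<in> ?I"
      using wf wd by simp
    have wcs: "x \<in> fst (WCS 1 d) \<longleftrightarrow>
        (\<exists>bs. length bs = n \<and> count_list bs True = k \<and> circuit_value gs bs)" "snd (WCS 1 d) x = k"
      unfolding WCS_def x using encoded_problem_enc[OF inj_enc_circuit in_I] by simp_all
    interpret csp_graph ?K ?N ?ok
      by unfold_locales (simp_all add: length_slots)
    have ndp: "inst_ndp d x = csp_ndp ?K ?N ?ok"
      unfolding inst_ndp_def inst_alts_def x inst_enc_circuit ..
    have red: "reduction d x = enc_ndp (csp_ndp ?K ?N ?ok)"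
      using True ndp by (simp add: reduction_def)
    have dw: "depth_le d n rs (size - 1)" "weft1 d n rs (size - 1)"
      using wd depth_weft_output by auto
    have clauses: "length C \<le> 2 ^ d \<and> (\<forall>l \<in> set C. fst l < n)" if "A \<in> set ?As" "C \<in> set A" for A C
      using node_alts_clauses[OF output_less dw that] .
    have "enc_ndp (csp_ndp ?K ?N ?ok) \<in> fst MaxNDP_unit_fvs \<longleftrightarrow> csp_solvable ?K ?N ?ok"
      unfolding MaxNDP_unit_fvs_def encoded_problem_enc[OF inj_enc_ndp csp_ndp_instance]
      unfolding csp_ndp_def prod.case by (rule csp_ndp_yes)
    also have "\<dots> \<longleftrightarrow> weighted_sat n k ?As"
      by (rule csp_solvable_iff_weighted_sat) (use clauses in auto)
    also have "\<dots> \<longleftrightarrow> x \<in> fst (WCS 1 d)"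
      unfolding wcs by (rule weighted_sat_node_alts[OF wd])
    finally have "x \<in> fst (WCS 1 d) \<longleftrightarrow> reduction d x \<in> fst MaxNDP_unit_fvs"
      unfolding red by blast
    moreover have "snd MaxNDP_unit_fvs (reduction d x) \<le> 3 * ?K * ?K"
      unfolding red MaxNDP_unit_fvs_def encoded_problem_enc[OF inj_enc_ndp csp_ndp_instance]
      using fvs_number_le by (simp add: csp_ndp_def)
    ultimately show ?thesis
      unfolding wcs(2) length_slots by blast
  next
    case False
    then have "x \<notin> fst (WCS 1 d)"
      unfolding is_instance_iff WCS_def encoded_problem_def by auto
    then show ?thesis
      using False ndp_no_instance by (simp add: reduction_def)
  qed
  then show "x \<in> fst (WCS 1 d) \<longleftrightarrow> reduction d x \<in> fst MaxNDP_unit_fvs"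
    "snd MaxNDP_unit_fvs (reduction d x) \<le>
     3 * (snd (WCS 1 d) x + 1) ^ 2 ^ d * (snd (WCS 1 d) x + 1) ^ 2 ^ d"
    by auto
qed


section \<open>The reduction is computable in polynomial time\<close>

lemma poly_time_comp4:
  assumes "poly_time (\<lambda>p. g (fst p) (fst (snd p)) (fst (snd (snd p))) (snd (snd (snd p))))"
    "poly_time f1" "poly_time f2" "poly_time f3" "poly_time f4"
  shows "poly_time (\<lambda>x. g (f1 x) (f2 x) (f3 x) (f4 x))"
  using poly_time_comp3[where g = "\<lambda>a b c. g a b (fst c) (snd c)",
      OF assms(1-3) poly_time_Pair[OF assms(4,5)]] by simp

lemma poly_time_comp5:
  assumes "poly_time (\<lambda>p. g (fst p) (fst (snd p)) (fst (snd (snd p))) (fst (snd (snd (snd p))))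
      (snd (snd (snd (snd p)))))"
    "poly_time f1" "poly_time f2" "poly_time f3" "poly_time f4" "poly_time f5"
  shows "poly_time (\<lambda>x. g (f1 x) (f2 x) (f3 x) (f4 x) (f5 x))"
  using poly_time_comp4[where g = "\<lambda>a b c d. g a b c (fst d) (snd d)",
      OF assms(1-4) poly_time_Pair[OF assms(5,6)]] by simp

lemma poly_time_enc_nat [pt_intros]: "poly_time f \<Longrightarrow> poly_time (\<lambda>x. enc_nat (f x))"
  unfolding enc_nat_def by (intro pt_intros)

lemma poly_time_untokens [pt_intros]: "poly_time f \<Longrightarrow> poly_time (\<lambda>x. untokens (f x))"
  unfolding untokens_def by (intro pt_intros)

lemma poly_time_enc_pairs:
  assumes "poly_time f"
  shows "poly_time (\<lambda>x. enc_list enc_pair (f x))"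
proof -
  have eq: "enc_pair = (\<lambda>p. enc_nat (fst p) @ enc_nat (snd p))"
    by (auto simp: fun_eq_iff)
  show ?thesis
    unfolding enc_list_def eq by (intro pt_intros assms)
qed

lemma poly_time_enc_ndp:
  assumes "poly_time f"
  shows "poly_time (\<lambda>x. enc_ndp (f x))"
proof -
  have "enc_ndp p = enc_nat (fst p) @ enc_list enc_pair (fst (snd p)) @
      enc_list enc_pair (fst (snd (snd p))) @ enc_nat (snd (snd (snd p)))" for p
    by (cases p) auto
  then show ?thesis
    by (simp only:) (intro pt_intros poly_time_enc_pairs assms)
qed

lemma poly_time_line_len [pt_intros]:
  "poly_time K \<Longrightarrow> poly_time N \<Longrightarrow> poly_time (\<lambda>x. line_len (K x) (N x))"
  unfolding line_len_def by (intro pt_intros)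

lemma poly_time_lvert [pt_intros]:
  "poly_time K \<Longrightarrow> poly_time N \<Longrightarrow> poly_time a \<Longrightarrow> poly_time p \<Longrightarrow>
   poly_time (\<lambda>x. lvert (K x) (N x) (a x) (p x))"
  unfolding lvert_def by (intro pt_intros)

lemma poly_time_cell [pt_intros]:
  "poly_time K \<Longrightarrow> poly_time a \<Longrightarrow> poly_time c \<Longrightarrow> poly_time (\<lambda>x. cell (K x) (a x) (c x))"
  unfolding cell_def by (intro pt_intros)

lemma poly_time_hub_base [pt_intros]:
  "poly_time K \<Longrightarrow> poly_time N \<Longrightarrow> poly_time (\<lambda>x. hub_base (K x) (N x))"
  unfolding hub_base_def by (intro pt_intros)

lemma poly_time_hub [pt_intros]:
  "poly_time K \<Longrightarrow> poly_time N \<Longrightarrow> poly_time h \<Longrightarrow> poly_time (\<lambda>x. hub (K x) (N x) (h x))"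
  unfolding hub_def by (intro pt_intros)

lemma poly_time_hubs [pt_intros]:
  assumes "poly_time K"
  shows "poly_time (\<lambda>x. hubs (K x))"
  unfolding hubs_def by (intro pt_intros assms[THEN poly_time_comp])

lemma poly_time_hub_nbs [pt_intros]:
  assumes "poly_time K" "poly_time N" "poly_time h"
  shows "poly_time (\<lambda>x. hub_nbs (K x) (N x) (h x))"
  unfolding hub_nbs_def by (intro pt_intros assms[THEN poly_time_comp])

lemma poly_time_csp_edges [pt_intros]:
  assumes "poly_time K" "poly_time N"
  shows "poly_time (\<lambda>x. csp_edges (K x) (N x))"
  unfolding csp_edges_def by (intro pt_intros assms[THEN poly_time_comp])

text \<open>The constraint is itself a function and has no tree; instead of a program for it as an
  argument, its uncurried form in all five arguments has to be polynomial-time.\<close>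

lemma poly_time_csp_ndp:
  assumes "poly_time K" "poly_time N"
    and ok: "poly_time (\<lambda>p. ok (fst p) (fst (snd p)) (fst (snd (snd p))) (fst (snd (snd (snd p))))
      (snd (snd (snd (snd p)))))"
  shows "poly_time (\<lambda>x. csp_ndp (K x) (N x) (ok x))"
  unfolding csp_ndp_def csp_pairs_def hub_pairs_def
  by (intro pt_intros assms(1,2)[THEN poly_time_comp] poly_time_comp5[OF ok])

lemma poly_time_falsified [pt_intros]:
  "poly_time l \<Longrightarrow> poly_time g \<Longrightarrow> poly_time (\<lambda>x. falsified (l x) (g x))"
  unfolding falsified_def by (intro pt_intros)

lemma poly_time_slots [pt_intros]: "poly_time k \<Longrightarrow> poly_time (\<lambda>x. slots a (k x))"
  unfolding slots_def by (intro pt_intros)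

lemma poly_time_gap_pairs [pt_intros]:
  assumes "poly_time n"
  shows "poly_time (\<lambda>x. gap_pairs (n x))"
  unfolding gap_pairs_def by (intro pt_intros assms[THEN poly_time_comp])

lemma poly_time_slot_vals [pt_intros]:
  assumes "poly_time n" "poly_time m"
  shows "poly_time (\<lambda>x. slot_vals a (n x) (m x))"
  unfolding slot_vals_def by (intro pt_intros assms[THEN poly_time_comp])

lemma poly_time_slot_valid [pt_intros]:
  assumes "poly_time n" "poly_time k" "poly_time As" "poly_time J" "poly_time v"
  shows "poly_time (\<lambda>x. slot_valid a (n x) (k x) (As x) (J x) (v x))"
  unfolding slot_valid_def by (intro pt_intros assms[THEN poly_time_comp])

lemma poly_time_slots_agree [pt_intros]:
  assumes "poly_time J" "poly_time gs" "poly_time J'" "poly_time gs'"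
  shows "poly_time (\<lambda>x. slots_agree a (J x) (gs x) (J' x) (gs' x))"
  unfolding slots_agree_def by (intro pt_intros assms[THEN poly_time_comp])

lemma poly_time_csp_ok [pt_intros]:
  assumes "poly_time n" "poly_time k" "poly_time As" "poly_time i" "poly_time u" "poly_time j" "poly_time w"
  shows "poly_time (\<lambda>x. csp_ok a (n x) (k x) (As x) (i x) (u x) (j x) (w x))"
  unfolding csp_ok_def slot_ok_def by (intro pt_intros assms)

lemma poly_time_node_gate [pt_intros]:
  "poly_time n \<Longrightarrow> poly_time rs \<Longrightarrow> poly_time v \<Longrightarrow> poly_time (\<lambda>x. node_gate (n x) (rs x) (v x))"
  unfolding node_gate_def by (intro pt_intros)

lemma poly_time_node_pred [pt_intros]:
  "poly_time n \<Longrightarrow> poly_time rs \<Longrightarrow> poly_time v \<Longrightarrow> poly_time i \<Longrightarrow>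
   poly_time (\<lambda>x. node_pred (n x) (rs x) (v x) (i x))"
  unfolding node_pred_def by (intro pt_intros)

lemma poly_time_depth_le: "poly_time (\<lambda>p. depth_le e (fst p) (fst (snd p)) (snd (snd p)))"
proof (induction e)
  case 0
  show ?case unfolding depth_le.simps by (intro pt_intros)
next
  case (Suc e)
  show ?case unfolding depth_le.simps by (intro pt_intros poly_time_comp3[OF Suc.IH])
qed

lemma poly_time_weft0: "poly_time (\<lambda>p. weft0 e (fst p) (fst (snd p)) (snd (snd p)))"
proof (induction e)
  case 0
  show ?case unfolding weft0.simps by (intro pt_intros)
next
  case (Suc e)
  show ?case unfolding weft0.simps by (intro pt_intros poly_time_comp3[OF Suc.IH])
qed

lemma poly_time_weft1: "poly_time (\<lambda>p. weft1 e (fst p) (fst (snd p)) (snd (snd p)))"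
proof (induction e)
  case 0
  show ?case unfolding weft1.simps by (intro pt_intros)
next
  case (Suc e)
  show ?case unfolding weft1.simps
    by (intro pt_intros poly_time_comp3[OF Suc.IH] poly_time_comp3[OF poly_time_weft0])
qed

lemma poly_time_node_cnf:
  "poly_time (\<lambda>p. node_cnf e (fst p) (fst (snd p)) (fst (snd (snd p))) (snd (snd (snd p))))"
proof (induction e)
  case 0
  show ?case unfolding node_cnf.simps by (intro pt_intros)
next
  case (Suc e)
  show ?case unfolding node_cnf.simps by (intro pt_intros poly_time_comp4[OF Suc.IH])
qed

lemma poly_time_node_alts:
  "poly_time (\<lambda>p. node_alts e (fst p) (fst (snd p)) (fst (snd (snd p))) (snd (snd (snd p))))"
proof (induction e)
  case 0
  show ?case unfolding node_alts.simps by (intro pt_intros)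
next
  case (Suc e)
  show ?case unfolding node_alts.simps
    by (intro pt_intros poly_time_comp4[OF Suc.IH] poly_time_comp4[OF poly_time_node_cnf])
qed

lemma poly_time_tokens: "poly_time tokens"
proof -
  have "poly_time (\<lambda>x. foldl (\<lambda>s b. if b then (fst s, Suc (snd s)) else (fst s @ [snd s], 0)) ([], 0 :: nat) x)"
  proof (rule poly_time_foldl_additive[where h = "\<lambda>_. 10"])
    \<comment> \<open>Closing a block moves the counter into the list rather than copying it, so
      both branches add only a constant.\<close>
    show "tsz (if b then (fst s, Suc (snd s)) else (fst s @ [snd s], 0)) \<le> tsz s + 10"
      for s :: "nat list \<times> nat" and b
      using tsz_append[of "fst s" "[snd s]"] by (auto simp: tsz_prod)
  qed (intro pt_intros poly_bounded_const)+
  from poly_time_fst[OF this] show ?thesis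
    unfolding tokens_def[abs_def] .
qed

lemma tsz_take: "tsz (take i xs) \<le> tsz xs"
  using tsz_append[of "take i xs" "drop i xs"] tsize_pos[of "to_tree (drop i xs)"] by (simp del: tsize_pos)

lemma tsz_drop: "tsz (drop i xs) \<le> tsz xs"
  using tsz_append[of "take i xs" "drop i xs"] tsize_pos[of "to_tree (take i xs)"] by (simp del: tsize_pos)

lemma tsz_nth_default_0: "tsz (nth_default (0::nat) xs i) \<le> tsz xs"
proof (cases "i < length xs")
  case True
  then show ?thesis
    using tsz_member[of "xs ! i" xs] by (simp add: nth_default_def)
next
  case False
  then show ?thesis
    using tsize_pos[of "to_tree xs"] by (simp add: nth_default_def Suc_le_eq)
qed

text \<open>What a step appends and how far it moves the position are both read off
  \<open>ts\<close>, so the state grows per step by an amount linear in the size of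
  \<open>ts\<close>. This holds for malformed input too: positions past the end read as 0, and
  \<open>take\<close> copies no more than there is.\<close>

lemma poly_time_read_gates: "poly_time read_gates"
proof -
  have "poly_time (\<lambda>ts. (read_gate ts ^^ nth_default 0 ts 1) (2, []))"
  proof (rule poly_time_funpow[where h = "\<lambda>n. 10 * n + 30"])
    show "poly_time (\<lambda>p. read_gate (fst p) (snd p))"
      unfolding read_gate_def by (intro pt_intros)
    show "tsz (read_gate ts s) \<le> tsz s + (10 * tsz ts + 30)" for ts s
    proof -
      let ?a = "nth_default 0 ts (fst s)" and ?b = "nth_default 0 ts (fst s + 1)"
      let ?t = "take ?b (drop (fst s + 2) ts)"
      have "tsz ?a \<le> tsz ts" "tsz ?b \<le> tsz ts" "tsz ?t \<le> tsz ts"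
        using tsz_nth_default_0 tsz_take[of ?b "drop (fst s + 2) ts"] tsz_drop[of "fst s + 2" ts] by auto
      then show ?thesis
        using tsz_append[of "snd s" "[(0::nat, [?b])]"] tsz_append[of "snd s" "[(?a, ?t)]"]
        unfolding read_gate_def by (simp add: tsz_prod tsz_nat)
    qed
  qed (intro pt_intros poly_bounded_intros)+
  then show ?thesis
    unfolding read_gates_def[abs_def] .
qed

lemma poly_time_inst [pt_intros]:
  assumes "poly_time f"
  shows "poly_time (\<lambda>x. inst_inputs (f x))" "poly_time (\<lambda>x. inst_gates (f x))"
    "poly_time (\<lambda>x. inst_weight (f x))" "poly_time (\<lambda>x. inst_output (f x))"
  unfolding inst_inputs_def inst_gates_def inst_weight_def inst_output_def
  by (intro pt_intros poly_time_comp[OF poly_time_tokens] poly_time_comp[OF poly_time_read_gates] assms)+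

lemma poly_time_is_instance: "poly_time (is_instance d)"
  unfolding is_instance_def[abs_def] canonical_def wf_raw_def circuit_tokens_def gate_tokens_def
  by (intro pt_intros poly_time_eq_bits poly_time_distinct
      poly_time_comp3[OF poly_time_depth_le] poly_time_comp3[OF poly_time_weft1])

lemma poly_time_inst_alts [pt_intros]: "poly_time f \<Longrightarrow> poly_time (\<lambda>x. inst_alts d (f x))"
  unfolding inst_alts_def by (intro pt_intros poly_time_comp4[OF poly_time_node_alts])

lemma poly_time_reduction: "poly_time (reduction d)"
  unfolding reduction_def[abs_def] inst_ndp_def
  by (intro pt_intros poly_time_is_instance poly_time_enc_ndp poly_time_csp_ndp)

theorem theorem4:
  shows "W_hard 1 MaxNDP_unit_fvs"
  unfolding W_hard_def
proof
  fix A assume "A \<in> W 1"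
  then obtain d where "A \<le>\<^sub>f\<^sub>p\<^sub>t WCS 1 d"
    unfolding W_def by blast
  then show "A \<le>\<^sub>f\<^sub>p\<^sub>t MaxNDP_unit_fvs"
  proof (rule fpt_reducible_poly_time_trans[OF _ poly_time_reduction reduction_correct])
    show "poly_time (\<lambda>k::nat. 3 * (k + 1) ^ 2 ^ d * (k + 1) ^ 2 ^ d)"
      by (intro pt_intros)
    show "mono (\<lambda>k::nat. 3 * (k + 1) ^ 2 ^ d * (k + 1) ^ 2 ^ d)"
      by (auto intro!: monoI mult_le_mono power_mono)
  qed
qed

end
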